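(* Let $r\ge2$ and let $\Phi$ be an orientation preserving uniformly contracting $C^r$ IFS that is either Diophantine or not $C^r$ conjugate to a linear IFS, and let $\mathbf{p}$ be a strictly positive probability vector. Then there are $\alpha,\beta,C>0$ such that for every $\theta\in\mathbb{R}$ with $|\theta|>1$, $$\big\|P_{i\theta}^{\,n(\beta,\theta)}\big\|_{(\theta)}\ \le\ 1-\frac{C}{|\theta|^{\alpha}},\qquad n(\beta,\theta)=[\beta\cdot\log|\theta|],$$ where the operator norm on $H^1$ is taken with respect to the norm $\|\cdot\|_{(\theta)}$.
   Context: An IFS is a finite set $\Phi=\{f_1,\dots,f_N\}$ of differentiable strict contractions of a compact interval $I\subset\mathbb{R}$ into itself; it is $C^r$ if every $f_i$ is. Standing assumption: the fixed points $x_i$ of the $f_i$ are not all equal. The attractor $K_\Phi$ is the unique nonempty compact set with $K_\Phi=\bigcup_i f_i(K_\Phi)$. Uniformly contracting: $0<\inf_{f\in\Phi,x\in I}|f'(x)|\le\sup_{f\in\Phi,x\in I}|f'(x)|<1$. Orientation preserving: all $f'>0$. Diophantine: there are $l,c>0$ with $\inf_{y\in\mathbb{R}}\max_i d(\log|f_i'(x_i)|\cdot x+y,\mathbb{Z})\ge c|x|^{-l}$ for all real $x$ large enough in absolute value. A $C^2$ IFS $\Psi$ is linear if $g''=0$ on its attractor $K_\Psi$ for every $g\in\Psi$. $\Phi$ is $C^r$ conjugate to $\Psi$ if $\Phi=\{h\circ g\circ h^{-1}\}_{g\in\Psi}$ for some $C^r$ diffeomorphism $h$. Let $\mathcal{A}=\{1,\dots,N\}$,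 $x_\omega=\lim_m f_{\omega_1}\circ\cdots\circ f_{\omega_m}(x_0)$ for $\omega\in\mathcal{A}^{\mathbb{N}}$ (any $x_0\in I$), and $c(a,\omega)=-\log f_a'(x_\omega)$ for $a\in\mathcal{A}$. Let $\iota_a(\omega)=(a,\omega_1,\omega_2,\dots)$, $\rho=\sup_{f\in\Phi}\|f'\|_\infty$ and $d_\rho(\omega,\omega')=\rho^{\min\{n:\omega_n\ne\omega'_n\}}$. $H^1$ is the space of complex-valued functions on $\mathcal{A}^{\mathbb{N}}$ that are Lipschitz with respect to $d_\rho$, and $c_1(\varphi)$ is the Lipschitz constant of $\varphi$. For $\mathbf{p}=(p_1,\dots,p_N)$ with all $p_a>0$ and $\sum_a p_a=1$, the transfer operator $P_{i\theta}:H^1\to H^1$ is $$P_{i\theta}(\phi)(\omega)=\sum_{a\in\mathcal{A}}p_a\, e^{2\pi i\theta c(a,\omega)}\,\phi(\iota_a(\omega)).$$ For $\theta\neq0$, $\|\varphi\|_{(\theta)}=\max\{\|\varphi\|_\infty,\ c_1(\varphi)/(2C_6|\theta|)\}$, where $C_6>0$ is a fixed constant chosen so that $\|P_{i\theta}^n\|_{(\theta)}\le1$ for all $n$. $[\cdot]$ denotes the integer part.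
   Formalization: The bound is proved for |θ| > θ0, where θ0 > 1 is arbitrary but fixed before α, β, C; for all |θ| > 1 it is false, since n(β,θ) = 0 when 1 < |θ| < e^{1/β} and the identity has norm 1. *)

theory Defs
  imports "HOL-Analysis.Analysis"
begin

text \<open>
  An IFS with $N$ maps is a family \<open>f :: 'a \<Rightarrow> real \<Rightarrow> real\<close> indexed by a finite type of
  cardinality $N$, which is also the alphabet. The maps live on a compact interval \<open>I\<close>;
  their values off \<open>I\<close> are irrelevant, and derivatives at the endpoints of \<open>I\<close> are one-sided.
\<close>

definition deriv_within :: "real set \<Rightarrow> (real \<Rightarrow> real) \<Rightarrow> real \<Rightarrow> real" where
  "deriv_within I g = (\<lambda>x. vector_derivative g (at x within I))"

text \<open>
  For non-integer \<open>r\<close>, $C^r$ means that the derivative of order $\lfloor r\rfloor$ is Hoelder with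
  exponent $r - \lfloor r\rfloor$. For integer \<open>r\<close> and compact \<open>I\<close> the last conjunct
  follows from the second one, since \<open>t powr 0 = 1\<close> for \<open>t \<noteq> 0\<close>.
\<close>

definition Cr_on :: "real \<Rightarrow> real set \<Rightarrow> (real \<Rightarrow> real) \<Rightarrow> bool" where
  "Cr_on r I g \<longleftrightarrow>
     (let n = nat \<lfloor>r\<rfloor>; D = (\<lambda>k. (deriv_within I ^^ k) g) in
       (\<forall>k<n. D k differentiable_on I) \<and>
       continuous_on I (D n) \<and>
       (\<exists>L. \<forall>x\<in>I. \<forall>y\<in>I. \<bar>D n x - D n y\<bar> \<le> L * \<bar>x - y\<bar> powr frac r))"

definition Cr_diffeo :: "real \<Rightarrow> real set \<Rightarrow> real set \<Rightarrow> (real \<Rightarrow> real) \<Rightarrow> bool" where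
  "Cr_diffeo r J I h \<longleftrightarrow>
     bij_betw h J I \<and> Cr_on r J h \<and> Cr_on r I (inv_into J h)"

definition fixed_point :: "real set \<Rightarrow> (real \<Rightarrow> real) \<Rightarrow> real" where
  "fixed_point I g = (THE x. x \<in> I \<and> g x = x)"

text \<open>The last conjunct is the standing assumption that the fixed points are not all equal; it
  already rules out a degenerate interval.\<close>

definition ifs :: "real set \<Rightarrow> ('a::finite \<Rightarrow> real \<Rightarrow> real) \<Rightarrow> bool" where
  "ifs I f \<longleftrightarrow>
     (\<exists>u v. u < v \<and> I = {u..v}) \<and>
     (\<forall>a. f a ` I \<subseteq> I \<and> f a differentiable_on I \<and> (\<exists>L<1. L-lipschitz_on I (f a))) \<and>
     (\<exists>a b. fixed_point I (f a) \<noteq> fixed_point I (f b))"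

definition Cr_ifs :: "real \<Rightarrow> real set \<Rightarrow> ('a::finite \<Rightarrow> real \<Rightarrow> real) \<Rightarrow> bool" where
  "Cr_ifs r I f \<longleftrightarrow> ifs I f \<and> (\<forall>a. Cr_on r I (f a))"

definition attractor :: "real set \<Rightarrow> ('a::finite \<Rightarrow> real \<Rightarrow> real) \<Rightarrow> real set" where
  "attractor I f = (THE K. K \<noteq> {} \<and> compact K \<and> K \<subseteq> I \<and> K = (\<Union>a. f a ` K))"

text \<open>This is $\rho = \sup_{f\in\Phi}\|f'\|_\infty$.\<close>

definition max_contraction :: "real set \<Rightarrow> ('a::finite \<Rightarrow> real \<Rightarrow> real) \<Rightarrow> real" where
  "max_contraction I f = (SUP (a, x) \<in> UNIV \<times> I. \<bar>deriv_within I (f a) x\<bar>)"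

definition uniformly_contracting :: "real set \<Rightarrow> ('a::finite \<Rightarrow> real \<Rightarrow> real) \<Rightarrow> bool" where
  "uniformly_contracting I f \<longleftrightarrow>
     0 < (INF (a, x) \<in> UNIV \<times> I. \<bar>deriv_within I (f a) x\<bar>) \<and> max_contraction I f < 1"

definition orientation_preserving :: "real set \<Rightarrow> ('a::finite \<Rightarrow> real \<Rightarrow> real) \<Rightarrow> bool" where
  "orientation_preserving I f \<longleftrightarrow> (\<forall>a. \<forall>x\<in>I. deriv_within I (f a) x > 0)"

definition diophantine :: "real set \<Rightarrow> ('a::finite \<Rightarrow> real \<Rightarrow> real) \<Rightarrow> bool" where
  "diophantine I f \<longleftrightarrow>
     (\<exists>l>0. \<exists>c>0. \<forall>\<^sub>F x in at_infinity.
        (INF y. MAX a. infdist (ln \<bar>deriv_within I (f a) (fixed_point I (f a))\<bar> * x + y) \<int>)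
          \<ge> c * \<bar>x\<bar> powr (- l))"

definition linear_ifs :: "real set \<Rightarrow> ('a::finite \<Rightarrow> real \<Rightarrow> real) \<Rightarrow> bool" where
  "linear_ifs J g \<longleftrightarrow>
     Cr_ifs 2 J g \<and>
     (\<forall>a. \<forall>x \<in> attractor J g. (deriv_within J ^^ 2) (g a) x = 0)"

text \<open>Equality of the two sets of maps of \<open>I\<close>; the restriction discards the values off \<open>I\<close>.\<close>

definition Cr_conjugate ::
  "real \<Rightarrow> real set \<Rightarrow> ('a::finite \<Rightarrow> real \<Rightarrow> real) \<Rightarrow> real set \<Rightarrow> ('a \<Rightarrow> real \<Rightarrow> real) \<Rightarrow> bool" where
  "Cr_conjugate r I f J g \<longleftrightarrow>
     (\<exists>h. Cr_diffeo r J I h \<and>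
        range (\<lambda>a. restrict (f a) I) = range (\<lambda>a. restrict (h \<circ> g a \<circ> inv_into J h) I))"

text \<open>
  Conjugation by \<open>h\<close> is injective on maps, so a conjugate IFS has as many distinct maps as \<open>f\<close>
  and can be indexed by the same alphabet.
\<close>

definition conjugate_to_linear ::
  "real \<Rightarrow> real set \<Rightarrow> ('a::finite \<Rightarrow> real \<Rightarrow> real) \<Rightarrow> bool" where
  "conjugate_to_linear r I f \<longleftrightarrow>
     (\<exists>J (g :: 'a \<Rightarrow> real \<Rightarrow> real). linear_ifs J g \<and> Cr_conjugate r I f J g)"

text \<open>
  A word $\omega = (\omega_1, \omega_2, \dots)$ is a function on \<^typ>\<open>nat\<close> with
  $\omega_{n+1}$ equal to \<open>\<omega> n\<close>; \<open>word_map f \<omega> m\<close> is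
  $f_{\omega_1}\circ\cdots\circ f_{\omega_m}$.
\<close>

primrec word_map :: "('a \<Rightarrow> real \<Rightarrow> real) \<Rightarrow> (nat \<Rightarrow> 'a) \<Rightarrow> nat \<Rightarrow> real \<Rightarrow> real" where
  "word_map f \<omega> 0 = id"
| "word_map f \<omega> (Suc m) = word_map f \<omega> m \<circ> f (\<omega> m)"

definition coding :: "real set \<Rightarrow> ('a::finite \<Rightarrow> real \<Rightarrow> real) \<Rightarrow> (nat \<Rightarrow> 'a) \<Rightarrow> real" where
  "coding I f \<omega> = (THE x. \<forall>x0\<in>I. (\<lambda>m. word_map f \<omega> m x0) \<longlonglongrightarrow> x)"

definition cocycle ::
  "real set \<Rightarrow> ('a::finite \<Rightarrow> real \<Rightarrow> real) \<Rightarrow> 'a \<Rightarrow> (nat \<Rightarrow> 'a) \<Rightarrow> real" where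
  "cocycle I f a \<omega> = - ln (deriv_within I (f a) (coding I f \<omega>))"

definition prepend :: "'a \<Rightarrow> (nat \<Rightarrow> 'a) \<Rightarrow> nat \<Rightarrow> 'a" where
  "prepend a \<omega> = case_nat a \<omega>"

text \<open>Positions are counted from 1 in the exponent, hence the \<^term>\<open>Suc\<close>.\<close>

definition word_dist :: "real \<Rightarrow> (nat \<Rightarrow> 'a) \<Rightarrow> (nat \<Rightarrow> 'a) \<Rightarrow> real" where
  "word_dist \<rho> \<omega> \<omega>' =
     (if \<omega> = \<omega>' then 0 else \<rho> ^ Suc (LEAST n. \<omega> n \<noteq> \<omega>' n))"

definition lip_bounds :: "real \<Rightarrow> ((nat \<Rightarrow> 'a) \<Rightarrow> complex) \<Rightarrow> real set" where
  "lip_bounds \<rho> \<phi> =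
     {L. 0 \<le> L \<and> (\<forall>\<omega> \<omega>'. cmod (\<phi> \<omega> - \<phi> \<omega>') \<le> L * word_dist \<rho> \<omega> \<omega>')}"

definition H1 :: "real \<Rightarrow> ((nat \<Rightarrow> 'a) \<Rightarrow> complex) set" where
  "H1 \<rho> = {\<phi>. lip_bounds \<rho> \<phi> \<noteq> {}}"

definition lip_const :: "real \<Rightarrow> ((nat \<Rightarrow> 'a) \<Rightarrow> complex) \<Rightarrow> real" where
  "lip_const \<rho> \<phi> = Inf (lip_bounds \<rho> \<phi>)"

definition sup_norm :: "((nat \<Rightarrow> 'a) \<Rightarrow> complex) \<Rightarrow> real" where
  "sup_norm \<phi> = (SUP \<omega>. cmod (\<phi> \<omega>))"

definition theta_norm :: "real \<Rightarrow> real \<Rightarrow> real \<Rightarrow> ((nat \<Rightarrow> 'a) \<Rightarrow> complex) \<Rightarrow> real" where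
  "theta_norm \<rho> C6 \<theta> \<phi> =
     max (sup_norm \<phi>) (lip_const \<rho> \<phi> / (2 * C6 * \<bar>\<theta>\<bar>))"

text \<open>
  The supremum is a real one, so it is meaningful only for bounded operators; all operators below
  (powers of the transfer operator of a $C^2$ IFS) are bounded on $H^1$.
\<close>

definition theta_opnorm ::
  "real \<Rightarrow> real \<Rightarrow> real \<Rightarrow> (((nat \<Rightarrow> 'a) \<Rightarrow> complex) \<Rightarrow> (nat \<Rightarrow> 'a) \<Rightarrow> complex) \<Rightarrow> real" where
  "theta_opnorm \<rho> C6 \<theta> T =
     (SUP \<phi> \<in> {\<phi> \<in> H1 \<rho>. theta_norm \<rho> C6 \<theta> \<phi> \<le> 1}. theta_norm \<rho> C6 \<theta> (T \<phi>))"

definition transfer_op ::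
  "real set \<Rightarrow> ('a::finite \<Rightarrow> real \<Rightarrow> real) \<Rightarrow> ('a \<Rightarrow> real) \<Rightarrow> real \<Rightarrow>
   ((nat \<Rightarrow> 'a) \<Rightarrow> complex) \<Rightarrow> (nat \<Rightarrow> 'a) \<Rightarrow> complex" where
  "transfer_op I f p \<theta> \<phi> = (\<lambda>\<omega>. \<Sum>a\<in>UNIV.
     of_real (p a) * exp (2 * of_real pi * \<i> * of_real \<theta> * of_real (cocycle I f a \<omega>))
       * \<phi> (prepend a \<omega>))"

text \<open>
  Note that \<open>num_iter \<beta> \<theta> = 0\<close>, so that the corresponding power of the transfer operator is the
  identity, of norm 1, whenever $1 < |\theta| < e^{1/\beta}$. No uniform bound
  $1 - C|\theta|^{-\alpha}$ can therefore hold on all of $\{|\theta| > 1\}$; one has to stay away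
  from $|\theta| = 1$.
\<close>

definition num_iter :: "real \<Rightarrow> real \<Rightarrow> nat" where
  "num_iter \<beta> \<theta> = nat \<lfloor>\<beta> * ln \<bar>\<theta>\<bar>\<rfloor>"

end

theory Submission
  imports Defs "HOL-Real_Asymp.Real_Asymp"
begin

text \<open>
  Suppose that \<open>n\<close> iterates of $P_{i\theta}$ barely decrease the supremum norm of a function
  \<open>\<phi>\<close>. By convexity all terms of the sum defining $P_{i\theta}^n\phi$ at a maximum point are
  almost aligned, and since the preimages of this point are dense, the functions
  $g_j = P_{i\theta}^{n-j}\phi$ almost satisfy
  $e^{2\pi i\theta c(a,\omega)} g_{j+1}(\iota_a\omega) = g_j(\omega)$ with errors that are
  arbitrary negative powers of $|\theta|$. Evaluated at the fixed words this contradicts the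
  Diophantine condition. In the other case it shows that, up to such errors,
  $\theta(\psi_b(x) - \psi_b(y))$ is an integer for all \<open>x\<close>, \<open>y\<close> in the attractor, where
  $\psi_b = u\circ f_b + \log f_b' - u$ and \<open>u\<close> is the logarithm of the derivative of the
  Koenigs linearization of one map. If $\psi_b'$ is nonzero somewhere on the attractor then this
  fails for \<open>x\<close>, \<open>y\<close> at distance comparable to $1/|\theta|$. If $\psi_b'$ vanishes on the attractor for every \<open>b\<close>, then the IFS is
  conjugate to a linear one; the density of the conjugacy has to be modified off the attractor so
  that the conjugated maps are contractions.

  Decay of the supremum norm implies decay of the Lipschitz part of the norm, although the
  constant $C_6$ is only known to make the powers of $P_{i\theta}$ contractions.
\<close>

section \<open>Hoelder classes\<close>

text \<open>Two losses are balanced over words of length \<open>k\<close> of order log |\<theta>|.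
  Alignment along \<open>J\<close> letters divides the deficit \<open>\<epsilon>\<close> by
  \<open>pmin ^ J\<close>, a power of |\<theta>| that is paid for by a large exponent \<alpha>.
  Passing from preimages to arbitrary points costs a Lipschitz constant of order |\<theta>| times
  \<open>\<rho> ^ k\<close>. Both errors become negative powers of |\<theta>| whose exponent grows
  with the ratio \<tau> of \<open>k\<close> to log |\<theta>|, whereas the lower bound furnished by
  either alternative has an exponent independent of \<tau>. Since \<open>g j\<close> changes with
  \<open>j\<close>, no eigenfunction is at hand; only products of one value of \<open>g\<close> with
  the conjugate of another carry information, and the common phase they leave open matches the free
  \<open>y\<close> of the Diophantine condition. The usual Lipschitz estimate for one step of the
  operator has a source term proportional to |\<theta>| times the sup norm; it lowers the Lipschitz
  part of the norm only when C6 is large enough. For an arbitrary admissible C6 the contraction is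
  drawn from the assumed stability itself, by means of an extremal test function.\<close>

lemma deriv_within_eq:
  assumes "\<exists>u v. u < v \<and> I = {u..v}" "x \<in> I" "(g has_real_derivative d) (at x within I)"
  shows "deriv_within I g x = d"
proof -
  obtain u v where "u < v" "I = {u..v}" using assms(1) by auto
  then show ?thesis
    using assms vector_derivative_within_closed_interval[of u v x g d]
    by (auto simp: deriv_within_def has_real_derivative_iff_has_vector_derivative)
qed

lemma has_deriv_within:
  assumes "g differentiable_on I" "x \<in> I"
  shows "(g has_real_derivative deriv_within I g x) (at x within I)"
  using assms
  by (auto simp: deriv_within_def has_real_derivative_iff_has_vector_derivative
      differentiable_on_def vector_derivative_works[symmetric])

lemma DERIV_ln_within:
  fixes g :: "real \<Rightarrow> real"
  assumes "(g has_real_derivative d) (at x within I)" "g x > 0"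
  shows "((\<lambda>x. ln (g x)) has_real_derivative inverse (g x) * d) (at x within I)"
  using DERIV_chain2[OF DERIV_ln[OF assms(2)] assms(1)] .

text \<open>The condition of \<open>Cr_on\<close> with one derivative peeled off at a time, so that
  closure properties can be proved by induction on the order with the function generalized.\<close>

primrec holder_class :: "nat \<Rightarrow> real \<Rightarrow> real set \<Rightarrow> (real \<Rightarrow> real) \<Rightarrow> bool" where
  "holder_class 0 \<alpha> I g \<longleftrightarrow>
     continuous_on I g \<and> (\<exists>L. \<forall>x\<in>I. \<forall>y\<in>I. \<bar>g x - g y\<bar> \<le> L * \<bar>x - y\<bar> powr \<alpha>)"
| "holder_class (Suc k) \<alpha> I g \<longleftrightarrow>
     g differentiable_on I \<and> holder_class k \<alpha> I (deriv_within I g)"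

lemma holder_class_funpow:
  "holder_class n \<alpha> I g \<longleftrightarrow>
    (\<forall>k<n. (deriv_within I ^^ k) g differentiable_on I) \<and> continuous_on I ((deriv_within I ^^ n) g) \<and>
    (\<exists>L. \<forall>x\<in>I. \<forall>y\<in>I. \<bar>(deriv_within I ^^ n) g x - (deriv_within I ^^ n) g y\<bar> \<le> L * \<bar>x - y\<bar> powr \<alpha>)"
proof (induction n arbitrary: g)
  case (Suc n)
  have "(\<forall>k<Suc n. (deriv_within I ^^ k) g differentiable_on I) \<longleftrightarrow>
    g differentiable_on I \<and> (\<forall>k<n. (deriv_within I ^^ k) (deriv_within I g) differentiable_on I)"
    by (auto simp: less_Suc_eq_0_disj funpow_swap1)
  then show ?case using Suc[of "deriv_within I g"] by (simp add: funpow_swap1)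
qed auto

lemma Cr_on_iff_holder_class: "Cr_on r I g \<longleftrightarrow> holder_class (nat \<lfloor>r\<rfloor>) (frac r) I g"
  by (simp add: Cr_on_def Let_def holder_class_funpow)

locale segment =
  fixes I :: "real set"
  assumes segment: "\<exists>u v. u < v \<and> I = {u..v}"
begin

lemma compact_I [simp]: "compact I" and convex_I [simp]: "convex I" and connected_I [simp]: "connected I"
  and nonempty_I [simp]: "I \<noteq> {}"
  using segment by auto

lemma deriv_eq: "x \<in> I \<Longrightarrow> (g has_real_derivative d) (at x within I) \<Longrightarrow> deriv_within I g x = d"
  using deriv_within_eq segment by blast

lemma abs_bound:
  fixes g :: "real \<Rightarrow> real"
  assumes "continuous_on I g"
  obtains C where "C > 0" "\<And>x. x \<in> I \<Longrightarrow> \<bar>g x\<bar> \<le> C"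
proof -
  have "bounded (g ` I)" using assms by (intro compact_imp_bounded compact_continuous_image) auto
  then show ?thesis using that unfolding bounded_pos by auto
qed

lemma diam: obtains D where "D > 0" "\<And>x y. x \<in> I \<Longrightarrow> y \<in> I \<Longrightarrow> \<bar>x - y\<bar> \<le> D"
proof -
  obtain u v where uv: "u < v" "I = {u..v}" using segment by auto
  show ?thesis by (rule that[of "v - u"]) (use uv in auto)
qed

lemma lipschitz_bound:
  assumes "\<And>x. x \<in> I \<Longrightarrow> (g has_real_derivative g' x) (at x within I)"
    "\<And>x. x \<in> I \<Longrightarrow> \<bar>g' x\<bar> \<le> L" "x \<in> I" "y \<in> I"
  shows "\<bar>g x - g y\<bar> \<le> L * \<bar>x - y\<bar>"
  using field_differentiable_bound[of I g g' L x y] assms by auto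

lemma pos_lower_bound:
  assumes "continuous_on I g" "\<And>x. x \<in> I \<Longrightarrow> g x > (0::real)"
  obtains m where "m > 0" "\<And>x. x \<in> I \<Longrightarrow> m \<le> g x"
proof -
  obtain x0 where x0: "x0 \<in> I" "\<forall>y\<in>I. g x0 \<le> g y"
    using continuous_attains_inf[of I g] assms(1) by auto
  show ?thesis using that[of "g x0"] x0 assms(2) by auto
qed

lemma holder_class_cong:
  "holder_class k \<alpha> I g \<Longrightarrow> (\<And>x. x \<in> I \<Longrightarrow> g x = h x) \<Longrightarrow> holder_class k \<alpha> I h"
proof (induction k arbitrary: g h)
  case 0
  then show ?case using continuous_on_cong[of I I g h] by auto
next
  case (Suc k)
  have d: "(h has_real_derivative deriv_within I g x) (at x within I)" if "x \<in> I" for x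
    using has_deriv_within[of g I x] Suc.prems that
    by (auto simp: has_field_derivative_def intro: has_derivative_transform[of x I h g])
  then have "h differentiable_on I"
    by (meson differentiable_on_def has_field_derivative_imp_has_derivative differentiable_def)
  moreover have "holder_class k \<alpha> I (deriv_within I h)"
    using Suc.IH[of "deriv_within I g" "deriv_within I h"] Suc.prems deriv_eq[OF _ d] by auto
  ultimately show ?case by simp
qed

text \<open>One-sided derivatives on a nondegenerate interval are unique, so any explicit formula
  for the derivative may stand in for \<open>deriv_within I g\<close>.\<close>

lemma holder_class_SucI:
  assumes "\<And>x. x \<in> I \<Longrightarrow> (g has_real_derivative g' x) (at x within I)" "holder_class k \<alpha> I g'"
  shows "holder_class (Suc k) \<alpha> I g"
proof -
  have "g differentiable_on I" using assms(1)
    by (meson differentiable_on_def has_field_derivative_imp_has_derivative differentiable_def)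
  moreover have "holder_class k \<alpha> I (deriv_within I g)"
    using holder_class_cong[OF assms(2)] deriv_eq[OF _ assms(1)] by metis
  ultimately show ?thesis by simp
qed

lemma holder_class_SucD:
  assumes "holder_class (Suc k) \<alpha> I g"
  shows "\<And>x. x \<in> I \<Longrightarrow> (g has_real_derivative deriv_within I g x) (at x within I)"
    "holder_class k \<alpha> I (deriv_within I g)"
  using assms has_deriv_within by auto

lemma holder_class_continuous: "holder_class k \<alpha> I g \<Longrightarrow> continuous_on I g"
  by (cases k) (auto intro: differentiable_imp_continuous_on)

end

text \<open>An exponent at most 1 makes Lipschitz functions on a bounded interval Hoelder, hence the
  classes decrease with the order. The value 0 is the case of integer \<open>r\<close>.\<close>

locale holder_segment = segment +
  fixes \<alpha> :: real
  assumes alpha: "0 \<le> \<alpha>" "\<alpha> \<le> 1"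
begin

lemma lipschitz_imp_holder:
  assumes "\<And>x y. x \<in> I \<Longrightarrow> y \<in> I \<Longrightarrow> \<bar>g x - g y\<bar> \<le> L * \<bar>x - y\<bar>"
  shows "holder_class 0 \<alpha> I g"
proof -
  obtain D where D: "D > 0" "\<And>x y. x \<in> I \<Longrightarrow> y \<in> I \<Longrightarrow> \<bar>x - y\<bar> \<le> D" using diam by blast
  have "\<bar>L\<bar>-lipschitz_on I g"
  proof (rule lipschitz_onI)
    fix x y assume "x \<in> I" "y \<in> I"
    then show "dist (g x) (g y) \<le> \<bar>L\<bar> * dist x y"
      using assms[of x y] mult_right_mono[OF abs_ge_self[of L], of "\<bar>x - y\<bar>"] by (simp add: dist_real_def)
  qed auto
  then have "continuous_on I g" using lipschitz_on_continuous_on by blast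
  moreover have "\<bar>g x - g y\<bar> \<le> \<bar>L\<bar> * D powr (1 - \<alpha>) * \<bar>x - y\<bar> powr \<alpha>" if "x \<in> I" "y \<in> I" for x y
  proof (cases "x = y")
    case False
    have "\<bar>g x - g y\<bar> \<le> \<bar>L\<bar> * \<bar>x - y\<bar>" 
      using assms[OF that] mult_right_mono[OF abs_ge_self[of L], of "\<bar>x - y\<bar>"] by linarith
    also have "\<bar>x - y\<bar> = \<bar>x - y\<bar> powr (1 - \<alpha>) * \<bar>x - y\<bar> powr \<alpha>"
      using False by (simp flip: powr_add)
    also have "\<bar>L\<bar> * \<dots> \<le> \<bar>L\<bar> * (D powr (1 - \<alpha>) * \<bar>x - y\<bar> powr \<alpha>)"
      using D(2)[OF that] alpha by (intro mult_left_mono mult_right_mono powr_mono2) auto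
    finally show ?thesis by (simp add: mult.assoc)
  qed auto
  ultimately show ?thesis by auto
qed

lemma holder_class_Suc_le: "holder_class (Suc k) \<alpha> I g \<Longrightarrow> holder_class k \<alpha> I g"
proof (induction k arbitrary: g)
  case 0
  then have d: "\<And>x. x \<in> I \<Longrightarrow> (g has_real_derivative deriv_within I g x) (at x within I)"
    and c: "continuous_on I (deriv_within I g)"
    using holder_class_SucD[of 0 \<alpha> g] by auto
  obtain C where "\<And>x. x \<in> I \<Longrightarrow> \<bar>deriv_within I g x\<bar> \<le> C" using abs_bound[OF c] by blast
  then show ?case using lipschitz_bound[OF d] lipschitz_imp_holder by blast
qed auto

lemma holder_class_le: "j \<le> k \<Longrightarrow> holder_class k \<alpha> I g \<Longrightarrow> holder_class j \<alpha> I g"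
proof (induction k)
  case (Suc k)
  then show ?case using holder_class_Suc_le[of k g] by (metis le_Suc_eq)
qed auto

lemma holder_class_const: "holder_class k \<alpha> I (\<lambda>x. c)"
proof (induction k arbitrary: c)
  case 0
  show ?case by (auto intro!: exI[of _ 0])
next
  case (Suc k)
  show ?case by (rule holder_class_SucI[of _ "\<lambda>x. 0"]) (auto intro!: Suc)
qed

lemma holder_class_add:
  "holder_class k \<alpha> I g \<Longrightarrow> holder_class k \<alpha> I h \<Longrightarrow> holder_class k \<alpha> I (\<lambda>x. g x + h x)"
proof (induction k arbitrary: g h)
  case 0
  then obtain L M where LM: "\<forall>x\<in>I. \<forall>y\<in>I. \<bar>g x - g y\<bar> \<le> L * \<bar>x - y\<bar> powr \<alpha>"
    "\<forall>x\<in>I. \<forall>y\<in>I. \<bar>h x - h y\<bar> \<le> M * \<bar>x - y\<bar> powr \<alpha>" by auto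
  have "\<bar>g x + h x - (g y + h y)\<bar> \<le> (L + M) * \<bar>x - y\<bar> powr \<alpha>" if "x \<in> I" "y \<in> I" for x y
    using LM that by (force simp: distrib_right)
  then show ?case using 0 by (auto intro!: continuous_intros)
next
  case (Suc k)
  show ?case
    by (rule holder_class_SucI[of _ "\<lambda>x. deriv_within I g x + deriv_within I h x"])
       (use Suc holder_class_SucD in \<open>auto intro!: derivative_eq_intros\<close>)
qed

lemma holder_class_mult:
  "holder_class k \<alpha> I g \<Longrightarrow> holder_class k \<alpha> I h \<Longrightarrow> holder_class k \<alpha> I (\<lambda>x. g x * h x)"
proof (induction k arbitrary: g h)
  case 0
  then obtain L M where LM: "\<forall>x\<in>I. \<forall>y\<in>I. \<bar>g x - g y\<bar> \<le> L * \<bar>x - y\<bar> powr \<alpha>"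
    "\<forall>x\<in>I. \<forall>y\<in>I. \<bar>h x - h y\<bar> \<le> M * \<bar>x - y\<bar> powr \<alpha>" by auto
  obtain A where A: "A > 0" "\<And>x. x \<in> I \<Longrightarrow> \<bar>g x\<bar> \<le> A" using abs_bound[of g] 0 by auto
  obtain B where B: "B > 0" "\<And>x. x \<in> I \<Longrightarrow> \<bar>h x\<bar> \<le> B" using abs_bound[of h] 0 by auto
  have "\<bar>g x * h x - g y * h y\<bar> \<le> (A * M + B * L) * \<bar>x - y\<bar> powr \<alpha>" if xy: "x \<in> I" "y \<in> I" for x y
  proof -
    have "\<bar>g x * h x - g y * h y\<bar> = \<bar>g x * (h x - h y) + h y * (g x - g y)\<bar>" by (simp add: algebra_simps)
    also have "\<dots> \<le> \<bar>g x\<bar> * \<bar>h x - h y\<bar> + \<bar>h y\<bar> * \<bar>g x - g y\<bar>" 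
      by (metis abs_mult abs_triangle_ineq)
    also have "\<dots> \<le> A * (M * \<bar>x - y\<bar> powr \<alpha>) + B * (L * \<bar>x - y\<bar> powr \<alpha>)"
      using A B LM xy by (intro add_mono mult_mono) auto
    finally show ?thesis by (simp add: algebra_simps)
  qed
  then show ?case using 0 by (auto intro!: continuous_intros)
next
  case (Suc k)
  note 1 = holder_class_SucD[OF Suc.prems(1)] holder_class_SucD[OF Suc.prems(2)]
  show ?case
  proof (rule holder_class_SucI)
    show "((\<lambda>x. g x * h x) has_real_derivative
      (deriv_within I g x * h x + g x * deriv_within I h x)) (at x within I)" if "x \<in> I" for x
      using 1 that by (auto intro!: derivative_eq_intros)
    show "holder_class k \<alpha> I (\<lambda>x. deriv_within I g x * h x + g x * deriv_within I h x)"
      by (intro holder_class_add Suc.IH 1 Suc.prems[THEN holder_class_Suc_le])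
  qed
qed

lemma holder_class_cmult: "holder_class k \<alpha> I g \<Longrightarrow> holder_class k \<alpha> I (\<lambda>x. c * g x)"
  by (intro holder_class_mult holder_class_const)

lemma holder_class_power: "holder_class k \<alpha> I g \<Longrightarrow> holder_class k \<alpha> I (\<lambda>x. g x ^ n)"
  by (induction n) (auto intro!: holder_class_const holder_class_mult)

lemma holder_class_sum:
  "finite A \<Longrightarrow> (\<And>i. i \<in> A \<Longrightarrow> holder_class k \<alpha> I (g i)) \<Longrightarrow> holder_class k \<alpha> I (\<lambda>x. \<Sum>i\<in>A. g i x)"
  by (induction A rule: finite_induct) (auto intro!: holder_class_const holder_class_add)

text \<open>The image of \<open>I\<close> is a compact interval, on which a continuous derivative
  makes \<open>F\<close> Lipschitz. This is the base case for exp, inverse and ln; their higher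
  orders follow from the shape of their derivatives.\<close>

lemma holder_class_0_comp:
  assumes g: "holder_class 0 \<alpha> I g"
    and F: "\<And>y. y \<in> g ` I \<Longrightarrow> (F has_real_derivative F' y) (at y)" "continuous_on (g ` I) F'"
  shows "holder_class 0 \<alpha> I (\<lambda>x. F (g x))"
proof -
  have cg: "continuous_on I g" using g by auto
  have co: "compact (g ` I)" "connected (g ` I)"
    using cg by (auto intro!: compact_continuous_image connected_continuous_image)
  then have conv: "convex (g ` I)" by (simp add: convex_contains_segment connected_contains_Icc closed_segment_eq_real_ivl)
  have "bounded (F' ` g ` I)" by (rule compact_imp_bounded[OF compact_continuous_image[OF F(2) co(1)]])
  then obtain B where B: "\<And>y. y \<in> g ` I \<Longrightarrow> \<bar>F' y\<bar> \<le> B" unfolding bounded_pos by auto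
  obtain L where L: "\<forall>x\<in>I. \<forall>y\<in>I. \<bar>g x - g y\<bar> \<le> L * \<bar>x - y\<bar> powr \<alpha>" using g by auto
  have "continuous_on (g ` I) F"
    using F(1) by (meson DERIV_isCont continuous_at_imp_continuous_on)
  then have "continuous_on I (\<lambda>x. F (g x))" using cg continuous_on_compose2 by blast
  moreover have "\<bar>F (g x) - F (g y)\<bar> \<le> B * L * \<bar>x - y\<bar> powr \<alpha>" if "x \<in> I" "y \<in> I" for x y
  proof -
    have B0: "0 \<le> B" using B[of "g x"] that by fastforce
    have "\<bar>F (g x) - F (g y)\<bar> \<le> B * \<bar>g x - g y\<bar>"
      using field_differentiable_bound[OF conv, of F F' B "g x" "g y"] B F(1) that
      by (auto intro: has_field_derivative_at_within)
    also have "\<dots> \<le> B * (L * \<bar>x - y\<bar> powr \<alpha>)" using L that B0 by (intro mult_left_mono) auto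
    finally show ?thesis by (simp add: mult.assoc)
  qed
  ultimately show ?thesis by auto
qed

lemma holder_class_exp: "holder_class k \<alpha> I g \<Longrightarrow> holder_class k \<alpha> I (\<lambda>x. exp (g x))"
proof (induction k arbitrary: g)
  case 0
  then show ?case
    by (rule holder_class_0_comp[where g = g and F' = exp]) (auto simp: continuous_on_exp)
next
  case (Suc k)
  note 1 = holder_class_SucD[OF Suc.prems(1)]
  show ?case
  proof (rule holder_class_SucI)
    show "((\<lambda>x. exp (g x)) has_real_derivative exp (g x) * deriv_within I g x) (at x within I)"
      if "x \<in> I" for x
      using 1 that by (auto intro!: derivative_eq_intros)
    show "holder_class k \<alpha> I (\<lambda>x. exp (g x) * deriv_within I g x)"
      by (intro holder_class_mult Suc.IH 1 holder_class_Suc_le[OF Suc.prems])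
  qed
qed

lemma holder_class_inverse:
  "holder_class k \<alpha> I g \<Longrightarrow> (\<And>x. x \<in> I \<Longrightarrow> g x > 0) \<Longrightarrow> holder_class k \<alpha> I (\<lambda>x. inverse (g x))"
proof (induction k arbitrary: g)
  case 0
  show ?case
  proof (rule holder_class_0_comp[where g = g and F = inverse and F' = "\<lambda>y. - (inverse y * inverse y)"])
    show "(inverse has_real_derivative - (inverse y * inverse y)) (at y)" if "y \<in> g ` I" for y
      using that 0(2) DERIV_inverse[of y] by (force simp: power2_eq_square)
    show "continuous_on (g ` I) (\<lambda>y. - (inverse y * inverse y))"
      using 0(2) by (force intro!: continuous_on_minus continuous_on_mult continuous_on_inverse)
  qed (rule 0)
next
  case (Suc k)
  note 1 = holder_class_SucD[OF Suc.prems(1)]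
  show ?case
  proof (rule holder_class_SucI)
    show "((\<lambda>x. inverse (g x)) has_real_derivative
      (-1) * (inverse (g x) * inverse (g x) * deriv_within I g x)) (at x within I)" if "x \<in> I" for x
      using 1 that Suc.prems by (auto intro!: derivative_eq_intros simp: less_imp_neq[symmetric])
    have "holder_class k \<alpha> I (\<lambda>x. inverse (g x))"
      using Suc holder_class_Suc_le by blast
    then show "holder_class k \<alpha> I (\<lambda>x. (-1) * (inverse (g x) * inverse (g x) * deriv_within I g x))"
      using 1 by (intro holder_class_mult holder_class_const) auto
  qed
qed

lemma holder_class_ln:
  assumes g: "holder_class k \<alpha> I g" "\<And>x. x \<in> I \<Longrightarrow> g x > 0"
  shows "holder_class k \<alpha> I (\<lambda>x. ln (g x))"
proof (cases k)
  case 0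
  show ?thesis unfolding 0
  proof (rule holder_class_0_comp[where g = g and F = ln and F' = inverse])
    show "(ln has_real_derivative inverse y) (at y)" if "y \<in> g ` I" for y
      using that g(2) by (auto intro!: DERIV_ln)
    show "continuous_on (g ` I) inverse"
      using g(2) continuous_on_inverse[OF continuous_on_id, of "g ` I"] by (force simp: id_def)
  qed (use g 0 in auto)
next
  case (Suc j)
  note 1 = holder_class_SucD[OF g(1)[unfolded Suc]]
  have "holder_class j \<alpha> I (\<lambda>x. inverse (g x) * deriv_within I g x)"
    using g by (intro holder_class_mult holder_class_inverse 1 holder_class_Suc_le[of j g]) (auto simp: Suc)
  then show ?thesis unfolding Suc
    by (rule holder_class_SucI[rotated]) (rule DERIV_ln_within[OF 1(1) g(2)])
qed

end

lemma deriv_chain_within: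
  assumes "(g has_real_derivative d) (at (q x) within I)" "(q has_real_derivative e) (at x within J)"
    "q ` J \<subseteq> I"
  shows "((\<lambda>x. g (q x)) has_real_derivative d * e) (at x within J)"
  using DERIV_image_chain[of g d q x J e] assms has_field_derivative_subset[OF assms(1,3)]
  by (auto simp: o_def)

text \<open>Composing two Hoelder functions multiplies the exponents; the Lipschitz bound on
  \<open>q\<close> is what keeps \<alpha> at order 0. Higher orders follow by the chain rule, with
  the same \<open>q\<close> throughout the induction.\<close>

lemma holder_class_comp:
  assumes "holder_segment I \<alpha>" "holder_segment J \<alpha>"
    and qJ: "q ` J \<subseteq> I" and lip: "\<And>x y. x \<in> J \<Longrightarrow> y \<in> J \<Longrightarrow> \<bar>q x - q y\<bar> \<le> L * \<bar>x - y\<bar>"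
  shows "holder_class k \<alpha> I g \<Longrightarrow> holder_class k \<alpha> J q \<Longrightarrow> holder_class k \<alpha> J (\<lambda>x. g (q x))"
proof -
  interpret I: holder_segment I \<alpha> by fact
  interpret J: holder_segment J \<alpha> by fact
  show "holder_class k \<alpha> J (\<lambda>x. g (q x))"
    if "holder_class k \<alpha> I g" "holder_class k \<alpha> J q"
    using that
  proof (induction k arbitrary: g)
    case 0
    then obtain M where M: "\<forall>x\<in>I. \<forall>y\<in>I. \<bar>g x - g y\<bar> \<le> M * \<bar>x - y\<bar> powr \<alpha>" by auto
    have "\<bar>g (q x) - g (q y)\<bar> \<le> (\<bar>M\<bar> * \<bar>L\<bar> powr \<alpha>) * \<bar>x - y\<bar> powr \<alpha>" if "x \<in> J" "y \<in> J" for x y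
    proof (cases "x = y")
      case False
      have "L * \<bar>x - y\<bar> \<le> \<bar>L\<bar> * \<bar>x - y\<bar>" by (intro mult_right_mono) auto
      then have 1: "\<bar>q x - q y\<bar> \<le> \<bar>L\<bar> * \<bar>x - y\<bar>" using lip[OF that] by linarith
      have "\<bar>g (q x) - g (q y)\<bar> \<le> M * \<bar>q x - q y\<bar> powr \<alpha>" using M that qJ by blast
      also have "\<dots> \<le> \<bar>M\<bar> * \<bar>q x - q y\<bar> powr \<alpha>" by (intro mult_right_mono) auto
      also have "\<dots> \<le> \<bar>M\<bar> * (\<bar>L\<bar> * \<bar>x - y\<bar>) powr \<alpha>"
        using 1 I.alpha by (intro mult_left_mono powr_mono2) auto
      also have "\<dots> = (\<bar>M\<bar> * \<bar>L\<bar> powr \<alpha>) * \<bar>x - y\<bar> powr \<alpha>" by (simp add: powr_mult)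
      finally show ?thesis .
    qed auto
    moreover have "continuous_on J (\<lambda>x. g (q x))"
      using 0 qJ by (intro continuous_on_compose2[of I g J q]) auto
    ultimately show ?case by auto
  next
    case (Suc k)
    note 1 = I.holder_class_SucD[OF Suc.prems(1)] J.holder_class_SucD[OF Suc.prems(2)]
    show ?case
    proof (rule J.holder_class_SucI)
      show "((\<lambda>x. g (q x)) has_real_derivative deriv_within I g (q x) * deriv_within J q x) (at x within J)"
        if "x \<in> J" for x
        using 1 that qJ by (intro deriv_chain_within) auto
      show "holder_class k \<alpha> J (\<lambda>x. deriv_within I g (q x) * deriv_within J q x)"
        using J.holder_class_mult[OF Suc.IH[OF 1(2) J.holder_class_Suc_le[OF Suc.prems(2)]] 1(4)] .
    qed
  qed
qed

section \<open>The cohomological equation \<open>s = \<phi> + G * (s \<circ> F)\<close> and its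
  partial sums\<close>

primrec cohom_iter :: "(real \<Rightarrow> real) \<Rightarrow> (real \<Rightarrow> real) \<Rightarrow> (real \<Rightarrow> real) \<Rightarrow> nat \<Rightarrow> real \<Rightarrow> real" where
  "cohom_iter F G \<phi> 0 = (\<lambda>x. 0)"
| "cohom_iter F G \<phi> (Suc n) = (\<lambda>x. \<phi> x + G x * cohom_iter F G \<phi> n (F x))"

text \<open>The difference between a partial sum and a bounded solution obeys the homogeneous
  equation, so each step contributes one factor \<open>G\<close>; at step 0 the difference is the
  solution itself.\<close>

lemma cohom_iter_approx:
  assumes F: "F ` I \<subseteq> I" and G: "\<And>x. x \<in> I \<Longrightarrow> \<bar>G x\<bar> \<le> r"
    and s: "\<And>x. x \<in> I \<Longrightarrow> s x = \<phi> x + G x * s (F x)" and B: "\<And>x. x \<in> I \<Longrightarrow> \<bar>s x\<bar> \<le> B"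
  shows "x \<in> I \<Longrightarrow> \<bar>cohom_iter F G \<phi> n x - s x\<bar> \<le> r ^ n * B"
proof (induction n arbitrary: x)
  case 0
  then show ?case using B by simp
next
  case (Suc n)
  have "\<bar>cohom_iter F G \<phi> (Suc n) x - s x\<bar> = \<bar>G x\<bar> * \<bar>cohom_iter F G \<phi> n (F x) - s (F x)\<bar>"
    using s[OF Suc.prems] by (simp add: right_diff_distrib flip: abs_mult)
  also have "\<dots> \<le> r * (r ^ n * B)"
    using G[OF Suc.prems] Suc.IH[of "F x"] Suc.prems F by (intro mult_mono) auto
  finally show ?case by simp
qed

context holder_segment
begin

text \<open>The series converges uniformly by comparison with a geometric one of ratio
  \<open>r\<close>. All the damping comes from \<open>G\<close>, so \<open>F\<close> has only to be
  nonexpanding.\<close>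

lemma cohomological_base:
  assumes F: "F ` I \<subseteq> I" "\<And>x y. x \<in> I \<Longrightarrow> y \<in> I \<Longrightarrow> \<bar>F x - F y\<bar> \<le> \<bar>x - y\<bar>"
    and r: "r < 1" and G: "\<And>x. x \<in> I \<Longrightarrow> \<bar>G x\<bar> \<le> r" "holder_class 0 \<alpha> I G"
    and \<phi>: "holder_class 0 \<alpha> I \<phi>"
  shows "\<exists>s. holder_class 0 \<alpha> I s \<and> (\<forall>x\<in>I. s x = \<phi> x + G x * s (F x))"
proof -
  define S where "S = cohom_iter F G \<phi>"
  obtain C where C: "C > 0" "\<And>x. x \<in> I \<Longrightarrow> \<bar>\<phi> x\<bar> \<le> C" using abs_bound[of \<phi>] \<phi> by auto
  have r0: "0 \<le> r" using G(1) nonempty_I by (meson abs_ge_zero equals0I order_trans)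
  have FI: "F x \<in> I" if "x \<in> I" for x using F(1) that by auto
  have cF: "continuous_on I F"
    using lipschitz_imp_holder[of F 1] F(2) by auto
  have cS: "continuous_on I (S n)" for n
  proof (induction n)
    case (Suc n)
    have "continuous_on I (\<lambda>x. S n (F x))" using continuous_on_compose2[OF Suc cF F(1)] .
    then show ?case using G \<phi> by (auto simp: S_def intro!: continuous_intros)
  qed (simp add: S_def)
  define T where "T n x = S (Suc n) x - S n x" for n x
  have T: "\<bar>T n x\<bar> \<le> r ^ n * C" if "x \<in> I" for n x
    using that
  proof (induction n arbitrary: x)
    case 0
    then show ?case using C by (simp add: T_def S_def)
  next
    case (Suc n)
    have "T (Suc n) x = G x * T n (F x)" by (simp add: T_def S_def algebra_simps)
    then have "\<bar>T (Suc n) x\<bar> \<le> r * (r ^ n * C)"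
      using G(1)[OF Suc.prems] Suc.IH[OF FI[OF Suc.prems]] r0
      by (simp only: abs_mult) (intro mult_mono, auto)
    then show ?case by simp
  qed
  have ST: "S n x = (\<Sum>i<n. T i x)" for n x
    by (induction n) (simp_all add: T_def, simp add: S_def)
  define s where "s x = (\<Sum>i. T i x)" for x
  have "uniform_limit I (\<lambda>n x. \<Sum>i<n. T i x) s sequentially"
    unfolding s_def
  proof (rule Weierstrass_m_test)
    show "norm (T n x) \<le> r ^ n * C" if "x \<in> I" for n x using T[OF that] by simp
    show "summable (\<lambda>n. r ^ n * C)" using r r0 by (intro summable_mult2 summable_geometric) auto
  qed
  then have ul: "uniform_limit I S s sequentially" by (simp add: ST[abs_def])
  then have cs: "continuous_on I s"
    using uniform_limit_theorem[OF _ ul] cS by auto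
  have lim: "(\<lambda>n. S n x) \<longlonglongrightarrow> s x" if "x \<in> I" for x
    using tendsto_uniform_limitI[OF ul that] .
  have eq: "s x = \<phi> x + G x * s (F x)" if "x \<in> I" for x
  proof (rule LIMSEQ_unique)
    show "(\<lambda>n. S (Suc n) x) \<longlonglongrightarrow> s x" using lim[OF that] by (rule LIMSEQ_Suc)
    show "(\<lambda>n. S (Suc n) x) \<longlonglongrightarrow> \<phi> x + G x * s (F x)"
      using lim[OF FI[OF that]] by (auto simp: S_def intro!: tendsto_intros)
  qed
  obtain L0 where L0: "\<forall>x\<in>I. \<forall>y\<in>I. \<bar>\<phi> x - \<phi> y\<bar> \<le> L0 * \<bar>x - y\<bar> powr \<alpha>" using \<phi> by auto
  obtain M0 where M0: "\<forall>x\<in>I. \<forall>y\<in>I. \<bar>G x - G y\<bar> \<le> M0 * \<bar>x - y\<bar> powr \<alpha>" using G by auto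
  obtain B where B: "B > 0" "\<And>x. x \<in> I \<Longrightarrow> \<bar>s x\<bar> \<le> B" using abs_bound[OF cs] by blast
  \<comment> \<open>The Hoelder constants of the \<open>S n\<close> satisfy an affine recursion of
    slope \<open>r\<close>, and \<open>K\<close> is its fixed point. One constant thus serves every
    \<open>n\<close> and survives the limit. The factor \<open>2 * B\<close> bounds all
    \<open>S n\<close>.\<close>
  define K where "K = (\<bar>L0\<bar> + \<bar>M0\<bar> * (2 * B)) / (1 - r)"
  have K: "\<bar>L0\<bar> + \<bar>M0\<bar> * (2 * B) + r * K = K" "0 \<le> K"
    using r B by (auto simp: K_def field_simps)
  have SB: "\<bar>S n x\<bar> \<le> 2 * B" if "x \<in> I" for n x
  proof -
    have "\<bar>S n x - s x\<bar> \<le> r ^ n * B"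
      unfolding S_def using F(1) G(1) eq B(2) that by (rule cohom_iter_approx)
    also have "\<dots> \<le> 1 * B" using r r0 B by (intro mult_right_mono power_le_one) auto
    finally show ?thesis using B(2)[OF that] by linarith
  qed
  have HS: "\<bar>S n x - S n y\<bar> \<le> K * \<bar>x - y\<bar> powr \<alpha>" if "x \<in> I" "y \<in> I" for n x y
    using that
  proof (induction n arbitrary: x y)
    case 0
    then show ?case using K by (simp add: S_def)
  next
    case (Suc n)
    let ?d = "\<bar>x - y\<bar> powr \<alpha>"
    have "S (Suc n) x - S (Suc n) y
      = (\<phi> x - \<phi> y) + (G x - G y) * S n (F y) + G x * (S n (F x) - S n (F y))"
      by (simp add: S_def algebra_simps)
    then have "\<bar>S (Suc n) x - S (Suc n) y\<bar>
      \<le> \<bar>\<phi> x - \<phi> y\<bar> + \<bar>G x - G y\<bar> * \<bar>S n (F y)\<bar> + \<bar>G x\<bar> * \<bar>S n (F x) - S n (F y)\<bar>"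
      unfolding abs_mult[symmetric] by linarith
    also have "\<dots> \<le> \<bar>L0\<bar> * ?d + (\<bar>M0\<bar> * ?d) * (2 * B) + r * (K * ?d)"
    proof (intro add_mono mult_mono)
      show "\<bar>\<phi> x - \<phi> y\<bar> \<le> \<bar>L0\<bar> * ?d"
        using L0 Suc.prems mult_right_mono[OF abs_ge_self[of L0], of ?d] by fastforce
      show "\<bar>G x - G y\<bar> \<le> \<bar>M0\<bar> * ?d"
        using M0 Suc.prems mult_right_mono[OF abs_ge_self[of M0], of ?d] by fastforce
      show "\<bar>S n (F x) - S n (F y)\<bar> \<le> K * ?d"
      proof -
        have "\<bar>F x - F y\<bar> powr \<alpha> \<le> ?d"
          using F(2)[OF Suc.prems] alpha by (intro powr_mono2) auto
        then have "K * \<bar>F x - F y\<bar> powr \<alpha> \<le> K * ?d" using K(2) by (intro mult_left_mono)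
        then show ?thesis using Suc.IH[OF FI FI, of x y] Suc.prems by linarith
      qed
    qed (use SB FI G(1) Suc.prems r0 K B in auto)
    also have "\<dots> = (\<bar>L0\<bar> + \<bar>M0\<bar> * (2 * B) + r * K) * ?d" by (simp add: algebra_simps)
    finally show ?case unfolding K(1) .
  qed
  have "\<bar>s x - s y\<bar> \<le> K * \<bar>x - y\<bar> powr \<alpha>" if "x \<in> I" "y \<in> I" for x y
  proof (rule LIMSEQ_le_const2)
    show "(\<lambda>n. \<bar>S n x - S n y\<bar>) \<longlonglongrightarrow> \<bar>s x - s y\<bar>" using lim that by (intro tendsto_intros) auto
  qed (use HS that in auto)
  then have "holder_class 0 \<alpha> I s" using cs by auto
  then show ?thesis using eq by blast
qed

text \<open>The derivative of the solution solves an equation of the same shape, with \<open>G\<close> replaced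
  by \<open>G * F'\<close>.\<close>

lemma cohomological_solution:
  assumes F: "F ` I \<subseteq> I" "\<And>x. x \<in> I \<Longrightarrow> (F has_real_derivative F' x) (at x within I)"
      "\<And>x. x \<in> I \<Longrightarrow> \<bar>F' x\<bar> \<le> 1"
    and r: "r < 1"
  shows "(\<And>x. x \<in> I \<Longrightarrow> \<bar>G x\<bar> \<le> r) \<Longrightarrow> holder_class k \<alpha> I F \<Longrightarrow> holder_class k \<alpha> I G \<Longrightarrow>
    holder_class k \<alpha> I \<phi> \<Longrightarrow> \<exists>s. holder_class k \<alpha> I s \<and> (\<forall>x\<in>I. s x = \<phi> x + G x * s (F x))"
proof (induction k arbitrary: G \<phi>)
  case 0
  have "\<bar>F x - F y\<bar> \<le> \<bar>x - y\<bar>" if "x \<in> I" "y \<in> I" for x y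
    using lipschitz_bound[OF F(2,3) that] by simp
  then show ?case by (rule cohomological_base[OF F(1) _ r 0(1,3,4)])
next
  case (Suc k)
  have lipF: "\<bar>F x - F y\<bar> \<le> 1 * \<bar>x - y\<bar>" if "x \<in> I" "y \<in> I" for x y
    using lipschitz_bound[OF F(2,3) that] by simp
  have hs: "holder_segment I \<alpha>" by unfold_locales
  have r0: "0 \<le> r" using Suc.prems(1) nonempty_I by (meson abs_ge_zero equals0I order_trans)
  have FI: "F x \<in> I" if "x \<in> I" for x using F(1) that by auto
  note G = Suc.prems(1)
  note dG = holder_class_SucD[OF Suc.prems(3)] and d\<phi> = holder_class_SucD[OF Suc.prems(4)]
    and dF = holder_class_SucD[OF Suc.prems(2)]
    and Sle = Suc.prems(2-4)[THEN holder_class_Suc_le]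
  have F': "holder_class k \<alpha> I F'"
    by (rule holder_class_cong[OF dF(2)]) (rule deriv_eq[OF _ F(2)])
  let ?G' = "deriv_within I G" and ?\<phi>' = "deriv_within I \<phi>"
  obtain s where s: "holder_class k \<alpha> I s" "\<And>x. x \<in> I \<Longrightarrow> s x = \<phi> x + G x * s (F x)"
    using Suc.IH[OF Suc.prems(1) Sle] by auto
  define \<psi> where "\<psi> x = ?\<phi>' x + ?G' x * s (F x)" for x
  have \<psi>: "holder_class k \<alpha> I \<psi>"
    unfolding \<psi>_def
    by (intro holder_class_add holder_class_mult d\<phi> dG holder_class_comp[OF hs hs F(1) lipF s(1) Sle(1)])
  have GF': "\<bar>G x * F' x\<bar> \<le> r" if "x \<in> I" for x
    using Suc.prems(1)[OF that] F(3)[OF that] r0 mult_mono[of "\<bar>G x\<bar>" r "\<bar>F' x\<bar>" 1] by (simp add: abs_mult)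
  obtain v where v: "holder_class k \<alpha> I v" "\<And>x. x \<in> I \<Longrightarrow> v x = \<psi> x + (G x * F' x) * v (F x)"
    using Suc.IH[OF GF' Sle(1) holder_class_mult[OF Sle(2) F'] \<psi>] by auto
  obtain B where B: "B > 0" "\<And>x. x \<in> I \<Longrightarrow> \<bar>s x\<bar> \<le> B" using abs_bound holder_class_continuous[OF s(1)] by blast
  obtain V where V: "V > 0" "\<And>x. x \<in> I \<Longrightarrow> \<bar>v x\<bar> \<le> V" using abs_bound holder_class_continuous[OF v(1)] by blast
  obtain C where C: "C > 0" "\<And>x. x \<in> I \<Longrightarrow> \<bar>?G' x\<bar> \<le> C" using abs_bound holder_class_continuous[OF dG(2)] by blast
  define S where "S = cohom_iter F G \<phi>"
  define D where "D = rec_nat (\<lambda>x. 0) (\<lambda>n d x. ?\<phi>' x + ?G' x * S n (F x) + G x * F' x * d (F x))"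
  have D_simps: "D 0 = (\<lambda>x. 0)" "D (Suc n) = (\<lambda>x. ?\<phi>' x + ?G' x * S n (F x) + G x * F' x * D n (F x))" for n
    by (auto simp: D_def)
  have SD: "(S n has_real_derivative D n x) (at x within I)" if "x \<in> I" for n x
    using that
  proof (induction n arbitrary: x)
    case 0
    then show ?case by (simp add: S_def D_simps)
  next
    case (Suc n)
    have "((\<lambda>x. S n (F x)) has_real_derivative D n (F x) * F' x) (at x within I)"
      by (rule deriv_chain_within[OF Suc.IH[OF FI[OF Suc.prems]] F(2)[OF Suc.prems] F(1)])
    note 1 = DERIV_add[OF d\<phi>(1)[OF Suc.prems] DERIV_mult[OF dG(1)[OF Suc.prems] this]]
    show ?case using 1 by (simp add: S_def D_simps algebra_simps)
  qed
  \<comment> \<open>The error of \<open>D n\<close> is damped by \<open>r\<close> but also driven by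
    the error of \<open>S n\<close>, which itself decays like \<open>r ^ n\<close>. At rate
    \<open>r\<close> this resonance would produce a factor \<open>n\<close>; a rate strictly between
    \<open>r\<close> and 1 absorbs it.\<close>
  define \<sigma> where "\<sigma> = (1 + r) / 2"
  have \<sigma>: "r < \<sigma>" "\<sigma> < 1" "0 < \<sigma>" using r r0 by (auto simp: \<sigma>_def)
  define A where "A = max V (C * B / (\<sigma> - r))"
  have A: "V \<le> A" "C * B \<le> A * (\<sigma> - r)" using \<sigma> by (auto simp: A_def max_def field_simps)
  have Dv: "\<bar>D n x - v x\<bar> \<le> A * \<sigma> ^ n" if "x \<in> I" for n x
    using that
  proof (induction n arbitrary: x)
    case 0
    then show ?case using V(2)[of x] A by (simp add: D_simps)
  next
    case (Suc n)
    note x = Suc.prems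
    have "\<bar>S n (F x) - s (F x)\<bar> \<le> r ^ n * B"
      unfolding S_def by (rule cohom_iter_approx[where s = s, OF F(1) G s(2) B(2) FI[OF x]])
    also have "\<dots> \<le> \<sigma> ^ n * B" using \<sigma> r0 B by (intro mult_right_mono power_mono) auto
    finally have 1: "\<bar>S n (F x) - s (F x)\<bar> \<le> \<sigma> ^ n * B" .
    have "D (Suc n) x - v x = ?G' x * (S n (F x) - s (F x)) + (G x * F' x) * (D n (F x) - v (F x))"
      using v(2)[OF x] by (simp add: D_simps \<psi>_def algebra_simps)
    then have "\<bar>D (Suc n) x - v x\<bar> \<le> \<bar>?G' x\<bar> * \<bar>S n (F x) - s (F x)\<bar> + \<bar>G x * F' x\<bar> * \<bar>D n (F x) - v (F x)\<bar>"
      unfolding abs_mult[symmetric] by linarith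
    also have "\<dots> \<le> C * (\<sigma> ^ n * B) + r * (A * \<sigma> ^ n)"
      using 1 C GF'[OF x] x r0 Suc.IH[OF FI[OF x]] by (intro add_mono mult_mono) auto
    also have "\<dots> = \<sigma> ^ n * (C * B + r * A)" by (simp add: algebra_simps)
    also have "\<dots> \<le> \<sigma> ^ n * (A * \<sigma>)" using A \<sigma> by (intro mult_left_mono) (auto simp: algebra_simps)
    finally show ?case by (simp add: algebra_simps)
  qed
  obtain x0 where x0: "x0 \<in> I" using nonempty_I by (meson ex_in_conv)
  have lim: "(\<lambda>n. S n x) \<longlonglongrightarrow> s x" if "x \<in> I" for x
  proof -
    have "(\<lambda>n. S n x - s x) \<longlonglongrightarrow> 0"
    proof (rule tendsto_rabs_zero_cancel, rule tendsto_sandwich[OF _ _ tendsto_const])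
      show "(\<lambda>n. r ^ n * B) \<longlonglongrightarrow> 0" using r r0 by (auto intro!: tendsto_eq_intros LIMSEQ_power_zero)
      show "\<forall>\<^sub>F n in sequentially. \<bar>S n x - s x\<bar> \<le> r ^ n * B"
        unfolding S_def using cohom_iter_approx[where s = s, OF F(1) Suc.prems(1) s(2) B(2) that] by auto
    qed auto
    then show ?thesis using LIM_zero_iff by blast
  qed
  \<comment> \<open>The derivatives of the partial sums converge uniformly to \<open>v\<close>, so
    the limit is differentiable; nothing about the differentiability of \<open>s\<close> is
    presupposed.\<close>
  have "\<exists>g. \<forall>x\<in>I. (\<lambda>n. S n x) \<longlonglongrightarrow> g x \<and> (g has_derivative (*) (v x)) (at x within I)"
  proof (rule has_derivative_sequence[where f = S and f' = "\<lambda>n x. (*) (D n x)"])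
    show "convex I" "x0 \<in> I" "(\<lambda>n. S n x0) \<longlonglongrightarrow> s x0" using x0 lim by auto
    show "(S n has_derivative (*) (D n x)) (at x within I)" if "x \<in> I" for n x
      using SD[OF that] by (simp add: has_field_derivative_def)
    show "\<forall>\<^sub>F n in sequentially. \<forall>x\<in>I. \<forall>h. norm (D n x * h - v x * h) \<le> e * norm h" if "e > 0" for e
    proof -
      have "(\<lambda>n. A * \<sigma> ^ n) \<longlonglongrightarrow> 0" using \<sigma> by (auto intro!: tendsto_eq_intros LIMSEQ_power_zero)
      then have "\<forall>\<^sub>F n in sequentially. A * \<sigma> ^ n < e" using that by (rule order_tendstoD)
      then show ?thesis
      proof eventually_elim
        case (elim n)
        show ?case
        proof (intro ballI allI)
          fix x h assume "x \<in> I"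
          then have "\<bar>D n x - v x\<bar> \<le> e" using Dv[of x n] elim by linarith
          then show "norm (D n x * h - v x * h) \<le> e * norm h"
            by (auto simp: abs_mult simp flip: left_diff_distrib intro!: mult_right_mono)
        qed
      qed
    qed
  qed
  then obtain g where g: "\<And>x. x \<in> I \<Longrightarrow> (\<lambda>n. S n x) \<longlonglongrightarrow> g x"
    "\<And>x. x \<in> I \<Longrightarrow> (g has_real_derivative v x) (at x within I)" by (auto simp: has_field_derivative_def)
  have gs: "g x = s x" if "x \<in> I" for x using LIMSEQ_unique[OF g(1) lim] that by blast
  have "holder_class (Suc k) \<alpha> I g" by (rule holder_class_SucI[OF g(2) v(1)])
  moreover have "g x = \<phi> x + G x * g (F x)" if "x \<in> I" for x
    using s(2)[OF that] unfolding gs[OF that] gs[OF FI[OF that]] .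
  ultimately show ?case by blast
qed

end

section \<open>Mean values and inverse functions on a closed interval\<close>

lemma mvt_within:
  fixes g :: "real \<Rightarrow> real"
  assumes "\<exists>u v. u < v \<and> I = {u..v}" "\<And>x. x \<in> I \<Longrightarrow> (g has_real_derivative g' x) (at x within I)"
    "x \<in> I" "y \<in> I" "x < y"
  obtains z where "z \<in> {x<..<y}" "g y - g x = g' z * (y - x)"
proof -
  have sub: "{x..y} \<subseteq> I" using assms by auto
  have "\<exists>z\<in>{x<..<y}. g y - g x = g' z * (y - x)"
  proof (rule mvt_simple[OF assms(5)])
    fix z assume "x \<le> z" "z \<le> y"
    then have "(g has_real_derivative g' z) (at z within {x..y})"
      using sub by (intro has_field_derivative_subset[OF assms(2) sub]) auto
    then show "(g has_derivative (*) (g' z)) (at z within {x..y})"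
      by (simp add: has_field_derivative_def)
  qed
  then show ?thesis using that by blast
qed

text \<open>A positive continuous density is bounded below on a compact interval, so
  \<open>H\<close> is bi-Lipschitz. Its inverse then gains one order at a time from
  \<open>h' = inverse (w \<circ> h)\<close>: regularity of \<open>h\<close> on the right yields one
  more derivative on the left, until the regularity of \<open>w\<close> is exhausted.\<close>

lemma (in holder_segment) inverse_function:
  assumes H: "\<And>x. x \<in> I \<Longrightarrow> (H has_real_derivative w x) (at x within I)"
    and w: "holder_class k \<alpha> I w" "\<And>x. x \<in> I \<Longrightarrow> w x > 0"
  shows "holder_segment (H ` I) \<alpha>" "inj_on H I"
    "\<And>y. y \<in> H ` I \<Longrightarrow> (inv_into I H has_real_derivative inverse (w (inv_into I H y))) (at y within H ` I)"
    "holder_class (Suc k) \<alpha> (H ` I) (inv_into I H)"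
    "\<exists>L. \<forall>x\<in>H ` I. \<forall>y\<in>H ` I. \<bar>inv_into I H x - inv_into I H y\<bar> \<le> L * \<bar>x - y\<bar>"
proof -
  let ?J = "H ` I" and ?h = "inv_into I H"
  obtain m where m: "m > 0" "\<And>x. x \<in> I \<Longrightarrow> m \<le> w x"
    using pos_lower_bound[OF holder_class_continuous[OF w(1)]] w(2) by blast
  have low1: "m * (y - x) \<le> H y - H x" if xy: "x \<in> I" "y \<in> I" "x < y" for x y
  proof -
    obtain z where z: "z \<in> {x<..<y}" "H y - H x = w z * (y - x)"
      using mvt_within[OF segment H xy] by blast
    then have "z \<in> I" using xy segment by auto
    then show ?thesis using z m(2)[of z] xy by (simp add: mult_right_mono)
  qed
  have low: "m * \<bar>x - y\<bar> \<le> \<bar>H x - H y\<bar>" if "x \<in> I" "y \<in> I" for x y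
    using low1[of x y] low1[of y x] that by (cases x y rule: linorder_cases) auto
  show inj: "inj_on H I"
  proof (rule inj_onI)
    fix x y assume "x \<in> I" "y \<in> I" "H x = H y"
    then show "x = y" using low[of x y] m by (simp add: mult_le_0_iff)
  qed
  have hH: "?h (H x) = x" if "x \<in> I" for x using inv_into_f_f[OF inj that] .
  have cH: "continuous_on I H" using H by (meson DERIV_continuous_on)
  have mono: "H x \<le> H y" if "x \<in> I" "y \<in> I" "x \<le> y" for x y
  proof (cases "x = y")
    case False
    then have "m * (y - x) \<le> H y - H x" using low1[of x y] that by linarith
    moreover have "0 \<le> m * (y - x)" using m(1) that by simp
    ultimately show ?thesis by linarith
  qed auto
  obtain u v where uv: "u < v" "I = {u..v}" using segment by auto
  have "?J = {H u..H v}"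
  proof
    have "H x \<in> {H u..H v}" if "x \<in> I" for x
      using mono[of u x] mono[of x v] that uv by auto
    then show "?J \<subseteq> {H u..H v}" by blast
    have "connected ?J" using cH connected_I by (rule connected_continuous_image)
    then show "{H u..H v} \<subseteq> ?J" by (rule connected_contains_Icc) (use uv in auto)
  qed
  moreover have "H u < H v" using low1[of u v] uv m by (smt (verit) atLeastAtMost_iff mult_pos_pos)
  ultimately show hsJ: "holder_segment ?J \<alpha>" using alpha by unfold_locales auto
  interpret J: holder_segment ?J \<alpha> by (rule hsJ)
  have lip: "\<bar>?h x - ?h y\<bar> \<le> inverse m * \<bar>x - y\<bar>" if "x \<in> ?J" "y \<in> ?J" for x y
    using low that hH m by (auto simp: field_simps)
  then show "\<exists>L. \<forall>x\<in>?J. \<forall>y\<in>?J. \<bar>?h x - ?h y\<bar> \<le> L * \<bar>x - y\<bar>" by blast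
  have ch: "continuous_on ?J ?h" using J.lipschitz_imp_holder[OF lip] by auto
  have hJ: "?h ` ?J \<subseteq> I" using hH by auto
  show deriv: "(?h has_real_derivative inverse (w (?h y))) (at y within ?J)" if y: "y \<in> ?J" for y
  proof -
    obtain x where x: "x \<in> I" "y = H x" using y by auto
    have "((\<lambda>z. (H z - H x) / (z - x)) \<longlongrightarrow> w x) (at x within I)"
      using H[OF x(1)] by (simp add: has_field_derivative_iff)
    then have 1: "((\<lambda>z. inverse ((H z - H x) / (z - x))) \<longlongrightarrow> inverse (w x)) (at x within I)"
      using w(2)[OF x(1)] by (intro tendsto_inverse) auto
    have "filterlim ?h (at x within I) (at y within ?J)"
      unfolding filterlim_at
    proof
      show "\<forall>\<^sub>F z in at y within ?J. ?h z \<in> I \<and> ?h z \<noteq> x"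
        unfolding eventually_at_filter using x hH by (auto intro!: always_eventually)
      show "(?h \<longlongrightarrow> x) (at y within ?J)"
        using ch y hH x by (auto simp: continuous_on)
    qed
    from filterlim_compose[OF 1 this]
    have "((\<lambda>z. inverse ((H (?h z) - H x) / (?h z - x))) \<longlongrightarrow> inverse (w x)) (at y within ?J)" .
    then have "((\<lambda>z. (?h z - ?h y) / (z - y)) \<longlongrightarrow> inverse (w x)) (at y within ?J)"
      by (rule Lim_transform_eventually) (auto simp: eventually_at_filter x hH intro!: always_eventually)
    then show ?thesis using x hH by (simp add: has_field_derivative_iff)
  qed
  have iw: "holder_class k \<alpha> I (\<lambda>x. inverse (w x))" using w by (rule holder_class_inverse)
  have hs: "holder_segment I \<alpha>" by unfold_locales
  have "j \<le> Suc k \<Longrightarrow> holder_class j \<alpha> ?J ?h" for j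
  proof (induction j)
    case 0
    show ?case by (rule J.lipschitz_imp_holder[OF lip])
  next
    case (Suc j)
    then have "holder_class j \<alpha> ?J ?h" by simp
    then have "holder_class j \<alpha> ?J (\<lambda>y. inverse (w (?h y)))"
      using holder_class_comp[OF hs hsJ hJ lip holder_class_le[OF _ iw]] Suc.prems by simp
    then show ?case using deriv by (intro J.holder_class_SucI)
  qed
  then show "holder_class (Suc k) \<alpha> ?J ?h" by blast
qed

section \<open>Coding of the attractor\<close>

lemma prepend_simps [simp]: "prepend a \<omega> 0 = a" "prepend a \<omega> (Suc n) = \<omega> n"
  by (auto simp: prepend_def)

lemma prepend_shift: "prepend (\<omega> 0) (\<lambda>n. \<omega> (Suc n)) = \<omega>"
  by (rule ext) (auto simp: prepend_def split: nat.split)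

lemma prepend_const: "prepend a (\<lambda>_. a) = (\<lambda>_. a)"
  by (rule ext) (auto simp: prepend_def split: nat.split)

lemma foldr_prepend_take: "foldr prepend (map \<omega> [0..<N]) (\<lambda>n. \<omega> (n + N)) = \<omega>"
proof (induction N)
  case (Suc N)
  have "prepend (\<omega> N) (\<lambda>n. \<omega> (n + Suc N)) = (\<lambda>n. \<omega> (n + N))"
    using prepend_shift[of "\<lambda>n. \<omega> (n + N)"] by simp
  then show ?case using Suc by simp
qed auto

lemma word_map_eq_foldr: "word_map f \<omega> m x = foldr f (map \<omega> [0..<m]) x"
  by (induction m arbitrary: x) auto

text \<open>Only contraction is assumed, without derivatives, so that the coding results apply both
  to \<open>f\<close> on \<open>I\<close> and to the conjugated maps on another interval.\<close>

locale contracting_ifs = segment +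
  fixes f :: "'a::finite \<Rightarrow> real \<Rightarrow> real" and \<rho> :: real
  assumes rho: "0 < \<rho>" "\<rho> < 1"
    and f_in: "\<And>a x. x \<in> I \<Longrightarrow> f a x \<in> I"
    and f_contr: "\<And>a x y. x \<in> I \<Longrightarrow> y \<in> I \<Longrightarrow> \<bar>f a x - f a y\<bar> \<le> \<rho> * \<bar>x - y\<bar>"
begin

lemma f_cont: "continuous_on I (f a)"
proof (rule lipschitz_on_continuous_on)
  show "\<rho>-lipschitz_on I (f a)" using f_contr rho by (intro lipschitz_onI) (auto simp: dist_real_def)
qed

lemma foldr_in: "x \<in> I \<Longrightarrow> foldr f w x \<in> I"
  by (induction w) (auto simp: f_in)

lemma foldr_contr:
  assumes "x \<in> I" "y \<in> I"
  shows "\<bar>foldr f w x - foldr f w y\<bar> \<le> \<rho> ^ length w * \<bar>x - y\<bar>"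
proof (induction w)
  case (Cons a w)
  have "\<bar>foldr f (a # w) x - foldr f (a # w) y\<bar> \<le> \<rho> * \<bar>foldr f w x - foldr f w y\<bar>"
    using f_contr[OF foldr_in foldr_in] assms by simp
  also have "\<dots> \<le> \<rho> * (\<rho> ^ length w * \<bar>x - y\<bar>)" using Cons rho by (intro mult_left_mono) auto
  finally show ?case by simp
qed auto

lemma word_map_conv: "\<exists>x\<in>I. \<forall>x0\<in>I. (\<lambda>m. word_map f \<omega> m x0) \<longlonglongrightarrow> x"
proof -
  obtain D where D: "D > 0" "\<And>x y. x \<in> I \<Longrightarrow> y \<in> I \<Longrightarrow> \<bar>x - y\<bar> \<le> D" using diam by blast
  define W where "W m x = word_map f \<omega> m x" for m x
  have WI: "W m x \<in> I" if "x \<in> I" for m x using that by (simp add: W_def word_map_eq_foldr foldr_in)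
  have Wc: "\<bar>W m x - W m y\<bar> \<le> \<rho> ^ m * D" if "x \<in> I" "y \<in> I" for m x y
  proof -
    have "\<bar>W m x - W m y\<bar> \<le> \<rho> ^ m * \<bar>x - y\<bar>"
      using foldr_contr[OF that, of "map \<omega> [0..<m]"] by (simp add: W_def word_map_eq_foldr)
    also have "\<dots> \<le> \<rho> ^ m * D" using D(2)[OF that] rho by (intro mult_left_mono) auto
    finally show ?thesis .
  qed
  have lim0: "(\<lambda>m. \<rho> ^ m * D) \<longlonglongrightarrow> 0" using rho by (auto intro!: tendsto_eq_intros LIMSEQ_power_zero)
  \<comment> \<open>New maps are added innermost, so later iterates stay in the image of the
    \<open>m\<close>-th one, whose diameter is at most \<open>\<rho> ^ m * D\<close>. This gives the
    Cauchy property.\<close>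
  have Wsplit: "\<exists>y\<in>I. W n x = W m y" if "m \<le> n" "x \<in> I" for m n x
    using that
  proof (induction n arbitrary: x)
    case (Suc n)
    show ?case
    proof (cases "m = Suc n")
      case False
      then show ?thesis using Suc.IH[of "f (\<omega> n) x"] Suc.prems f_in by (simp add: W_def)
    qed (use Suc.prems in auto)
  qed auto
  obtain x0 where x0: "x0 \<in> I" using nonempty_I by (meson ex_in_conv)
  have "Cauchy (\<lambda>m. W m x0)"
  proof (rule metric_CauchyI)
    fix e :: real assume "e > 0"
    then obtain M where M: "\<rho> ^ M * D < e / 2"
      using order_tendstoD(2)[OF lim0, of "e / 2"] by (auto simp: eventually_sequentially)
    have "\<bar>W m x0 - W M x0\<bar> < e / 2" if "m \<ge> M" for m
      using Wsplit[OF that x0] Wc[OF _ x0, of _ M] M by fastforce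
    note close = this
    have "dist (W m x0) (W n x0) < e" if "m \<ge> M" "n \<ge> M" for m n
      using close[OF that(1)] close[OF that(2)] unfolding dist_real_def by linarith
    then show "\<exists>M. \<forall>m\<ge>M. \<forall>n\<ge>M. dist (W m x0) (W n x0) < e" by blast
  qed
  then obtain x where x: "(\<lambda>m. W m x0) \<longlonglongrightarrow> x" by (auto simp: Cauchy_convergent_iff convergent_def)
  have "x \<in> I"
    using closed_sequentially[OF compact_imp_closed[OF compact_I] _ x] WI[OF x0] by auto
  moreover have "(\<lambda>m. W m y) \<longlonglongrightarrow> x" if "y \<in> I" for y
  proof -
    have "(\<lambda>m. W m y - W m x0) \<longlonglongrightarrow> 0"
    proof (rule tendsto_rabs_zero_cancel, rule tendsto_sandwich[OF _ _ tendsto_const lim0])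
      show "\<forall>\<^sub>F m in sequentially. \<bar>W m y - W m x0\<bar> \<le> \<rho> ^ m * D" using Wc[OF that x0] by auto
    qed auto
    then show ?thesis using tendsto_add[OF _ x] by force
  qed
  ultimately show ?thesis by (auto simp: W_def)
qed

lemma coding_eqI:
  assumes "\<And>x0. x0 \<in> I \<Longrightarrow> (\<lambda>m. word_map f \<omega> m x0) \<longlonglongrightarrow> x"
  shows "coding I f \<omega> = x"
proof -
  obtain x0 where x0: "x0 \<in> I" using nonempty_I by (meson ex_in_conv)
  show ?thesis unfolding coding_def
    by (rule the_equality) (use assms x0 LIMSEQ_unique in blast)+
qed

lemma coding_in: "coding I f \<omega> \<in> I"
  and coding_limit: "x \<in> I \<Longrightarrow> (\<lambda>m. word_map f \<omega> m x) \<longlonglongrightarrow> coding I f \<omega>"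
  using word_map_conv[of \<omega>] coding_eqI[of \<omega>] by auto

lemma coding_prepend: "coding I f (prepend a \<omega>) = f a (coding I f \<omega>)"
proof -
  obtain x0 where x0: "x0 \<in> I" using nonempty_I by (meson ex_in_conv)
  have eq: "word_map f (prepend a \<omega>) (Suc m) x = f a (word_map f \<omega> m x)" for m x
    by (induction m arbitrary: x) auto
  have "(\<lambda>m. word_map f (prepend a \<omega>) (Suc m) x0) \<longlonglongrightarrow> f a (coding I f \<omega>)"
    unfolding eq
    by (rule continuous_on_tendsto_compose[OF f_cont coding_limit[OF x0] coding_in])
       (auto simp: word_map_eq_foldr foldr_in x0)
  with coding_limit[OF x0, THEN LIMSEQ_Suc] show ?thesis using LIMSEQ_unique by blast
qed

lemma coding_foldr: "coding I f (foldr prepend w \<omega>) = foldr f w (coding I f \<omega>)"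
  by (induction w) (auto simp: coding_prepend)

lemma coding_const: "coding I f (\<lambda>_. a) = fixed_point I (f a)"
proof -
  let ?x = "coding I f (\<lambda>_. a)"
  have "f a ?x = ?x" using coding_prepend[of a "\<lambda>_. a"] by (simp add: prepend_const)
  moreover have "y = ?x" if "y \<in> I" "f a y = y" for y
  proof -
    have "word_map f (\<lambda>_. a) m y = y" for m using that by (induction m) auto
    then show ?thesis using coding_limit[OF that(1), of "\<lambda>_. a"] by (simp add: LIMSEQ_const_iff)
  qed
  ultimately show ?thesis unfolding fixed_point_def using coding_in by (metis (mono_tags, lifting) the_equality)
qed

lemma range_coding_invariant: "range (coding I f) = (\<Union>a. f a ` range (coding I f))"
proof -
  have "coding I f \<omega> \<in> (\<Union>a. f a ` range (coding I f))" for \<omega>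
    using coding_prepend[of "\<omega> 0" "\<lambda>n. \<omega> (Suc n)"] by (auto simp: prepend_shift)
  then show ?thesis using coding_prepend by (auto simp flip: coding_prepend)
qed

text \<open>Choosing for each point of \<open>X\<close> a letter and a preimage in \<open>X\<close>
  produces a backward orbit, and the letters along it form an address of the starting point. Since
  only this backward inclusion enters, the argument serves for the closure of the coded points as
  well as for any invariant set.\<close>

lemma invariant_subset_range_coding:
  assumes X: "X \<subseteq> I" "X \<subseteq> (\<Union>a. f a ` X)"
  shows "X \<subseteq> range (coding I f)"
proof
  fix x assume x: "x \<in> X"
  have "\<exists>a y. y \<in> X \<and> z = f a y" if "z \<in> X" for z using that X(2) by blast
  then obtain A Y where AY: "\<And>z. z \<in> X \<Longrightarrow> Y z \<in> X \<and> z = f (A z) (Y z)" by metis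
  define \<omega> where "\<omega> n = A ((Y ^^ n) x)" for n
  have YX: "(Y ^^ n) x \<in> X" for n by (induction n) (auto simp: x AY)
  have eq: "word_map f \<omega> m ((Y ^^ m) x) = x" for m
  proof (induction m)
    case (Suc m)
    then show ?case using AY[OF YX[of m]] by (simp add: \<omega>_def)
  qed auto
  obtain D where D: "D > 0" "\<And>x y. x \<in> I \<Longrightarrow> y \<in> I \<Longrightarrow> \<bar>x - y\<bar> \<le> D" using diam by blast
  have xI: "x \<in> I" using x X by auto
  have "(\<lambda>m. word_map f \<omega> m x - x) \<longlonglongrightarrow> 0"
  proof (rule tendsto_rabs_zero_cancel, rule tendsto_sandwich[OF _ _ tendsto_const])
    show "(\<lambda>m. \<rho> ^ m * D) \<longlonglongrightarrow> 0" using rho by (auto intro!: tendsto_eq_intros LIMSEQ_power_zero)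
    have "\<bar>word_map f \<omega> m x - x\<bar> \<le> \<rho> ^ m * D" for m
    proof -
      have YI: "(Y ^^ m) x \<in> I" using YX X by auto
      have "\<bar>word_map f \<omega> m x - word_map f \<omega> m ((Y ^^ m) x)\<bar> \<le> \<rho> ^ m * \<bar>x - (Y ^^ m) x\<bar>"
        using foldr_contr[OF xI YI, of "map \<omega> [0..<m]"] by (simp add: word_map_eq_foldr)
      also have "\<dots> \<le> \<rho> ^ m * D" using D(2)[OF xI YI] rho by (intro mult_left_mono) auto
      finally show ?thesis using eq by simp
    qed
    then show "\<forall>\<^sub>F m in sequentially. \<bar>word_map f \<omega> m x - x\<bar> \<le> \<rho> ^ m * D" by simp
  qed auto
  then have "(\<lambda>m. word_map f \<omega> m x) \<longlonglongrightarrow> x" by (simp add: LIM_zero_iff)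
  then have "x = coding I f \<omega>" using coding_limit[OF xI] LIMSEQ_unique by blast
  then show "x \<in> range (coding I f)" by simp
qed

lemma closure_image_f: "X \<subseteq> I \<Longrightarrow> f a ` closure X = closure (f a ` X)"
proof -
  assume X: "X \<subseteq> I"
  have cX: "closure X \<subseteq> I" using X compact_imp_closed[OF compact_I] by (rule closure_minimal)
  then have "compact (f a ` closure X)"
    by (metis compact_continuous_image continuous_on_subset[OF f_cont] bounded_subset compact_I
        compact_imp_bounded compact_eq_bounded_closed closed_closure)
  then have "closure (f a ` X) \<subseteq> f a ` closure X"
    by (intro closure_minimal image_mono closure_subset compact_imp_closed)
  moreover have "f a ` closure X \<subseteq> closure (f a ` X)"
    using image_closure_subset[of X "f a" "closure (f a ` X)"] continuous_on_subset[OF f_cont cX]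
    by (simp add: closure_subset)
  ultimately show ?thesis by auto
qed

text \<open>The closure of the set of coded points is invariant, hence consists of coded points: this
  gives compactness without topologizing the space of words.\<close>

lemma attractor_eq: "attractor I f = range (coding I f)"
  unfolding attractor_def
proof (rule the_equality)
  let ?R = "range (coding I f)"
  have RI: "?R \<subseteq> I" using coding_in by auto
  have cI: "closure ?R \<subseteq> I" using RI compact_imp_closed[OF compact_I] by (rule closure_minimal)
  have "closure ?R \<subseteq> (\<Union>a. f a ` closure ?R)"
  proof (rule closure_minimal)
    show "?R \<subseteq> (\<Union>a. f a ` closure ?R)"
      using range_coding_invariant closure_subset[of ?R] by blast
    show "closed (\<Union>a. f a ` closure ?R)"
      by (intro closed_UN) (auto simp: closure_image_f[OF RI])
  qed
  then have "closure ?R \<subseteq> ?R" using invariant_subset_range_coding[OF cI] by auto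
  then have "closed ?R" by (simp add: closure_subset_eq)
  then have "compact ?R"
    using RI compact_I by (meson bounded_subset compact_eq_bounded_closed)
  then show "?R \<noteq> {} \<and> compact ?R \<and> ?R \<subseteq> I \<and> ?R = (\<Union>a. f a ` ?R)"
    using RI range_coding_invariant by blast
next
  fix K assume K: "K \<noteq> {} \<and> compact K \<and> K \<subseteq> I \<and> K = (\<Union>a. f a ` K)"
  then have fK: "f a x \<in> K" if "x \<in> K" for a x using that by blast
  have "K \<subseteq> range (coding I f)" by (rule invariant_subset_range_coding) (use K in auto)
  moreover have "coding I f \<omega> \<in> K" for \<omega>
  proof -
    obtain x where x: "x \<in> K" using K by auto
    have "foldr f w x \<in> K" for w by (induction w) (auto simp: x fK)
    then show ?thesis
      using closed_sequentially[OF compact_imp_closed, of K _ "coding I f \<omega>"] coding_limit[of x \<omega>] K x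
      by (metis (no_types, lifting) subsetD word_map_eq_foldr)
  qed
  ultimately show "K = range (coding I f)" by auto
qed

end

section \<open>Conjugacy to a linear system\<close>

locale conformal_ifs =
  fixes r :: real and I :: "real set" and f :: "'a::finite \<Rightarrow> real \<Rightarrow> real"
  assumes r: "r \<ge> 2" and Cr: "Cr_ifs r I f" and uc: "uniformly_contracting I f"
    and op: "orientation_preserving I f"
begin

abbreviation "\<rho> \<equiv> max_contraction I f"
abbreviation "df a \<equiv> deriv_within I (f a)"
abbreviation "ddf a \<equiv> deriv_within I (df a)"

text \<open>Two derivatives are spent on forming \<open>f'' / f'\<close>; \<open>ord\<close> is the
  order that remains for it and for the solution \<open>s\<close> of the cohomological
  equation.\<close>

definition ord :: nat where "ord = nat \<lfloor>r\<rfloor> - 2"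

lemma ord: "nat \<lfloor>r\<rfloor> = Suc (Suc ord)"
  using r by (simp add: ord_def) linarith

sublocale holder_segment I "frac r"
  using Cr by unfold_locales (auto simp: Cr_ifs_def ifs_def frac_ge_0 less_imp_le[OF frac_lt_1])

lemma f_class: "holder_class (Suc (Suc ord)) (frac r) I (f a)"
  using Cr by (auto simp: Cr_ifs_def Cr_on_iff_holder_class ord simp del: holder_class.simps)

lemmas f_deriv = holder_class_SucD(1)[OF f_class]
  and df_class = holder_class_SucD(2)[OF f_class]
lemmas df_deriv = holder_class_SucD(1)[OF df_class]
  and ddf_class = holder_class_SucD(2)[OF df_class]

lemma df_cont: "continuous_on I (df a)"
  by (rule holder_class_continuous[OF df_class])

lemma df_abs_bdd: "\<exists>B. \<forall>a. \<forall>x\<in>I. \<bar>df a x\<bar> \<le> B"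
proof -
  have "\<exists>C. \<forall>x\<in>I. \<bar>df a x\<bar> \<le> C" for a using abs_bound[OF df_cont] by metis
  then obtain C where "\<And>a x. x \<in> I \<Longrightarrow> \<bar>df a x\<bar> \<le> C a" by metis
  then show ?thesis by (intro exI[of _ "\<Sum>a\<in>UNIV. \<bar>C a\<bar>"])
      (metis (no_types, lifting) abs_ge_self abs_ge_zero finite member_le_sum order_trans UNIV_I)
qed

lemma df_pos: "x \<in> I \<Longrightarrow> 0 < df a x"
  using op by (auto simp: orientation_preserving_def)

lemma df_le: "x \<in> I \<Longrightarrow> df a x \<le> \<rho>"
proof -
  assume x: "x \<in> I"
  obtain B where B: "\<forall>a. \<forall>x\<in>I. \<bar>df a x\<bar> \<le> B" using df_abs_bdd by blast
  have "\<bar>df a x\<bar> \<le> \<rho>" unfolding max_contraction_def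
    by (rule cSUP_upper2[where x = "(a, x)"]) (use B x in \<open>auto intro!: bdd_aboveI2[where M = B]\<close>)
  then show ?thesis by simp
qed

lemma rho_bounds: "0 < \<rho>" "\<rho> < 1"
proof -
  obtain x where "x \<in> I" using nonempty_I by (meson ex_in_conv)
  then show "0 < \<rho>" using df_pos[of x] df_le[of x] by (meson less_le_trans)
  show "\<rho> < 1" using uc by (simp add: uniformly_contracting_def)
qed

sublocale contracting_ifs I f \<rho>
proof
  show "f a x \<in> I" if "x \<in> I" for a x using Cr that by (auto simp: Cr_ifs_def ifs_def)
  show "\<bar>f a x - f a y\<bar> \<le> \<rho> * \<bar>x - y\<bar>" if "x \<in> I" "y \<in> I" for a x y
    using that df_le df_pos by (intro lipschitz_bound[OF f_deriv]) (auto simp: abs_of_pos)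
qed (use rho_bounds in auto)

lemma df_lower: obtains l where "l > 0" "\<And>a x. x \<in> I \<Longrightarrow> l \<le> df a x"
proof -
  have "\<exists>m>0. \<forall>x\<in>I. m \<le> df a x" for a
    using pos_lower_bound[OF df_cont df_pos] by metis
  then obtain m where m: "\<And>a. m a > 0" "\<And>a x. x \<in> I \<Longrightarrow> m a \<le> df a x" by metis
  show ?thesis
  proof (rule that[of "Min (range m)"])
    show "Min (range m) > 0" using m by (subst Min_gr_iff) auto
    show "Min (range m) \<le> df a x" if "x \<in> I" for a x
      using m(2)[OF that, of a] by (intro order_trans[OF Min_le]) auto
  qed
qed

lemma two_fixed_points: "\<exists>a b. coding I f (\<lambda>_. a) \<noteq> coding I f (\<lambda>_. b)"
  using Cr by (auto simp: Cr_ifs_def ifs_def coding_const)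

definition ldf :: "'a \<Rightarrow> real \<Rightarrow> real" where "ldf a x = inverse (df a x) * ddf a x"

lemma ln_df_deriv: "x \<in> I \<Longrightarrow> ((\<lambda>x. ln (df a x)) has_real_derivative ldf a x) (at x within I)"
  unfolding ldf_def by (rule DERIV_ln_within[OF df_deriv df_pos])

lemma ldf_class: "holder_class ord (frac r) I (ldf a)"
  unfolding ldf_def
  by (intro holder_class_mult ddf_class holder_class_inverse df_pos holder_class_Suc_le[OF df_class])

lemma ldf_bound: obtains C where "C > 0" "\<And>a x. x \<in> I \<Longrightarrow> \<bar>ldf a x\<bar> \<le> C"
proof -
  have "\<exists>C>0. \<forall>x\<in>I. \<bar>ldf a x\<bar> \<le> C" for a
    using abs_bound[OF holder_class_continuous[OF ldf_class]] by metis
  then obtain C where C: "\<And>a. C a > 0" "\<And>a x. x \<in> I \<Longrightarrow> \<bar>ldf a x\<bar> \<le> C a" by metis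
  show ?thesis
  proof (rule that[of "Max (range C)"])
    show "Max (range C) > 0" using C by (subst Max_gr_iff) auto
    show "\<bar>ldf a x\<bar> \<le> Max (range C)" if "x \<in> I" for a x
      using C(2)[OF that, of a] by (intro order_trans[OF _ Max_ge]) auto
  qed
qed

text \<open>\<open>s\<close> is the derivative of the logarithm of the derivative of the linearization of \<open>f a\<close>.\<close>

lemma koenigs:
  obtains s where "holder_class ord (frac r) I s" "\<And>x. x \<in> I \<Longrightarrow> s x = ldf a x + df a x * s (f a x)"
proof -
  have F: "f a ` I \<subseteq> I" using f_in by auto
  have 1: "\<bar>df a x\<bar> \<le> \<rho>" "\<bar>df a x\<bar> \<le> 1" if "x \<in> I" for x
    using df_le[OF that, of a] df_pos[OF that, of a] rho_bounds by auto
  show ?thesis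
    using cohomological_solution[OF F f_deriv 1(2) rho_bounds(2) 1(1) 
        holder_class_Suc_le[OF holder_class_Suc_le[OF f_class]] holder_class_Suc_le[OF df_class] ldf_class] that
    by blast
qed

lemma antiderivative:
  assumes "holder_class k (frac r) I s"
  obtains u where "\<And>x. x \<in> I \<Longrightarrow> (u has_real_derivative s x) (at x within I)"
    "holder_class (Suc k) (frac r) I u"
proof -
  obtain p q where pq: "p < q" "I = {p..q}" using segment by auto
  obtain u where "\<And>x. x \<in> {p..q} \<Longrightarrow> (u has_vector_derivative s x) (at x within {p..q})"
    using antiderivative_continuous[of p q s] holder_class_continuous[OF assms] pq by auto
  then have "\<And>x. x \<in> I \<Longrightarrow> (u has_real_derivative s x) (at x within I)"
    using pq by (simp add: has_real_derivative_iff_has_vector_derivative)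
  then show ?thesis using holder_class_SucI[OF _ assms] that by blast
qed

text \<open>\<open>w\<close> is the \<open>q\<close>-th root of a finite sum of iterates of the operator
  \<open>V \<mapsto> \<Sum>b. (V \<circ> f b) * (df b)^q\<close>, which is a contraction for large \<open>q\<close>; the telescoping makes
  every \<open>f b\<close> contract the metric with density \<open>w\<close> on all of \<open>I\<close> and not only on the attractor.\<close>

lemma adapted_density:
  assumes s: "holder_class ord (frac r) I s"
    and flat: "\<And>b \<omega>. s (f b (coding I f \<omega>)) * df b (coding I f \<omega>) + ldf b (coding I f \<omega>) = s (coding I f \<omega>)"
  obtains w where "holder_class (Suc ord) (frac r) I w" "\<And>x. x \<in> I \<Longrightarrow> w x > 0"
    "\<And>b x. x \<in> I \<Longrightarrow> w (f b x) * df b x < w x"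
    "\<And>\<omega>. (w has_real_derivative s (coding I f \<omega>) * w (coding I f \<omega>)) (at (coding I f \<omega>) within I)"
proof -
  let ?K = "range (coding I f)"
  have KI: "?K \<subseteq> I" using coding_in by auto
  obtain u where u: "\<And>x. x \<in> I \<Longrightarrow> (u has_real_derivative s x) (at x within I)"
    "holder_class (Suc ord) (frac r) I u" using antiderivative[OF s] by blast
  have "(\<lambda>q. real CARD('a) * \<rho> ^ q) \<longlonglongrightarrow> 0"
    using rho_bounds by (auto intro!: tendsto_eq_intros LIMSEQ_power_zero)
  then have "\<forall>\<^sub>F q in sequentially. real CARD('a) * \<rho> ^ q < 1/2" by (rule order_tendstoD) simp
  then have "\<forall>\<^sub>F q in sequentially. real CARD('a) * \<rho> ^ q < 1/2 \<and> 0 < q"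
    using eventually_gt_at_top by (rule eventually_conj)
  then obtain q :: nat where q: "real CARD('a) * \<rho> ^ q < 1/2" "0 < q"
    by (auto simp: eventually_sequentially)
  define V where "V j = ((\<lambda>V x. \<Sum>b\<in>UNIV. V (f b x) * df b x ^ q) ^^ j) (\<lambda>x. exp (q * u x))" for j :: nat
  have V_0: "V 0 x = exp (q * u x)" and V_Suc: "V (Suc j) x = (\<Sum>b\<in>UNIV. V j (f b x) * df b x ^ q)" for j x
    by (auto simp: V_def)
  have hs: "holder_segment I (frac r)" by unfold_locales
  have fI: "f b ` I \<subseteq> I" for b using f_in by auto
  have lip: "\<bar>f b x - f b y\<bar> \<le> \<rho> * \<bar>x - y\<bar>" if "x \<in> I" "y \<in> I" for b x y using f_contr that .
  have Vc: "holder_class (Suc ord) (frac r) I (V j)" for j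
  proof (induction j)
    case 0
    show ?case unfolding V_0[abs_def] by (intro holder_class_exp holder_class_cmult u)
  next
    case (Suc j)
    show ?case unfolding V_Suc[abs_def]
      by (intro holder_class_sum holder_class_mult holder_class_power df_class
          holder_class_comp[OF hs hs fI lip Suc holder_class_Suc_le[OF f_class]]) auto
  qed
  have Vpos: "0 < V j x" if "x \<in> I" for j x
    using that by (induction j arbitrary: x) (auto simp: V_0 V_Suc f_in df_pos intro!: sum_pos)
  obtain M where M: "M > 0" "\<And>x. x \<in> I \<Longrightarrow> \<bar>V 0 x\<bar> \<le> M"
    using abs_bound[OF holder_class_continuous[OF Vc]] by blast
  obtain m0 where m0: "m0 > 0" "\<And>x. x \<in> I \<Longrightarrow> m0 \<le> V 0 x"
    using pos_lower_bound[OF holder_class_continuous[OF Vc] Vpos] by blast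
  have Vle: "V j x \<le> (1/2) ^ j * M" if "x \<in> I" for j x
    using that
  proof (induction j arbitrary: x)
    case 0
    then show ?case using M(2)[of x] by simp
  next
    case (Suc j)
    have "V (Suc j) x \<le> (\<Sum>b\<in>(UNIV::'a set). ((1/2) ^ j * M) * \<rho> ^ q)"
      unfolding V_Suc using Suc Vpos df_pos df_le f_in M
      by (intro sum_mono mult_mono power_mono) (auto intro: less_imp_le)
    also have "\<dots> = (real CARD('a) * \<rho> ^ q) * ((1/2) ^ j * M)" by simp
    also have "\<dots> \<le> 1/2 * ((1/2) ^ j * M)" using q M by (intro mult_right_mono) auto
    finally show ?case by simp
  qed
  have "(\<lambda>m. (1/2) ^ m * M) \<longlonglongrightarrow> 0" by (auto intro!: tendsto_eq_intros LIMSEQ_power_zero)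
  then have "\<forall>\<^sub>F m in sequentially. (1/2) ^ m * M < m0" using m0(1) by (rule order_tendstoD)
  \<comment> \<open>From this depth on \<open>V m\<close> lies below \<open>V 0\<close> on all of
    \<open>I\<close>, so that the telescoped bound \<open>W - V 0 + V m\<close> is strictly smaller
    than \<open>W\<close>.\<close>
  then obtain m where m: "(1/2) ^ m * M < m0" by (auto simp: eventually_sequentially)
  define W where "W x = (\<Sum>j<m. V j x)" for x
  have "m \<noteq> 0"
  proof
    assume "m = 0"
    moreover obtain x where "x \<in> I" using nonempty_I by (meson ex_in_conv)
    ultimately show False using m M(2)[of x] m0(2)[of x] by simp
  qed
  then have Wpos: "0 < W x" if "x \<in> I" for x
    using Vpos that by (auto simp: W_def intro!: sum_pos)
  have Wc: "holder_class (Suc ord) (frac r) I W"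
    unfolding W_def[abs_def] by (intro holder_class_sum Vc) auto
  have Wf: "W (f b x) * df b x ^ q < W x" if x: "x \<in> I" for b x
  proof -
    have "W (f b x) * df b x ^ q = (\<Sum>j<m. V j (f b x) * df b x ^ q)"
      by (simp add: W_def sum_distrib_right)
    also have "\<dots> \<le> (\<Sum>j<m. V (Suc j) x)"
      unfolding V_Suc using x Vpos df_pos f_in
      by (intro sum_mono member_le_sum[of b UNIV]) (auto intro!: mult_nonneg_nonneg less_imp_le)
    also have "\<dots> = W x - V 0 x + V m x"
      unfolding W_def using sum.lessThan_Suc_shift[of "\<lambda>j. V j x" m] by simp
    also have "\<dots> < W x" using Vle[OF x, of m] m m0(2)[OF x] by linarith
    finally show ?thesis .
  qed
  \<comment> \<open>Flatness says that on the attractor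
    \<open>(V j \<circ> f b) * (df b) ^ q\<close> has logarithmic derivative
    \<open>q * (s (f b x) * df b x + ldf b x) = q * s x\<close>. This value is the same for every
    \<open>b\<close>, hence it is inherited by the sum: the operator preserves the logarithmic
    derivative \<open>q * s\<close> there.\<close>
  have Vd: "(V j has_real_derivative (q * s x) * V j x) (at x within I)" if "x \<in> ?K" for j x
    using that
  proof (induction j arbitrary: x)
    case 0
    then have "x \<in> I" using KI by auto
    have "((\<lambda>x. exp (q * u x)) has_real_derivative exp (q * u x) * (q * s x)) (at x within I)"
      using u(1)[OF \<open>x \<in> I\<close>] by (auto intro!: derivative_eq_intros)
    then show ?case by (simp add: V_0[abs_def] mult_ac)
  next
    case (Suc j)
    then have x: "x \<in> I" using KI by auto
    have fx: "f b x \<in> ?K" for b using Suc.prems range_coding_invariant by blast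
    have fl: "ddf b x = df b x * (s x - s (f b x) * df b x)" for b
    proof -
      obtain \<omega> where "x = coding I f \<omega>" using Suc.prems by auto
      then have "s x - s (f b x) * df b x = inverse (df b x) * ddf b x"
        using flat[of b \<omega>] by (simp add: ldf_def)
      then show ?thesis using df_pos[OF x, of b] by simp
    qed
    have 1: "((\<lambda>x. V j (f b x)) has_real_derivative (q * s (f b x)) * V j (f b x) * df b x) (at x within I)" for b
      by (rule deriv_chain_within[OF Suc.IH[OF fx] f_deriv[OF x] fI])
    have 2: "((\<lambda>x. df b x ^ q) has_real_derivative q * (s x - s (f b x) * df b x) * df b x ^ q) (at x within I)" for b
    proof -
      have "((\<lambda>x. df b x ^ q) has_real_derivative real q * df b x ^ (q - 1) * ddf b x) (at x within I)"
        using DERIV_power[OF df_deriv[OF x], of b q] by (simp add: mult_ac)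
      also have "real q * df b x ^ (q - 1) * ddf b x = q * (s x - s (f b x) * df b x) * (df b x * df b x ^ (q - 1))"
        unfolding fl by (simp add: mult_ac)
      also have "df b x * df b x ^ (q - 1) = df b x ^ q" using q(2) by (simp add: power_eq_if)
      finally show ?thesis .
    qed
    have "((\<lambda>x. V j (f b x) * df b x ^ q) has_real_derivative (q * s x) * (V j (f b x) * df b x ^ q)) (at x within I)" for b
      using DERIV_mult[OF 1[of b] 2[of b]] by (simp add: algebra_simps)
    then have "((\<lambda>x. \<Sum>b\<in>UNIV. V j (f b x) * df b x ^ q) has_real_derivative
        (\<Sum>b\<in>UNIV. (q * s x) * (V j (f b x) * df b x ^ q))) (at x within I)"
      by (intro DERIV_sum)
    then show ?case by (simp only: V_Suc[abs_def] sum_distrib_left)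
  qed
  have Wd: "(W has_real_derivative (q * s x) * W x) (at x within I)" if "x \<in> ?K" for x
  proof -
    have "((\<lambda>x. \<Sum>j<m. V j x) has_real_derivative (\<Sum>j<m. (q * s x) * V j x)) (at x within I)"
      by (intro DERIV_sum Vd that)
    then show ?thesis by (simp only: W_def[abs_def] sum_distrib_left)
  qed
  define w where "w x = exp (inverse q * ln (W x))" for x
  have wq: "w x ^ q = W x" if "x \<in> I" for x
    using Wpos[OF that] q(2) by (simp add: w_def exp_of_nat_mult[symmetric] mult.assoc[symmetric])
  have wpos: "w x > 0" for x by (simp add: w_def)
  show ?thesis
  proof (rule that)
    show "holder_class (Suc ord) (frac r) I w"
      unfolding w_def[abs_def] by (intro holder_class_exp holder_class_cmult holder_class_ln Wc Wpos)
    show "w x > 0" for x by (rule wpos)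
    show "w (f b x) * df b x < w x" if "x \<in> I" for b x
    proof (rule power_less_imp_less_base[of _ q])
      show "(w (f b x) * df b x) ^ q < w x ^ q"
        using Wf[OF that] by (simp add: power_mult_distrib wq that f_in)
    qed (simp add: wpos less_imp_le)
    show "(w has_real_derivative s (coding I f \<omega>) * w (coding I f \<omega>)) (at (coding I f \<omega>) within I)" for \<omega>
    proof -
      let ?x = "coding I f \<omega>"
      have "((\<lambda>x. ln (W x)) has_real_derivative inverse (W ?x) * ((q * s ?x) * W ?x)) (at ?x within I)"
        by (rule DERIV_ln_within[OF Wd Wpos[OF coding_in]]) auto
      then have "((\<lambda>x. ln (W x)) has_real_derivative (q * s ?x)) (at ?x within I)"
        using Wpos[OF coding_in, of \<omega>] by (simp add: field_simps)
      then have "(w has_real_derivative w ?x * (inverse q * (q * s ?x))) (at ?x within I)"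
        unfolding w_def[abs_def] by (intro DERIV_chain2[OF DERIV_exp] DERIV_cmult)
      moreover have "w ?x * (inverse q * (q * s ?x)) = s ?x * w ?x"
        using q(2) by (simp add: field_simps)
      ultimately show ?thesis by metis
    qed
  qed
qed

end

text \<open>Linearity is stated for \<open>Cr_on 2\<close>, whose fractional part is 0, while the
  conjugated maps are known to have Hoelder exponent \<open>frac r\<close>.\<close>

lemma (in holder_segment) holder_class_exponent_0:
  "holder_class k \<alpha> I g \<Longrightarrow> holder_class k 0 I g"
proof (induction k arbitrary: g)
  case 0
  then obtain C where C: "C > 0" "\<And>x. x \<in> I \<Longrightarrow> \<bar>g x\<bar> \<le> C" using abs_bound[of g] by auto
  have "\<bar>g x - g y\<bar> \<le> (2 * C) * \<bar>x - y\<bar> powr 0" if "x \<in> I" "y \<in> I" for x y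
    using C(2)[OF that(1)] C(2)[OF that(2)] by (cases "x = y") auto
  then have "\<forall>x\<in>I. \<forall>y\<in>I. \<bar>g x - g y\<bar> \<le> (2 * C) * \<bar>x - y\<bar> powr 0" by blast
  then show ?case using 0 unfolding holder_class.simps by blast
qed auto

context conformal_ifs
begin

text \<open>With \<open>H\<close> an antiderivative of \<open>w\<close> and \<open>h\<close> its
  inverse, the map \<open>H \<circ> f a \<circ> h\<close> has derivative
  \<open>\<kappa> a \<circ> h\<close>, where \<open>\<kappa> a = (w \<circ> f a) * df a / w\<close>.
  The inequality for \<open>w\<close> on \<open>I\<close> makes this less than 1. On the attractor
  the logarithmic derivative of \<open>\<kappa> a\<close> is
  \<open>s (f a x) * df a x + ldf a x - s x\<close>, which is zero by flatness, so the second
  derivative of the conjugated map vanishes.\<close>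

lemma flat_imp_conjugate_to_linear:
  assumes s: "holder_class ord (frac r) I s"
    and flat: "\<And>b \<omega>. s (f b (coding I f \<omega>)) * df b (coding I f \<omega>) + ldf b (coding I f \<omega>) = s (coding I f \<omega>)"
  shows "conjugate_to_linear r I f"
proof -
  obtain w where wc: "holder_class (Suc ord) (frac r) I w" and wpos: "\<And>x. x \<in> I \<Longrightarrow> w x > 0"
    and wf: "\<And>b x. x \<in> I \<Longrightarrow> w (f b x) * df b x < w x"
    and wd: "\<And>\<omega>. (w has_real_derivative s (coding I f \<omega>) * w (coding I f \<omega>)) (at (coding I f \<omega>) within I)"
    using adapted_density[OF s flat] by blast
  obtain H where H: "\<And>x. x \<in> I \<Longrightarrow> (H has_real_derivative w x) (at x within I)"
    and Hc: "holder_class (Suc (Suc ord)) (frac r) I H" using antiderivative[OF wc] by blast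
  define J where "J = H ` I"
  define h where "h = inv_into I H"
  have inv: "holder_segment J (frac r)" "inj_on H I"
    "\<And>y. y \<in> J \<Longrightarrow> (h has_real_derivative inverse (w (h y))) (at y within J)"
    "holder_class (Suc (Suc ord)) (frac r) J h"
    "\<exists>L. \<forall>x\<in>J. \<forall>y\<in>J. \<bar>h x - h y\<bar> \<le> L * \<bar>x - y\<bar>"
    unfolding J_def h_def by (rule inverse_function[OF H wc wpos]; assumption)+
  interpret J: holder_segment J "frac r" by (rule inv(1))
  have hs: "holder_segment I (frac r)" by unfold_locales
  have hH: "h (H x) = x" if "x \<in> I" for x unfolding h_def by (rule inv_into_f_f[OF inv(2) that])
  have hI: "h y \<in> I" and Hh: "H (h y) = y" if "y \<in> J" for y using that hH by (auto simp: J_def)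
  have HJ: "H x \<in> J" if "x \<in> I" for x using that by (simp add: J_def)
  define g where "g a y = H (f a (h y))" for a y
  have gJ: "g a y \<in> J" if "y \<in> J" for a y using that hI f_in HJ by (simp add: g_def)
  define \<kappa> where "\<kappa> a x = w (f a x) * df a x * inverse (w x)" for a x
  have gd: "(g a has_real_derivative \<kappa> a (h y)) (at y within J)" if y: "y \<in> J" for a y
  proof -
    have 1: "((\<lambda>y. f a (h y)) has_real_derivative df a (h y) * inverse (w (h y))) (at y within J)"
      by (rule deriv_chain_within[OF f_deriv[OF hI[OF y]] inv(3)[OF y]]) (use hI in auto)
    have "((\<lambda>y. H (f a (h y))) has_real_derivative w (f a (h y)) * (df a (h y) * inverse (w (h y)))) (at y within J)"
      by (rule deriv_chain_within[OF H[OF f_in[OF hI[OF y]]] 1]) (use hI f_in in auto)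
    then show ?thesis by (simp add: g_def[abs_def] \<kappa>_def mult_ac)
  qed
  have gdw: "deriv_within J (g a) y = \<kappa> a (h y)" if "y \<in> J" for a y using J.deriv_eq[OF that gd[OF that]] .
  have \<kappa>0: "0 < \<kappa> a x" if "x \<in> I" for a x
    using wpos that f_in df_pos by (simp add: \<kappa>_def)
  have \<kappa>1: "\<kappa> a x < 1" if "x \<in> I" for a x
    using wf[OF that, of a] wpos[OF that] by (simp add: \<kappa>_def field_simps)
  have \<kappa>cont: "continuous_on I (\<kappa> a)" for a
  proof -
    have "continuous_on I (\<lambda>x. w (f a x))"
      using continuous_on_compose2[OF holder_class_continuous[OF wc] f_cont] f_in by blast
    then show ?thesis unfolding \<kappa>_def[abs_def]
      using df_cont holder_class_continuous[OF wc] wpos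
      by (intro continuous_intros) (auto simp: less_imp_neq[symmetric])
  qed
  have "\<exists>L<1. 0 < L \<and> (\<forall>x\<in>I. \<kappa> a x \<le> L)" for a
  proof -
    obtain x where x: "x \<in> I" "\<forall>y\<in>I. \<kappa> a y \<le> \<kappa> a x"
      using continuous_attains_sup[OF compact_I nonempty_I \<kappa>cont] by blast
    then show ?thesis using \<kappa>0 \<kappa>1 by blast
  qed
  then obtain Lf where Lf: "\<And>a. Lf a < 1" "\<And>a. 0 < Lf a" "\<And>a x. x \<in> I \<Longrightarrow> \<kappa> a x \<le> Lf a" by metis
  define L where "L = Max (range Lf)"
  have L: "L < 1" "0 < L" "\<And>a x. x \<in> I \<Longrightarrow> \<kappa> a x \<le> L"
  proof -
    show "L < 1" "0 < L" unfolding L_def using Lf by (auto simp: Max_gr_iff)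
    show "\<kappa> a x \<le> L" if "x \<in> I" for a x
      using Lf(3)[OF that, of a] by (auto simp: L_def intro: order_trans[OF _ Max_ge])
  qed
  have glip: "\<bar>g a x - g a y\<bar> \<le> L * \<bar>x - y\<bar>" if "x \<in> J" "y \<in> J" for a x y
    by (rule J.lipschitz_bound[OF gd]) (use that hI L(3) \<kappa>0 in \<open>auto simp: abs_of_pos\<close>)
  interpret G: contracting_ifs J g L
    by unfold_locales (use L gJ glip in auto)
  have coding_g: "coding J g \<omega> = H (coding I f \<omega>)" for \<omega>
  proof (rule G.coding_eqI)
    fix y assume y: "y \<in> J"
    have 1: "word_map g \<omega> m (H x) = H (word_map f \<omega> m x)" if "x \<in> I" for m x
      using that by (induction m arbitrary: x) (auto simp: g_def hH f_in)
    have "(\<lambda>m. H (word_map f \<omega> m (h y))) \<longlonglongrightarrow> H (coding I f \<omega>)"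
      by (rule continuous_on_tendsto_compose[OF holder_class_continuous[OF Hc] coding_limit[OF hI[OF y]] coding_in])
         (auto simp: word_map_eq_foldr foldr_in hI[OF y])
    then show "(\<lambda>m. word_map g \<omega> m y) \<longlonglongrightarrow> H (coding I f \<omega>)"
      using 1[OF hI[OF y]] by (simp add: Hh[OF y])
  qed
  have gc: "holder_class (Suc (Suc ord)) (frac r) J (g a)" for a
  proof -
    obtain Lh where Lh: "\<And>x y. x \<in> J \<Longrightarrow> y \<in> J \<Longrightarrow> \<bar>h x - h y\<bar> \<le> Lh * \<bar>x - y\<bar>" using inv(5) by blast
    have 1: "holder_class (Suc (Suc ord)) (frac r) J (\<lambda>y. f a (h y))"
      by (rule holder_class_comp[OF hs J.holder_segment_axioms _ Lh f_class inv(4)]) (use hI in auto)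
    have 2: "\<bar>f a (h x) - f a (h y)\<bar> \<le> \<bar>Lh\<bar> * \<bar>x - y\<bar>" if "x \<in> J" "y \<in> J" for x y
    proof -
      have "\<bar>f a (h x) - f a (h y)\<bar> \<le> \<rho> * \<bar>h x - h y\<bar>" using f_contr hI that by simp
      also have "\<dots> \<le> 1 * \<bar>h x - h y\<bar>" using rho by (intro mult_right_mono) auto
      finally show ?thesis using Lh[OF that] mult_right_mono[OF abs_ge_self[of Lh] abs_ge_zero[of "x - y"]] by linarith
    qed
    show ?thesis unfolding g_def[abs_def]
      by (rule holder_class_comp[OF hs J.holder_segment_axioms _ 2 Hc 1]) (use hI f_in in auto)
  qed
  have "Cr_ifs 2 J g"
    unfolding Cr_ifs_def ifs_def
  proof (intro conjI allI)
    show "\<exists>u v. u < v \<and> J = {u..v}" by (rule J.segment)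
    show "g a ` J \<subseteq> J" for a using gJ by auto
    show "g a differentiable_on J" for a using gc[of a] by simp
    show "\<exists>L<1. L-lipschitz_on J (g a)" for a
      using glip L by (intro exI[of _ L]) (auto simp: dist_real_def intro!: lipschitz_onI)
    obtain a b where ab: "coding I f (\<lambda>_. a) \<noteq> coding I f (\<lambda>_. b)" using two_fixed_points by blast
    then have "H (coding I f (\<lambda>_. a)) \<noteq> H (coding I f (\<lambda>_. b))"
      using coding_in inv(2) by (metis inj_on_eq_iff)
    then show "\<exists>a b. fixed_point J (g a) \<noteq> fixed_point J (g b)"
      by (metis G.coding_const coding_g)
    show "Cr_on 2 J (g a)" for a
    proof -
      have "holder_class (Suc (Suc 0)) (frac r) J (g a)"
        by (rule J.holder_class_le[OF _ gc]) simp
      then have "holder_class (Suc (Suc 0)) 0 J (g a)" by (rule J.holder_class_exponent_0)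
      moreover have "nat \<lfloor>2::real\<rfloor> = Suc (Suc 0)" "frac (2::real) = 0" by (auto simp: frac_def)
      ultimately show ?thesis by (simp only: Cr_on_iff_holder_class)
    qed
  qed
  moreover have "(deriv_within J ^^ 2) (g a) y = 0" if att: "y \<in> attractor J g" for a y
  proof -
    obtain \<omega> where y: "y = H (coding I f \<omega>)" using att by (auto simp: G.attractor_eq coding_g)
    let ?x = "coding I f \<omega>"
    have xI: "?x \<in> I" and yJ: "y \<in> J" using coding_in HJ y by auto
    have hy: "h y = ?x" using y hH xI by simp
    have fx: "f a ?x = coding I f (prepend a \<omega>)" by (simp add: coding_prepend)
    have 1: "((\<lambda>x. w (f a x)) has_real_derivative (s (f a ?x) * w (f a ?x)) * df a ?x) (at ?x within I)"
      by (rule deriv_chain_within[OF _ f_deriv[OF xI]]) (use wd f_in fx in auto)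
    have 2: "((\<lambda>x. inverse (w x)) has_real_derivative - (s ?x * inverse (w ?x))) (at ?x within I)"
      using DERIV_inverse_fun[OF wd[of \<omega>]] wpos[OF xI] by (auto simp: field_simps)
    have 3: "ddf a ?x = df a ?x * (s ?x - s (f a ?x) * df a ?x)"
    proof -
      have "s ?x - s (f a ?x) * df a ?x = inverse (df a ?x) * ddf a ?x"
        using flat[of a \<omega>] by (simp add: ldf_def)
      then show ?thesis using df_pos[OF xI, of a] by simp
    qed
    have "(\<kappa> a has_real_derivative 0) (at ?x within I)"
      using DERIV_mult[OF DERIV_mult[OF 1 df_deriv[OF xI, of a]] 2]
      unfolding \<kappa>_def[abs_def] 3 by (simp add: algebra_simps)
    then have "((\<lambda>y. \<kappa> a (h y)) has_real_derivative 0 * inverse (w (h y))) (at y within J)"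
      using deriv_chain_within[OF _ inv(3)[OF yJ], of "\<kappa> a" 0 I] hI by (auto simp: hy)
    then have "(deriv_within J (g a) has_real_derivative 0) (at y within J)"
      using yJ gdw by (auto simp: has_field_derivative_def intro: has_derivative_transform[rotated 2])
    then show ?thesis using J.deriv_eq[OF yJ] by (simp add: eval_nat_numeral)
  qed
  ultimately have "linear_ifs J g" by (auto simp: linear_ifs_def)
  moreover have "Cr_conjugate r I f J g"
    unfolding Cr_conjugate_def
  proof (intro exI[of _ h] conjI)
    have ih: "inv_into J h x = H x" if "x \<in> I" for x
    proof (rule inv_into_f_eq)
      show "inj_on h J" by (rule inj_on_inverseI[of _ H]) (rule Hh)
    qed (use that HJ hH in auto)
    have "bij_betw h J I"
      by (rule bij_betwI[of _ _ _ H]) (use hI HJ hH Hh in auto)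
    moreover have "Cr_on r J h" using inv(4) by (simp only: Cr_on_iff_holder_class ord)
    moreover have "Cr_on r I (inv_into J h)"
      unfolding Cr_on_iff_holder_class ord by (rule holder_class_cong[OF Hc]) (simp add: ih)
    ultimately show "Cr_diffeo r J I h" by (simp add: Cr_diffeo_def)
    have "restrict (h \<circ> g a \<circ> inv_into J h) I = restrict (f a) I" for a
      by (rule restrict_ext) (simp add: ih g_def hH f_in)
    then show "range (\<lambda>a. restrict (f a) I) = range (\<lambda>a. restrict (h \<circ> g a \<circ> inv_into J h) I)" by simp
  qed
  ultimately show ?thesis unfolding conjugate_to_linear_def by blast
qed

end

section \<open>Nonlinearity at the scale of the frequency\<close>

context conformal_ifs
begin

text \<open>A common prefix of length \<open>N\<close> contracts the distance of the tails by
  \<open>\<rho> ^ N\<close>. Since \<open>word_dist\<close> counts positions from 1, its value is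
  \<open>\<rho> ^ (N + 1)\<close>, hence the constant \<open>D / \<rho>\<close>.\<close>

lemma coding_lipschitz:
  "\<exists>C>0. \<forall>\<omega> \<omega>'. \<bar>coding I f \<omega> - coding I f \<omega>'\<bar> \<le> C * word_dist \<rho> \<omega> \<omega>'"
proof -
  obtain D where D: "D > 0" "\<And>x y. x \<in> I \<Longrightarrow> y \<in> I \<Longrightarrow> \<bar>x - y\<bar> \<le> D" using diam by blast
  have "\<bar>coding I f \<omega> - coding I f \<omega>'\<bar> \<le> D / \<rho> * word_dist \<rho> \<omega> \<omega>'" for \<omega> \<omega>'
  proof (cases "\<omega> = \<omega>'")
    case False
    define N where "N = (LEAST n. \<omega> n \<noteq> \<omega>' n)"
    define w where "w = map \<omega> [0..<N]"
    have "\<omega> n = \<omega>' n" if "n < N" for n using not_less_Least that unfolding N_def by blast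
    then have w': "w = map \<omega>' [0..<N]" by (simp add: w_def)
    have 1: "coding I f \<omega> = foldr f w (coding I f (\<lambda>n. \<omega> (n + N)))"
      using foldr_prepend_take[of \<omega> N] unfolding w_def coding_foldr[symmetric] by simp
    have 2: "coding I f \<omega>' = foldr f w (coding I f (\<lambda>n. \<omega>' (n + N)))"
      using foldr_prepend_take[of \<omega>' N] unfolding w' coding_foldr[symmetric] by simp
    have "\<bar>coding I f \<omega> - coding I f \<omega>'\<bar> \<le> \<rho> ^ length w * \<bar>coding I f (\<lambda>n. \<omega> (n + N)) - coding I f (\<lambda>n. \<omega>' (n + N))\<bar>"
      unfolding 1 2 by (rule foldr_contr[OF coding_in coding_in])
    also have "\<dots> \<le> \<rho> ^ length w * D"
      using D(2)[OF coding_in coding_in] rho by (intro mult_left_mono) auto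
    also have "\<dots> = D / \<rho> * word_dist \<rho> \<omega> \<omega>'"
      using False rho by (simp add: word_dist_def w_def N_def[symmetric])
    finally show ?thesis .
  qed (simp add: word_dist_def)
  then show ?thesis using D rho by (intro exI[of _ "D / \<rho>"]) auto
qed

lemma cocycle_lipschitz:
  obtains C where "C > 0"
    "\<And>a \<omega> \<omega>'. \<bar>cocycle I f a \<omega> - cocycle I f a \<omega>'\<bar> \<le> C * word_dist \<rho> \<omega> \<omega>'"
proof -
  obtain A where A: "A > 0" "\<And>\<omega> \<omega>'. \<bar>coding I f \<omega> - coding I f \<omega>'\<bar> \<le> A * word_dist \<rho> \<omega> \<omega>'"
    using coding_lipschitz by blast
  obtain B where B: "B > 0" "\<And>a x. x \<in> I \<Longrightarrow> \<bar>ldf a x\<bar> \<le> B" using ldf_bound by blast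
  have "\<bar>cocycle I f a \<omega> - cocycle I f a \<omega>'\<bar> \<le> (B * A) * word_dist \<rho> \<omega> \<omega>'" for a \<omega> \<omega>'
  proof -
    have "\<bar>ln (df a (coding I f \<omega>)) - ln (df a (coding I f \<omega>'))\<bar> \<le> B * \<bar>coding I f \<omega> - coding I f \<omega>'\<bar>"
      using lipschitz_bound[OF ln_df_deriv B(2) coding_in coding_in] by blast
    also have "\<dots> \<le> B * (A * word_dist \<rho> \<omega> \<omega>')" using A(2) B(1) by (intro mult_left_mono) auto
    finally show ?thesis by (simp add: cocycle_def mult.assoc)
  qed
  then show ?thesis using A B that[of "B * A"] by simp
qed

lemma foldr_lower:
  assumes l: "0 < l" "\<And>a x. x \<in> I \<Longrightarrow> l \<le> df a x" and xy: "x \<in> I" "y \<in> I"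
  shows "l ^ length w * \<bar>x - y\<bar> \<le> \<bar>foldr f w x - foldr f w y\<bar>"
proof (induction w)
  case (Cons a w)
  have step: "l * (y - x) \<le> f a y - f a x" if xy: "x \<in> I" "y \<in> I" "x < y" for x y
  proof -
    obtain z where z: "z \<in> {x<..<y}" "f a y - f a x = df a z * (y - x)"
      using mvt_within[OF segment f_deriv xy] by blast
    then have "z \<in> I" using xy segment by auto
    then show ?thesis using z l(2)[of z a] xy by (simp add: mult_right_mono)
  qed
  have step': "l * \<bar>x - y\<bar> \<le> \<bar>f a x - f a y\<bar>" if "x \<in> I" "y \<in> I" for x y
    using step[of x y] step[of y x] that by (cases x y rule: linorder_cases) auto
  have "l ^ length (a # w) * \<bar>x - y\<bar> \<le> l * \<bar>foldr f w x - foldr f w y\<bar>"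
    using Cons l by (simp add: mult.assoc)
  also have "\<dots> \<le> \<bar>f a (foldr f w x) - f a (foldr f w y)\<bar>"
    using step' foldr_in xy by blast
  finally show ?case by simp
qed auto

text \<open>Any tail point is at least half the gap away from one of two distinct fixed points.
  Carrying this pair through the first \<open>N\<close> letters of \<omega> gives a second attractor
  point whose distance is controlled from both sides, at every depth \<open>N\<close>.\<close>

lemma uniformly_perfect:
  obtains D l G where "0 < D" "0 < l" "l < 1" "0 < G"
    "\<And>\<omega> N. \<exists>\<omega>'. G * l ^ N \<le> \<bar>coding I f \<omega>' - coding I f \<omega>\<bar> \<and> \<bar>coding I f \<omega>' - coding I f \<omega>\<bar> \<le> \<rho> ^ N * D"
proof -
  obtain D where D: "D > 0" "\<And>x y. x \<in> I \<Longrightarrow> y \<in> I \<Longrightarrow> \<bar>x - y\<bar> \<le> D" using diam by blast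
  obtain l where l: "l > 0" "\<And>a x. x \<in> I \<Longrightarrow> l \<le> df a x" using df_lower by blast
  have "l < 1" using l(2)[OF coding_in] df_le[OF coding_in] rho_bounds by (meson le_less_trans)
  obtain a b where ab: "coding I f (\<lambda>_. a) \<noteq> coding I f (\<lambda>_. b)" using two_fixed_points by blast
  define G where "G = \<bar>coding I f (\<lambda>_. a) - coding I f (\<lambda>_. b)\<bar> / 2"
  have "\<exists>\<omega>'. G * l ^ N \<le> \<bar>coding I f \<omega>' - coding I f \<omega>\<bar> \<and> \<bar>coding I f \<omega>' - coding I f \<omega>\<bar> \<le> \<rho> ^ N * D" for \<omega> N
  proof -
    define w where "w = map \<omega> [0..<N]"
    let ?x = "coding I f (\<lambda>n. \<omega> (n + N))"
    have x: "coding I f \<omega> = foldr f w ?x"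
      using foldr_prepend_take[of \<omega> N] unfolding w_def coding_foldr[symmetric] by simp
    have "G \<le> \<bar>coding I f (\<lambda>_. a) - ?x\<bar> \<or> G \<le> \<bar>coding I f (\<lambda>_. b) - ?x\<bar>"
      unfolding G_def by argo
    then obtain e where e: "G \<le> \<bar>coding I f (\<lambda>_. e) - ?x\<bar>" by blast
    let ?y = "coding I f (\<lambda>_::nat. e)"
    have 1: "l ^ N * \<bar>?y - ?x\<bar> \<le> \<bar>foldr f w ?y - foldr f w ?x\<bar>"
      using foldr_lower[OF l coding_in coding_in, of w] by (simp add: w_def)
    have 2: "\<bar>foldr f w ?y - foldr f w ?x\<bar> \<le> \<rho> ^ N * \<bar>?y - ?x\<bar>"
      using foldr_contr[OF coding_in coding_in, of w] by (simp add: w_def)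
    have "G * l ^ N \<le> l ^ N * \<bar>?y - ?x\<bar>" using e l by (simp add: mult.commute mult_left_mono)
    moreover have "\<rho> ^ N * \<bar>?y - ?x\<bar> \<le> \<rho> ^ N * D" using D(2)[OF coding_in coding_in] rho by (intro mult_left_mono) auto
    ultimately show ?thesis using 1 2 unfolding x by (intro exI[of _ "foldr prepend w (\<lambda>_. e)"]) (simp only: coding_foldr, linarith)
  qed
  then show ?thesis using that[of D l G] D l \<open>l < 1\<close> ab by (simp add: G_def)
qed

text \<open>By the chain rule this is the logarithm of the derivative of \<open>f a ^^ k\<close>.
  Its derivative is the \<open>k\<close>-th partial sum of the equation solved in
  \<open>koenigs\<close>, and so converges geometrically to \<open>s\<close>.\<close>

definition birkhoff :: "'a \<Rightarrow> nat \<Rightarrow> real \<Rightarrow> real" where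
  "birkhoff a k x = (\<Sum>i<k. ln (df a ((f a ^^ i) x)))"

lemma birkhoff_Suc: "birkhoff a (Suc k) x = ln (df a x) + birkhoff a k (f a x)"
  unfolding birkhoff_def sum.lessThan_Suc_shift by (simp add: funpow_swap1)

lemma birkhoff_deriv:
  "x \<in> I \<Longrightarrow> (birkhoff a k has_real_derivative cohom_iter (f a) (df a) (ldf a) k x) (at x within I)"
proof (induction k arbitrary: x)
  case 0
  show ?case by (simp add: birkhoff_def[abs_def])
next
  case (Suc k)
  have "((\<lambda>x. birkhoff a k (f a x)) has_real_derivative cohom_iter (f a) (df a) (ldf a) k (f a x) * df a x) (at x within I)"
    by (rule deriv_chain_within[OF Suc.IH[OF f_in[OF Suc.prems]] f_deriv[OF Suc.prems]]) (use f_in in auto)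
  from DERIV_add[OF ln_df_deriv[OF Suc.prems] this] show ?case
    by (simp add: birkhoff_Suc[abs_def] mult.commute)
qed

text \<open>If the IFS is not conjugate to a linear one then the limit of the derivatives of \<open>\<Psi> k\<close> is
  nonzero at some point of the attractor.\<close>

lemma nonlinear_bilipschitz:
  fixes a :: 'a
  assumes "\<not> conjugate_to_linear r I f"
  defines "\<Psi> \<equiv> \<lambda>b k x. birkhoff a k (f b x) + ln (df b x) - birkhoff a k x"
  obtains b \<omega>0 m \<delta> k0 where "0 < m" "0 < \<delta>"
    "\<And>k y. k0 \<le> k \<Longrightarrow> y \<in> I \<Longrightarrow> \<bar>y - coding I f \<omega>0\<bar> < \<delta> \<Longrightarrow>
      m * \<bar>y - coding I f \<omega>0\<bar> \<le> \<bar>\<Psi> b k y - \<Psi> b k (coding I f \<omega>0)\<bar> \<and>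
      \<bar>\<Psi> b k y - \<Psi> b k (coding I f \<omega>0)\<bar> \<le> 3 * m * \<bar>y - coding I f \<omega>0\<bar>"
proof -
  obtain s where s: "holder_class ord (frac r) I s" "\<And>x. x \<in> I \<Longrightarrow> s x = ldf a x + df a x * s (f a x)"
    using koenigs[of a] by blast
  obtain b \<omega>0 where "s (f b (coding I f \<omega>0)) * df b (coding I f \<omega>0) + ldf b (coding I f \<omega>0) \<noteq> s (coding I f \<omega>0)"
    using flat_imp_conjugate_to_linear[OF s(1)] assms(1) by blast
  define x0 where "x0 = coding I f \<omega>0"
  define \<psi> where "\<psi> x = s (f b x) * df b x + ldf b x - s x" for x
  have x0: "x0 \<in> I" "\<psi> x0 \<noteq> 0"
    using coding_in \<open>_ \<noteq> _\<close> by (auto simp: x0_def \<psi>_def)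
  \<comment> \<open>Half of the limiting slope. The errors below are \<open>m / 2\<close> from
    continuity of \<psi> and twice \<open>m / 4\<close> from replacing \<open>s\<close> by partial
    sums; they add up to \<open>m\<close>, which keeps the slope of \<open>\<Psi> b k\<close>
    between \<open>m\<close> and \<open>3 * m\<close> in modulus.\<close>
  define m where "m = \<bar>\<psi> x0\<bar> / 2"
  have m: "0 < m" using x0 by (simp add: m_def)
  note cs = holder_class_continuous[OF s(1)]
  have fI: "f b ` I \<subseteq> I" for b using f_in by auto
  have "continuous_on I \<psi>"
    unfolding \<psi>_def
    by (intro continuous_intros continuous_on_compose2[OF cs f_cont fI] df_cont cs
        holder_class_continuous[OF ldf_class])
  then obtain \<delta> where \<delta>: "0 < \<delta>" "\<And>y. y \<in> I \<Longrightarrow> \<bar>y - x0\<bar> < \<delta> \<Longrightarrow> \<bar>\<psi> y - \<psi> x0\<bar> < m / 2"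
    using x0 m unfolding continuous_on_iff dist_real_def by (meson half_gt_zero)
  obtain B where B: "B > 0" "\<And>x. x \<in> I \<Longrightarrow> \<bar>s x\<bar> \<le> B" using abs_bound[OF cs] by blast
  define S where "S = cohom_iter (f a) (df a) (ldf a)"
  have SB: "\<bar>S k x - s x\<bar> \<le> \<rho> ^ k * B" if "x \<in> I" for k x
    unfolding S_def
    by (rule cohom_iter_approx[where s = s and F = "f a", OF fI _ s(2) B(2) that])
       (use df_le df_pos in \<open>auto simp: abs_of_pos\<close>)
  have "(\<lambda>k. \<rho> ^ k * B) \<longlonglongrightarrow> 0" using rho by (auto intro!: tendsto_eq_intros LIMSEQ_power_zero)
  then have "\<forall>\<^sub>F k in sequentially. \<rho> ^ k * B < m / 4" by (rule order_tendstoD) (use m in simp)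
  then obtain k0 where k0: "\<And>k. k0 \<le> k \<Longrightarrow> \<rho> ^ k * B < m / 4" by (auto simp: eventually_sequentially)
  define \<Psi>' where "\<Psi>' k x = S k (f b x) * df b x + ldf b x - S k x" for k x
  have \<Psi>': "(\<Psi> b k has_real_derivative \<Psi>' k x) (at x within I)" if x: "x \<in> I" for k x
  proof -
    have "((\<lambda>x. birkhoff a k (f b x)) has_real_derivative S k (f b x) * df b x) (at x within I)"
      unfolding S_def by (rule deriv_chain_within[OF birkhoff_deriv[OF f_in[OF x]] f_deriv[OF x] fI])
    then show ?thesis
      unfolding \<Psi>_def \<Psi>'_def S_def
      by (intro DERIV_diff DERIV_add ln_df_deriv[OF x] birkhoff_deriv[OF x])
  qed
  have close: "\<bar>\<Psi>' k y - \<psi> x0\<bar> \<le> m" if k: "k0 \<le> k" and y: "y \<in> I" "\<bar>y - x0\<bar> < \<delta>" for k y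
  proof -
    have "\<Psi>' k y - \<psi> x0 = (S k (f b y) - s (f b y)) * df b y - (S k y - s y) + (\<psi> y - \<psi> x0)"
      by (simp add: \<Psi>'_def \<psi>_def algebra_simps)
    moreover have "\<bar>(S k (f b y) - s (f b y)) * df b y\<bar> \<le> m / 4 * 1"
      unfolding abs_mult
      using SB[OF f_in[OF y(1)], of k b] k0[OF k] df_le[OF y(1), of b] df_pos[OF y(1), of b] rho m
      by (intro mult_mono) auto
    moreover have "\<bar>S k y - s y\<bar> \<le> m / 4" using SB[OF y(1), of k] k0[OF k] by linarith
    ultimately show ?thesis using \<delta>(2)[OF y] by linarith
  qed
  have size: "m \<le> \<bar>\<Psi>' k y\<bar> \<and> \<bar>\<Psi>' k y\<bar> \<le> 3 * m" if "k0 \<le> k" "y \<in> I" "\<bar>y - x0\<bar> < \<delta>" for k y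
  proof -
    have "\<bar>\<psi> x0\<bar> = 2 * m" by (simp add: m_def)
    then show ?thesis using close[OF that] by (intro conjI) linarith+
  qed
  have bil: "m * \<bar>y - x0\<bar> \<le> \<bar>\<Psi> b k y - \<Psi> b k x0\<bar> \<and> \<bar>\<Psi> b k y - \<Psi> b k x0\<bar> \<le> 3 * m * \<bar>y - x0\<bar>"
    if k: "k0 \<le> k" and y: "y \<in> I" "\<bar>y - x0\<bar> < \<delta>" for k y
  proof -
    have "\<exists>z. z \<in> I \<and> \<bar>z - x0\<bar> < \<delta> \<and> \<bar>\<Psi> b k y - \<Psi> b k x0\<bar> = \<bar>\<Psi>' k z\<bar> * \<bar>y - x0\<bar>"
    proof (cases y x0 rule: linorder_cases)
      case less
      obtain z where z: "z \<in> {y<..<x0}" "\<Psi> b k x0 - \<Psi> b k y = \<Psi>' k z * (x0 - y)"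
        using mvt_within[OF segment \<Psi>' y(1) x0(1) less] by blast
      have "\<bar>\<Psi> b k y - \<Psi> b k x0\<bar> = \<bar>\<Psi>' k z\<bar> * \<bar>y - x0\<bar>"
        using z(2) by (metis abs_minus_commute abs_mult)
      then show ?thesis using z(1) y x0 segment by (intro exI[of _ z]) auto
    next
      case greater
      obtain z where z: "z \<in> {x0<..<y}" "\<Psi> b k y - \<Psi> b k x0 = \<Psi>' k z * (y - x0)"
        using mvt_within[OF segment \<Psi>' x0(1) y(1) greater] by blast
      have "\<bar>\<Psi> b k y - \<Psi> b k x0\<bar> = \<bar>\<Psi>' k z\<bar> * \<bar>y - x0\<bar>"
        using z(2) by (metis abs_mult)
      then show ?thesis using z(1) y x0 segment by (intro exI[of _ z]) auto
    qed (use x0 \<delta> in auto)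
    then show ?thesis using size[OF k] by (metis abs_ge_zero mult_right_mono)
  qed
  show ?thesis by (rule that[of m \<delta> k0 \<omega>0 b]) (use m \<delta> bil in \<open>auto simp: x0_def\<close>)
qed

text \<open>The upper bound \<open>1/2\<close> guarantees that the phase difference does not come
  close to a nonzero integer, so its size modulo 1 is its absolute value. Points at depth
  \<open>N\<close> of order log |\<theta>| / \<sigma> are close enough for this, yet by uniform
  perfectness still at distance of order \<open>l ^ N\<close>, that is |\<theta>| to the power
  \<open>-\<mu> / \<sigma>\<close>.\<close>

lemma nonlinear_gap:
  fixes a :: 'a
  assumes "\<not> conjugate_to_linear r I f"
  defines "\<Psi> \<equiv> \<lambda>b k x. birkhoff a k (f b x) + ln (df b x) - birkhoff a k x"
  obtains b k0 K0 l where "0 < K0"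
    "\<And>\<theta> k. 1 < \<bar>\<theta>\<bar> \<Longrightarrow> k0 \<le> k \<Longrightarrow> \<exists>\<omega> \<omega>'.
       K0 * \<bar>\<theta>\<bar> powr - l \<le> \<bar>\<theta> * (\<Psi> b k (coding I f \<omega>) - \<Psi> b k (coding I f \<omega>'))\<bar> \<and>
       \<bar>\<theta> * (\<Psi> b k (coding I f \<omega>) - \<Psi> b k (coding I f \<omega>'))\<bar> \<le> 1/2"
proof -
  obtain b \<omega>0 m \<delta> k0 where m: "0 < m" and \<delta>: "0 < \<delta>" and
    bil: "\<And>k y. k0 \<le> k \<Longrightarrow> y \<in> I \<Longrightarrow> \<bar>y - coding I f \<omega>0\<bar> < \<delta> \<Longrightarrow>
      m * \<bar>y - coding I f \<omega>0\<bar> \<le> \<bar>\<Psi> b k y - \<Psi> b k (coding I f \<omega>0)\<bar> \<and>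
      \<bar>\<Psi> b k y - \<Psi> b k (coding I f \<omega>0)\<bar> \<le> 3 * m * \<bar>y - coding I f \<omega>0\<bar>"
    using nonlinear_bilipschitz[OF assms(1), of a] unfolding \<Psi>_def by metis
  obtain D l G where D: "0 < D" and l: "0 < l" "l < 1" and G: "0 < G" and
    perf: "\<And>\<omega> N. \<exists>\<omega>'. G * l ^ N \<le> \<bar>coding I f \<omega>' - coding I f \<omega>\<bar> \<and> \<bar>coding I f \<omega>' - coding I f \<omega>\<bar> \<le> \<rho> ^ N * D"
    using uniformly_perfect by blast
  define \<sigma> where "\<sigma> = - ln \<rho>"
  define \<mu> where "\<mu> = - ln l"
  have \<sigma>: "0 < \<sigma>" and \<mu>: "0 < \<mu>" using rho l by (auto simp: \<sigma>_def \<mu>_def)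
  \<comment> \<open>The entry \<open>2 * D / \<delta>\<close> keeps the points within \<delta> of
    each other, and \<open>6 * m * D\<close> turns the Lipschitz bound \<open>3 * m * D / E\<close>
    into at most \<open>1/2\<close>.\<close>
  define E where "E = max D (max (2 * D / \<delta>) (6 * m * D))"
  define A where "A = ln E"
  have E: "0 < E" "D / E < \<delta>" "3 * m * (D / E) \<le> 1/2"
  proof -
    show E0: "0 < E" using D by (simp add: E_def)
    have "2 * D / \<delta> \<le> E" "6 * m * D \<le> E" by (auto simp: E_def)
    then show "D / E < \<delta>" "3 * m * (D / E) \<le> 1/2" using E0 \<delta> D by (auto simp: field_simps)
  qed
  have rN: "\<rho> ^ N = exp (- \<sigma> * N)" "l ^ N = exp (- \<mu> * N)" for N
    using rho l by (simp_all add: \<sigma>_def \<mu>_def exp_of_nat_mult mult.commute[of _ "real N"])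
  \<comment> \<open>Rounding makes \<open>N\<close> at most \<open>(L + |A|) / \<sigma> + 1\<close>.
    The part of \<open>m * G * l ^ N\<close> not depending on \<open>L\<close> becomes
    \<open>K0\<close>, the rest is the power of |\<theta>|.\<close>
  define K0 where "K0 = m * G * exp (- \<mu> * (\<bar>A\<bar> / \<sigma> + 1))"
  have K0: "0 < K0" using m G by (simp add: K0_def)
  have "\<exists>\<omega> \<omega>'.
       K0 * \<bar>\<theta>\<bar> powr - (\<mu> / \<sigma>) \<le> \<bar>\<theta> * (\<Psi> b k (coding I f \<omega>) - \<Psi> b k (coding I f \<omega>'))\<bar> \<and>
       \<bar>\<theta> * (\<Psi> b k (coding I f \<omega>) - \<Psi> b k (coding I f \<omega>'))\<bar> \<le> 1/2"
    if \<theta>: "1 < \<bar>\<theta>\<bar>" and k: "k0 \<le> k" for \<theta> k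
  proof -
    define L where "L = ln \<bar>\<theta>\<bar>"
    have L: "0 < L" "\<bar>\<theta>\<bar> = exp L" using \<theta> by (auto simp: L_def)
    \<comment> \<open>This depth makes \<open>\<rho> ^ N\<close> at most
      \<open>1 / (E * |\<theta>|)\<close>; |A| replaces \<open>A = ln E\<close> to keep the argument
      nonnegative.\<close>
    define N where "N = nat \<lceil>(L + \<bar>A\<bar>) / \<sigma>\<rceil>"
    have "0 \<le> (L + \<bar>A\<bar>) / \<sigma>" using L \<sigma> by simp
    then have N: "(L + \<bar>A\<bar>) / \<sigma> \<le> N" "N \<le> (L + \<bar>A\<bar>) / \<sigma> + 1" unfolding N_def by (simp_all add: of_nat_ceiling)
    obtain \<omega>' where \<omega>': "G * l ^ N \<le> \<bar>coding I f \<omega>' - coding I f \<omega>0\<bar>" "\<bar>coding I f \<omega>' - coding I f \<omega>0\<bar> \<le> \<rho> ^ N * D"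
      using perf by blast
    let ?t = "\<bar>coding I f \<omega>' - coding I f \<omega>0\<bar>"
    have "L + A \<le> \<sigma> * N" using N(1) \<sigma> by (simp add: field_simps abs_if split: if_splits)
    then have "\<rho> ^ N \<le> exp (- (L + A))" unfolding rN by simp
    also have "\<dots> = inverse (\<bar>\<theta>\<bar> * E)" by (simp only: A_def exp_minus exp_add L(2) exp_ln[OF E(1)])
    finally have "\<rho> ^ N * D \<le> inverse (\<bar>\<theta>\<bar> * E) * D" using D by (intro mult_right_mono) auto
    then have t: "?t \<le> D / E / \<bar>\<theta>\<bar>" using \<omega>'(2) by (simp add: field_simps)
    also have "\<dots> \<le> D / E" using \<theta> D E by (simp add: divide_le_eq mult_left_le mult_le_cancel_left1)
    finally have "?t < \<delta>" using E by linarith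
    note bil' = bil[OF k coding_in this]
    have "\<bar>\<theta>\<bar> * \<bar>\<Psi> b k (coding I f \<omega>') - \<Psi> b k (coding I f \<omega>0)\<bar> \<le> \<bar>\<theta>\<bar> * (3 * m * (D / E / \<bar>\<theta>\<bar>))"
    proof (intro mult_left_mono)
      have "3 * m * ?t \<le> 3 * m * (D / E / \<bar>\<theta>\<bar>)" using t m by (intro mult_left_mono) auto
      then show "\<bar>\<Psi> b k (coding I f \<omega>') - \<Psi> b k (coding I f \<omega>0)\<bar> \<le> 3 * m * (D / E / \<bar>\<theta>\<bar>)"
        using bil' by linarith
    qed auto
    also have "\<dots> = 3 * m * (D / E)" using \<theta> by simp
    finally have up: "\<bar>\<theta>\<bar> * \<bar>\<Psi> b k (coding I f \<omega>') - \<Psi> b k (coding I f \<omega>0)\<bar> \<le> 1/2" using E by linarith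
    have "K0 * \<bar>\<theta>\<bar> powr - (\<mu> / \<sigma>) = m * (G * exp (- \<mu> * ((L + \<bar>A\<bar>) / \<sigma> + 1)))"
      using \<theta> by (simp add: K0_def powr_def L_def flip: exp_add) (simp add: algebra_simps add_divide_distrib)
    also have "\<dots> \<le> m * (G * l ^ N)"
      unfolding rN using N(2) \<mu> m G by (intro mult_left_mono) auto
    also have "\<dots> \<le> m * ?t" using \<omega>'(1) m by (intro mult_left_mono) auto
    also have "\<dots> \<le> 1 * \<bar>\<Psi> b k (coding I f \<omega>') - \<Psi> b k (coding I f \<omega>0)\<bar>" using bil' by simp
    also have "\<dots> \<le> \<bar>\<theta>\<bar> * \<bar>\<Psi> b k (coding I f \<omega>') - \<Psi> b k (coding I f \<omega>0)\<bar>"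
      using \<theta> by (intro mult_right_mono) auto
    finally show ?thesis using up by (intro exI[of _ \<omega>'] exI[of _ \<omega>0]) (simp add: abs_mult)
  qed
  then show ?thesis using that K0 by blast
qed

end

section \<open>Nearly maximal functions of the transfer operator\<close>

definition ec :: "real \<Rightarrow> complex" where "ec t = cis (2 * pi * t)"

lemma ec_norm [simp]: "cmod (ec t) = 1" and ec_add: "ec (s + t) = ec s * ec t"
  and ec_0 [simp]: "ec 0 = 1" and ec_cnj: "cnj (ec t) = ec (- t)"
  by (auto simp: ec_def cis_mult cis_cnj algebra_simps)

lemma ec_diff: "ec (s - t) = ec s * cnj (ec t)"
  using ec_add[of s "- t"] by (simp add: ec_cnj)

lemma ec_dist: "cmod (ec s - ec t) = 2 * \<bar>sin (pi * (s - t))\<bar>"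
proof -
  have "(cmod (ec s - ec t))\<^sup>2 = (cos (2 * pi * s) - cos (2 * pi * t))\<^sup>2 + (sin (2 * pi * s) - sin (2 * pi * t))\<^sup>2"
    by (simp add: cmod_power2 ec_def)
  also have "\<dots> = 2 - 2 * (cos (2 * pi * s) * cos (2 * pi * t) + sin (2 * pi * s) * sin (2 * pi * t))"
    using sin_cos_squared_add[of "2 * pi * s"] sin_cos_squared_add[of "2 * pi * t"]
    by (simp add: power2_eq_square algebra_simps)
  also have "\<dots> = 2 - 2 * cos (2 * (pi * (s - t)))"
    by (simp add: cos_diff[symmetric] algebra_simps)
  also have "\<dots> = (2 * \<bar>sin (pi * (s - t))\<bar>)\<^sup>2"
    by (simp only: cos_double_sin) (simp add: power_mult_distrib)
  finally show ?thesis by (rule power2_eq_imp_eq) auto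
qed

lemma ec_lipschitz: "cmod (ec s - ec t) \<le> 2 * pi * \<bar>s - t\<bar>"
  using abs_sin_x_le_abs_x[of "pi * (s - t)"] by (simp add: ec_dist abs_mult)

lemma ec_power: "ec t ^ n = ec (n * t)"
  unfolding ec_def Complex.DeMoivre by (simp add: mult_ac)

lemma ec_power_dist: "cmod (ec (real m * t) - 1) \<le> m * cmod (ec t - 1)"
proof -
  have "norm (ec t ^ m - 1 ^ m) \<le> m * norm (ec t - 1)" by (rule norm_power_diff) auto
  then show ?thesis by (simp add: ec_power)
qed

lemma ec_int: "ec (t + of_int k) = ec t"
proof -
  have "ec (of_int k) = 1" unfolding ec_def by (rule cis_multiple_2pi) simp
  then show ?thesis by (simp add: ec_add)
qed

text \<open>For \<open>x = pi * t\<close> the hypothesis gives |x| \<le> 2, so the cubic Taylor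
  bound leaves |sin x| \<ge> |x| / 3, and \<open>pi > 3\<close> finishes.\<close>

lemma ec_ge: assumes "\<bar>t\<bar> \<le> 1/2" shows "\<bar>t\<bar> \<le> cmod (ec t - 1)"
proof -
  let ?x = "pi * t"
  have "\<bar>sin ?x - (\<Sum>m<3. sin_coeff m * ?x ^ m)\<bar> \<le> inverse (fact 3) * \<bar>?x\<bar> ^ 3"
    by (rule Maclaurin_sin_bound)
  then have 1: "\<bar>sin ?x - ?x\<bar> \<le> \<bar>?x\<bar> ^ 3 / 6"
    by (simp add: eval_nat_numeral sin_coeff_def)
  have "\<bar>?x\<bar> \<le> 2"
    using assms pi_less_4 mult_mono[of pi 4 "\<bar>t\<bar>" "1/2"] by (simp add: abs_mult)
  then have "\<bar>?x\<bar>\<^sup>2 \<le> 2\<^sup>2" by (intro power_mono) auto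
  then have "\<bar>?x\<bar> * \<bar>?x\<bar>\<^sup>2 \<le> \<bar>?x\<bar> * 4" by (intro mult_left_mono) auto
  then have "\<bar>?x\<bar> ^ 3 \<le> 4 * \<bar>?x\<bar>" by (simp add: power3_eq_cube power2_eq_square mult_ac)
  then have "\<bar>?x\<bar> / 3 \<le> \<bar>sin ?x\<bar>" using 1 by linarith
  moreover have "\<bar>?x\<bar> \<ge> 3 * \<bar>t\<bar>" using pi_gt3 by (simp add: abs_mult mult_right_mono)
  ultimately show ?thesis using ec_dist[of t 0] by simp
qed

lemma infdist_int_le_ec: "infdist t \<int> \<le> cmod (ec t - 1)"
proof -
  define k where "k = round t"
  have k: "\<bar>t - of_int k\<bar> \<le> 1/2" using of_int_round_abs_le[of t] by (simp add: k_def abs_minus_commute)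
  have "infdist t \<int> \<le> dist t (of_int k)" by (rule infdist_le) simp
  also have "\<dots> \<le> cmod (ec (t - of_int k) - 1)" using ec_ge[OF k] by (simp add: dist_real_def)
  also have "ec (t - of_int k) = ec t" using ec_int[of t "- k"] by simp
  finally show ?thesis .
qed

lemma norm_add_diff_le: "norm (x + y - z) \<le> norm x + norm y + norm (z :: 'b :: real_normed_vector)"
  using norm_triangle_ineq4[of "x + y" z] norm_triangle_ineq[of x y] by linarith

lemma norm_mult_cnj_diff:
  assumes "cmod x' \<le> 1" "cmod y \<le> 1"
  shows "cmod (x * cnj y - x' * cnj y') \<le> cmod (x - x') + cmod (y - y')"
proof -
  have "x * cnj y - x' * cnj y' = (x - x') * cnj y + x' * cnj (y - y')" by (simp add: algebra_simps)
  then have "cmod (x * cnj y - x' * cnj y') \<le> cmod (x - x') * cmod y + cmod x' * cmod (y - y')"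
    by (metis complex_mod_cnj norm_mult norm_triangle_ineq)
  also have "\<dots> \<le> cmod (x - x') * 1 + 1 * cmod (y - y')"
    using assms by (intro add_mono mult_mono) auto
  finally show ?thesis by simp
qed

section \<open>The metric on words\<close>

lemma word_dist_nonneg: "0 < \<rho> \<Longrightarrow> 0 \<le> word_dist \<rho> \<omega> \<omega>'"
  by (simp add: word_dist_def)

lemma word_dist_refl [simp]: "word_dist \<rho> \<omega> \<omega> = 0"
  by (simp add: word_dist_def)

lemma word_dist_commute: "word_dist \<rho> \<omega> \<omega>' = word_dist \<rho> \<omega>' \<omega>"
proof -
  have "(\<lambda>n. \<omega> n \<noteq> \<omega>' n) = (\<lambda>n. \<omega>' n \<noteq> \<omega> n)" by metis
  then show ?thesis by (auto simp: word_dist_def)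
qed

lemma word_dist_le: "0 < \<rho> \<Longrightarrow> \<rho> < 1 \<Longrightarrow> word_dist \<rho> \<omega> \<omega>' \<le> \<rho>"
  by (simp add: word_dist_def mult_left_le power_le_one)

lemma prepend_eq_iff [simp]: "prepend a \<omega> = prepend b \<omega>' \<longleftrightarrow> a = b \<and> \<omega> = \<omega>'"
  by (metis ext prepend_simps)

lemma word_dist_prepend: "word_dist \<rho> (prepend a \<omega>) (prepend a \<omega>') = \<rho> * word_dist \<rho> \<omega> \<omega>'"
proof (cases "\<omega> = \<omega>'")
  case False
  then obtain n where "\<omega> n \<noteq> \<omega>' n" by auto
  then have "(LEAST n. prepend a \<omega> n \<noteq> prepend a \<omega>' n) = Suc (LEAST n. \<omega> n \<noteq> \<omega>' n)"
    using Least_Suc[of "\<lambda>n. prepend a \<omega> n \<noteq> prepend a \<omega>' n" "Suc n"] by simp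
  then show ?thesis using False by (simp add: word_dist_def)
qed simp

lemma word_dist_prepend_neq: "a \<noteq> b \<Longrightarrow> word_dist \<rho> (prepend a \<omega>) (prepend b \<omega>') = \<rho>"
proof -
  assume "a \<noteq> b"
  then have "(LEAST n. prepend a \<omega> n \<noteq> prepend b \<omega>' n) = 0" by (intro Least_equality) auto
  then show ?thesis using \<open>a \<noteq> b\<close> by (simp add: word_dist_def)
qed

lemma word_dist_foldr:
  "word_dist \<rho> (foldr prepend w \<omega>) (foldr prepend w \<omega>') = \<rho> ^ length w * word_dist \<rho> \<omega> \<omega>'"
  by (induction w) (auto simp: word_dist_prepend)

text \<open>The operator is studied over the space of words with an arbitrary Lipschitz cocycle. The
  geometry of the IFS returns only through the lower bound on phases in
  \<open>sup_norm_decay\<close>.\<close>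

locale phase_cocycle =
  fixes \<rho> Lc :: real and c :: "'a::finite \<Rightarrow> (nat \<Rightarrow> 'a) \<Rightarrow> real" and p :: "'a \<Rightarrow> real"
  assumes rho: "0 < \<rho>" "\<rho> < 1" and Lc: "0 < Lc"
    and c_lip: "\<And>a \<omega> \<omega>'. \<bar>c a \<omega> - c a \<omega>'\<bar> \<le> Lc * word_dist \<rho> \<omega> \<omega>'"
    and p_pos: "\<And>a. 0 < p a" and p_sum: "(\<Sum>a\<in>UNIV. p a) = 1"
begin

abbreviation "d \<equiv> word_dist \<rho>"

definition P :: "real \<Rightarrow> ((nat \<Rightarrow> 'a) \<Rightarrow> complex) \<Rightarrow> (nat \<Rightarrow> 'a) \<Rightarrow> complex" where
  "P \<theta> \<phi> \<omega> = (\<Sum>a\<in>UNIV. p a * ec (\<theta> * c a \<omega>) * \<phi> (prepend a \<omega>))"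

definition bounded_by :: "real \<Rightarrow> ((nat \<Rightarrow> 'a) \<Rightarrow> complex) \<Rightarrow> bool" where
  "bounded_by R \<phi> \<longleftrightarrow> (\<forall>\<omega>. cmod (\<phi> \<omega>) \<le> R)"

definition lip :: "real \<Rightarrow> ((nat \<Rightarrow> 'a) \<Rightarrow> complex) \<Rightarrow> bool" where
  "lip B \<phi> \<longleftrightarrow> (\<forall>\<omega> \<omega>'. cmod (\<phi> \<omega> - \<phi> \<omega>') \<le> B * d \<omega> \<omega>')"

text \<open>The Birkhoff sum of \<open>c\<close> picked up while the letters of \<open>w\<close> are
  prepended, the last letter first. It is the phase of the term for \<open>w\<close> when a power of
  \<open>P\<close> is expanded into a sum over words.\<close>

primrec bc :: "'a list \<Rightarrow> (nat \<Rightarrow> 'a) \<Rightarrow> real" where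
  "bc [] \<omega> = 0"
| "bc (a # w) \<omega> = c a (foldr prepend w \<omega>) + bc w \<omega>"

text \<open>Prepending \<open>w\<close> directly and prepending \<open>b\<close> and then
  \<open>w\<close> give two expressions for the phase of the same function, up to terms that barely
  depend on \<omega>. Their difference is the defect, whose variation times \<theta> must then be
  nearly an integer.\<close>

definition defect :: "'a list \<Rightarrow> 'a \<Rightarrow> (nat \<Rightarrow> 'a) \<Rightarrow> real" where
  "defect w b \<omega> = bc w \<omega> - bc w (prepend b \<omega>) - c b \<omega>"

lemma d_nonneg: "0 \<le> d \<omega> \<omega>'" and d_le: "d \<omega> \<omega>' \<le> \<rho>"
  using word_dist_nonneg[OF rho(1)] word_dist_le[OF rho] by auto

lemma d_le_1: "d \<omega> \<omega>' \<le> 1"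
  using d_le[of \<omega> \<omega>'] rho by linarith

lemma P_bounded: assumes "bounded_by R \<phi>" shows "bounded_by R (P \<theta> \<phi>)"
  unfolding bounded_by_def
proof
  fix \<omega>
  have "cmod (P \<theta> \<phi> \<omega>) \<le> (\<Sum>a\<in>UNIV. p a * R)"
    unfolding P_def using assms p_pos
    by (intro sum_norm_le) (auto simp: norm_mult bounded_by_def less_imp_le)
  also have "\<dots> = R" using p_sum by (simp flip: sum_distrib_right)
  finally show "cmod (P \<theta> \<phi> \<omega>) \<le> R" .
qed

lemma phase_lip: "cmod (ec (\<theta> * c a \<omega>) - ec (\<theta> * c a \<omega>')) \<le> 2 * pi * Lc * \<bar>\<theta>\<bar> * d \<omega> \<omega>'"
proof -
  have "cmod (ec (\<theta> * c a \<omega>) - ec (\<theta> * c a \<omega>')) \<le> 2 * pi * (\<bar>\<theta>\<bar> * \<bar>c a \<omega> - c a \<omega>'\<bar>)"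
    using ec_lipschitz[of "\<theta> * c a \<omega>" "\<theta> * c a \<omega>'"] by (simp flip: right_diff_distrib abs_mult)
  also have "\<dots> \<le> 2 * pi * (\<bar>\<theta>\<bar> * (Lc * d \<omega> \<omega>'))"
    using c_lip by (intro mult_left_mono) auto
  finally show ?thesis by (simp add: mult_ac)
qed

lemma phase_mult_lip:
  assumes "bounded_by R \<phi>" "lip B \<phi>"
  shows "cmod (ec (\<theta> * c a \<omega>) * \<phi> (prepend a \<omega>) - ec (\<theta> * c a \<omega>') * \<phi> (prepend a \<omega>'))
    \<le> (2 * pi * Lc * \<bar>\<theta>\<bar> * R + \<rho> * B) * d \<omega> \<omega>'"
proof -
  let ?e = "ec (\<theta> * c a \<omega>)" and ?e' = "ec (\<theta> * c a \<omega>')"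
  have R: "0 \<le> R" using assms(1) norm_ge_zero order_trans unfolding bounded_by_def by blast
  have "?e * \<phi> (prepend a \<omega>) - ?e' * \<phi> (prepend a \<omega>')
    = (?e - ?e') * \<phi> (prepend a \<omega>) + ?e' * (\<phi> (prepend a \<omega>) - \<phi> (prepend a \<omega>'))" by (simp add: algebra_simps)
  then have "cmod (?e * \<phi> (prepend a \<omega>) - ?e' * \<phi> (prepend a \<omega>'))
    \<le> cmod (?e - ?e') * cmod (\<phi> (prepend a \<omega>)) + cmod (\<phi> (prepend a \<omega>) - \<phi> (prepend a \<omega>'))"
    using norm_triangle_ineq[of "(?e - ?e') * \<phi> (prepend a \<omega>)"
      "?e' * (\<phi> (prepend a \<omega>) - \<phi> (prepend a \<omega>'))"] by (simp add: norm_mult)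
  also have "\<dots> \<le> (2 * pi * Lc * \<bar>\<theta>\<bar> * d \<omega> \<omega>') * R + B * (\<rho> * d \<omega> \<omega>')"
  proof (intro add_mono mult_mono)
    show "cmod (\<phi> (prepend a \<omega>) - \<phi> (prepend a \<omega>')) \<le> B * (\<rho> * d \<omega> \<omega>')"
      using assms(2) word_dist_prepend[of \<rho> a \<omega> \<omega>'] unfolding lip_def by metis
  qed (use phase_lip assms Lc d_nonneg in \<open>auto simp: bounded_by_def intro!: mult_nonneg_nonneg\<close>)
  finally show ?thesis by (simp add: algebra_simps)
qed

lemma P_lip:
  assumes "bounded_by R \<phi>" "lip B \<phi>"
  shows "lip (2 * pi * Lc * \<bar>\<theta>\<bar> * R + \<rho> * B) (P \<theta> \<phi>)"
  unfolding lip_def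
proof (intro allI)
  fix \<omega> \<omega>'
  have "P \<theta> \<phi> \<omega> - P \<theta> \<phi> \<omega>' = (\<Sum>a\<in>UNIV. p a *
    (ec (\<theta> * c a \<omega>) * \<phi> (prepend a \<omega>) - ec (\<theta> * c a \<omega>') * \<phi> (prepend a \<omega>')))"
    by (simp add: P_def sum_subtractf right_diff_distrib mult.assoc)
  also have "cmod \<dots> \<le> (\<Sum>a\<in>UNIV. p a * ((2 * pi * Lc * \<bar>\<theta>\<bar> * R + \<rho> * B) * d \<omega> \<omega>'))"
    using phase_mult_lip[OF assms] p_pos
    by (intro sum_norm_le) (simp add: norm_mult less_imp_le mult_left_mono)
  also have "\<dots> = (2 * pi * Lc * \<bar>\<theta>\<bar> * R + \<rho> * B) * d \<omega> \<omega>'"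
    using p_sum by (simp flip: sum_distrib_right)
  finally show "cmod (P \<theta> \<phi> \<omega> - P \<theta> \<phi> \<omega>') \<le> (2 * pi * Lc * \<bar>\<theta>\<bar> * R + \<rho> * B) * d \<omega> \<omega>'" .
qed

lemma lip_mono: "lip B \<phi> \<Longrightarrow> B \<le> B' \<Longrightarrow> lip B' \<phi>"
  unfolding lip_def using d_nonneg by (meson mult_right_mono order_trans)

lemma P_pow_bounded: "bounded_by R \<phi> \<Longrightarrow> bounded_by R ((P \<theta> ^^ n) \<phi>)"
  by (induction n) (auto intro: P_bounded)

text \<open>One step turns the constant \<open>M * |\<theta>|\<close> into
  \<open>(2 * pi * Lc + \<rho> * M) * |\<theta>|\<close>; the threshold on \<open>M\<close> is where
  this stops being an increase.\<close>

lemma P_pow_lip: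
  assumes "bounded_by 1 \<phi>" "lip (M * \<bar>\<theta>\<bar>) \<phi>" "2 * pi * Lc / (1 - \<rho>) \<le> M"
  shows "lip (M * \<bar>\<theta>\<bar>) ((P \<theta> ^^ n) \<phi>)"
proof (induction n)
  case (Suc n)
  have "2 * pi * Lc * \<bar>\<theta>\<bar> + \<rho> * (M * \<bar>\<theta>\<bar>) = (2 * pi * Lc + \<rho> * M) * \<bar>\<theta>\<bar>" by (simp add: algebra_simps)
  also have "\<dots> \<le> M * \<bar>\<theta>\<bar>" using assms(3) rho by (intro mult_right_mono) (auto simp: field_simps)
  finally show ?case
    using P_lip[OF P_pow_bounded[OF assms(1)] Suc, of \<theta>] by (auto intro: lip_mono)
qed (use assms in auto)

definition pmin :: real where "pmin = Min (range p)"

lemma pmin: "0 < pmin" "pmin \<le> p a" "pmin \<le> 1"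
proof -
  show "0 < pmin" using p_pos by (simp add: pmin_def Min_gr_iff)
  show le: "pmin \<le> p a" for a by (simp add: pmin_def)
  have "p a \<le> 1" for a using member_le_sum[of a UNIV p] p_pos p_sum by (auto intro: less_imp_le)
  then show "pmin \<le> 1" using le order_trans by blast
qed

section \<open>Backward orbits of the operator that start from a nearly maximal value\<close>

context
  fixes \<theta> :: real and g :: "nat \<Rightarrow> (nat \<Rightarrow> 'a) \<Rightarrow> complex" and J :: nat and B :: real
  assumes gP: "\<And>j. j < J \<Longrightarrow> g j = P \<theta> (g (Suc j))"
    and g1: "\<And>j. j \<le> J \<Longrightarrow> bounded_by 1 (g j)"
    and gB: "\<And>j. j \<le> J \<Longrightarrow> lip B (g j)"
    and B: "0 \<le> B"
begin

lemma g_le_1: "j \<le> J \<Longrightarrow> cmod (g j \<omega>) \<le> 1"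
  using g1 by (auto simp: bounded_by_def)

text \<open>A convex combination of numbers of modulus at most 1 can be close to the unit circle only if
  each of them is.\<close>

lemma aligned:
  assumes z: "cmod z = 1" "1 - \<epsilon> \<le> Re (z * g 0 \<omega>0)"
  shows "length w \<le> J \<Longrightarrow>
    1 - \<epsilon> / pmin ^ length w \<le> Re (z * ec (\<theta> * bc w \<omega>0) * g (length w) (foldr prepend w \<omega>0))"
proof (induction w)
  case Nil
  then show ?case using z by simp
next
  case (Cons a w)
  let ?j = "length w" and ?\<omega> = "foldr prepend w \<omega>0"
  define y where "y b = Re (z * ec (\<theta> * bc w \<omega>0) * (ec (\<theta> * c b ?\<omega>) * g (Suc ?j) (prepend b ?\<omega>)))" for b
  have y1: "y b \<le> 1" for b
  proof -
    have "y b \<le> cmod (z * ec (\<theta> * bc w \<omega>0) * (ec (\<theta> * c b ?\<omega>) * g (Suc ?j) (prepend b ?\<omega>)))"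
      unfolding y_def by (rule complex_Re_le_cmod)
    also have "\<dots> \<le> 1" using z g_le_1[of "Suc ?j"] Cons.prems by (simp add: norm_mult)
    finally show ?thesis .
  qed
  have "g ?j ?\<omega> = (\<Sum>b\<in>UNIV. p b * ec (\<theta> * c b ?\<omega>) * g (Suc ?j) (prepend b ?\<omega>))"
    using gP[of ?j] Cons.prems by (simp add: P_def)
  then have "z * ec (\<theta> * bc w \<omega>0) * g ?j ?\<omega> =
    (\<Sum>b\<in>UNIV. p b * (z * ec (\<theta> * bc w \<omega>0) * (ec (\<theta> * c b ?\<omega>) * g (Suc ?j) (prepend b ?\<omega>))))"
    by (simp add: sum_distrib_left mult_ac)
  then have "Re (z * ec (\<theta> * bc w \<omega>0) * g ?j ?\<omega>) = (\<Sum>b\<in>UNIV. p b * y b)"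
    by (simp add: y_def)
  then have "1 - \<epsilon> / pmin ^ ?j \<le> (\<Sum>b\<in>UNIV. p b * y b)" using Cons by simp
  then have "(\<Sum>b\<in>UNIV. p b * (1 - y b)) \<le> \<epsilon> / pmin ^ ?j"
    using p_sum by (simp add: right_diff_distrib sum_subtractf)
  \<comment> \<open>All summands are nonnegative, so a single letter carries at most the whole
    deficit; dividing by its weight is the loss of one factor \<open>pmin\<close> per
    letter.\<close>
  moreover have "p a * (1 - y a) \<le> (\<Sum>b\<in>UNIV. p b * (1 - y b))"
    using p_pos y1 by (intro member_le_sum) (simp_all add: less_imp_le)
  moreover have "pmin * (1 - y a) \<le> p a * (1 - y a)"
    using pmin(2) y1[of a] by (intro mult_right_mono) auto
  ultimately have "pmin * (1 - y a) \<le> \<epsilon> / pmin ^ ?j" by linarith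
  then have "1 - y a \<le> \<epsilon> / pmin ^ ?j / pmin"
    using pos_le_divide_eq[OF pmin(1)] by (simp only: mult.commute)
  then show ?case by (simp add: y_def ec_add distrib_left mult_ac)
qed

lemma norm_one_minus_le: "cmod y \<le> 1 \<Longrightarrow> 1 - \<delta> \<le> Re y \<Longrightarrow> cmod (1 - y) \<le> sqrt (2 * \<delta>)"
proof (rule real_le_rsqrt)
  assume y: "cmod y \<le> 1" "1 - \<delta> \<le> Re y"
  have "(cmod (1 - y))\<^sup>2 = 1 - 2 * Re y + (cmod y)\<^sup>2"
    unfolding cmod_power2 by (simp add: power2_eq_square algebra_simps)
  also have "\<dots> \<le> 2 * \<delta>" using y power_le_one[of "cmod y" 2] by simp
  finally show "(cmod (1 - y))\<^sup>2 \<le> 2 * \<delta>" .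
qed

context
  fixes \<epsilon> :: real and \<omega>0 :: "nat \<Rightarrow> 'a" and k :: nat
  assumes eps: "0 \<le> \<epsilon>" "1 - \<epsilon> \<le> cmod (g 0 \<omega>0)"
begin

text \<open>The error in the approximate eigenfunction equation. Two alignment errors enter, with a
  square root because the real part controls the squared distance to 1; the rest is the cost of
  moving by \<open>\<rho> ^ k\<close> in functions with Lipschitz constants \<open>B\<close> and
  \<open>B + 2 * pi * Lc * |\<theta>|\<close>.\<close>

definition \<eta> :: real where "\<eta> = 2 * sqrt (2 * \<epsilon> / pmin ^ J) + (2 * B + 2 * pi * Lc * \<bar>\<theta>\<bar>) * \<rho> ^ k"

lemma unit_phase: obtains z where "cmod z = 1" "1 - \<epsilon> \<le> Re (z * g 0 \<omega>0)"
proof (cases "g 0 \<omega>0 = 0")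
  case True
  then show ?thesis using that[of 1] eps by simp
next
  case False
  let ?y = "g 0 \<omega>0"
  have "cnj (sgn ?y) * ?y = of_real (cmod ?y)"
    using False complex_norm_square[of ?y]
    by (simp add: sgn_eq mult.commute power2_eq_square nonzero_divide_eq_eq)
  then have "Re (cnj (sgn ?y) * ?y) = cmod ?y" by simp
  then show ?thesis using that[of "cnj (sgn ?y)"] eps False by (simp add: norm_sgn)
qed

lemma aligned_dist:
  obtains z where "cmod z = 1" "\<And>w. length w \<le> J \<Longrightarrow>
    cmod (1 - z * ec (\<theta> * bc w \<omega>0) * g (length w) (foldr prepend w \<omega>0)) \<le> sqrt (2 * \<epsilon> / pmin ^ J)"
proof -
  obtain z where z: "cmod z = 1" "1 - \<epsilon> \<le> Re (z * g 0 \<omega>0)" by (rule unit_phase)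
  have "cmod (1 - z * ec (\<theta> * bc w \<omega>0) * g (length w) (foldr prepend w \<omega>0)) \<le> sqrt (2 * \<epsilon> / pmin ^ J)"
    if w: "length w \<le> J" for w
  proof -
    have "cmod (1 - z * ec (\<theta> * bc w \<omega>0) * g (length w) (foldr prepend w \<omega>0)) \<le> sqrt (2 * (\<epsilon> / pmin ^ length w))"
      using z g_le_1[OF w] by (intro norm_one_minus_le aligned w) (auto simp: norm_mult)
    also have "\<dots> \<le> sqrt (2 * \<epsilon> / pmin ^ J)"
      using eps pmin w by (simp add: divide_left_mono power_decreasing)
    finally show ?thesis .
  qed
  then show ?thesis using z that by blast
qed

text \<open>The preimage of \<open>\<omega>0\<close> that copies the first \<open>j\<close> letters
  of \<omega> is within \<open>\<rho> ^ j\<close> of it; this is the quantitative density of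
  preimages.\<close>

lemma approx_point:
  assumes "k \<le> j"
  shows "d (foldr prepend (map \<omega> [0..<j]) \<omega>0) \<omega> \<le> \<rho> ^ k"
proof -
  have "d (foldr prepend (map \<omega> [0..<j]) \<omega>0) (foldr prepend (map \<omega> [0..<j]) (\<lambda>n. \<omega> (n + j))) \<le> \<rho> ^ j * 1"
    unfolding word_dist_foldr using d_le_1 rho by (simp add: mult_left_le)
  also have "\<dots> \<le> \<rho> ^ k" using assms rho by (simp add: power_decreasing)
  finally show ?thesis unfolding foldr_prepend_take .
qed

text \<open>At the preimage \<omega>1 alignment holds for the words \<open>w\<close> and
  \<open>a # w\<close> with the same rotation \<zeta>, so both sides of the equation, multiplied by
  \<zeta>, are close to 1 and hence to each other. The Lipschitz bounds carry this over to
  \<omega>.\<close>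

lemma approx_eigen_step:
  assumes j: "k \<le> j" "j < J"
  shows "cmod (ec (\<theta> * c a \<omega>) * g (Suc j) (prepend a \<omega>) - g j \<omega>) \<le> \<eta>"
proof -
  obtain z where z: "cmod z = 1" "\<And>w. length w \<le> J \<Longrightarrow>
    cmod (1 - z * ec (\<theta> * bc w \<omega>0) * g (length w) (foldr prepend w \<omega>0)) \<le> sqrt (2 * \<epsilon> / pmin ^ J)"
    using aligned_dist by blast
  define w where "w = map \<omega> [0..<j]"
  have w: "length w = j" by (simp add: w_def)
  define \<omega>1 where "\<omega>1 = foldr prepend w \<omega>0"
  define \<zeta> where "\<zeta> = z * ec (\<theta> * bc w \<omega>0)"
  define A where "A x = ec (\<theta> * c a x) * g (Suc j) (prepend a x)" for x
  have \<zeta>: "cmod \<zeta> = 1" using z by (simp add: \<zeta>_def norm_mult)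
  have d1: "d \<omega> \<omega>1 \<le> \<rho> ^ k"
    using approx_point[OF j(1), of \<omega>] unfolding \<omega>1_def w_def by (subst word_dist_commute)
  have "cmod (1 - \<zeta> * A \<omega>1) \<le> sqrt (2 * \<epsilon> / pmin ^ J)"
    using z(2)[of "a # w"] j w by (simp add: \<zeta>_def A_def \<omega>1_def ec_add distrib_left mult_ac)
  moreover have "cmod (1 - \<zeta> * g j \<omega>1) \<le> sqrt (2 * \<epsilon> / pmin ^ J)"
    using z(2)[of w] j w by (simp add: \<zeta>_def \<omega>1_def)
  moreover have "cmod (A \<omega>1 - g j \<omega>1) = cmod ((1 - \<zeta> * g j \<omega>1) - (1 - \<zeta> * A \<omega>1))"
    using \<zeta> by (simp add: norm_mult flip: right_diff_distrib)
  ultimately have 1: "cmod (A \<omega>1 - g j \<omega>1) \<le> 2 * sqrt (2 * \<epsilon> / pmin ^ J)"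
    using norm_triangle_ineq4[of "1 - \<zeta> * g j \<omega>1" "1 - \<zeta> * A \<omega>1"] by linarith
  have "cmod (A \<omega> - A \<omega>1) \<le> (2 * pi * Lc * \<bar>\<theta>\<bar> * 1 + \<rho> * B) * d \<omega> \<omega>1"
    unfolding A_def using g1 gB j by (intro phase_mult_lip) auto
  also have "\<dots> \<le> (2 * pi * Lc * \<bar>\<theta>\<bar> + B) * \<rho> ^ k"
    using d1 d_nonneg Lc B rho mult_left_le_one_le[of B \<rho>] by (intro mult_mono) auto
  finally have 2: "cmod (A \<omega> - A \<omega>1) \<le> (2 * pi * Lc * \<bar>\<theta>\<bar> + B) * \<rho> ^ k" .
  have "cmod (g j \<omega> - g j \<omega>1) \<le> B * d \<omega> \<omega>1" using gB[of j] j by (auto simp: lip_def)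
  also have "\<dots> \<le> B * \<rho> ^ k" using d1 B by (intro mult_left_mono)
  finally have 3: "cmod (g j \<omega> - g j \<omega>1) \<le> B * \<rho> ^ k" .
  have "A \<omega> - g j \<omega> = (A \<omega> - A \<omega>1) + (A \<omega>1 - g j \<omega>1) - (g j \<omega> - g j \<omega>1)" by simp
  then have "cmod (A \<omega> - g j \<omega>) \<le> cmod (A \<omega> - A \<omega>1) + cmod (A \<omega>1 - g j \<omega>1) + cmod (g j \<omega> - g j \<omega>1)"
    by (simp only: norm_add_diff_le)
  then show ?thesis using 1 2 3 by (simp add: A_def \<eta>_def algebra_simps)
qed

text \<open>Alignment forces modulus near 1 at a preimage close to \<omega>. This is what later
  allows \<open>g j \<omega> * cnj (g j \<omega>)\<close> to be replaced by 1.\<close>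

lemma modulus_lower:
  assumes j: "k \<le> j" "j \<le> J"
  shows "1 - \<eta> \<le> cmod (g j \<omega>)"
proof -
  obtain z where z: "cmod z = 1" "\<And>w. length w \<le> J \<Longrightarrow>
    cmod (1 - z * ec (\<theta> * bc w \<omega>0) * g (length w) (foldr prepend w \<omega>0)) \<le> sqrt (2 * \<epsilon> / pmin ^ J)"
    using aligned_dist by blast
  define w where "w = map \<omega> [0..<j]"
  define \<omega>1 where "\<omega>1 = foldr prepend w \<omega>0"
  have "cmod (1 - z * ec (\<theta> * bc w \<omega>0) * g j \<omega>1) \<le> sqrt (2 * \<epsilon> / pmin ^ J)"
    using z(2)[of w] j by (simp add: w_def \<omega>1_def)
  moreover have "cmod (z * ec (\<theta> * bc w \<omega>0) * g j \<omega>1) = cmod (g j \<omega>1)" using z by (simp add: norm_mult)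
  ultimately have 1: "1 - cmod (g j \<omega>1) \<le> sqrt (2 * \<epsilon> / pmin ^ J)"
    using norm_triangle_ineq2[of 1 "z * ec (\<theta> * bc w \<omega>0) * g j \<omega>1"] by simp
  have "cmod (g j \<omega>1 - g j \<omega>) \<le> B * d \<omega>1 \<omega>" using gB[of j] j by (auto simp: lip_def)
  also have "\<dots> \<le> B * \<rho> ^ k"
    using approx_point[OF j(1), of \<omega>] B unfolding \<omega>1_def w_def by (intro mult_left_mono)
  finally have "cmod (g j \<omega>1) - cmod (g j \<omega>) \<le> B * \<rho> ^ k"
    using norm_triangle_ineq2[of "g j \<omega>1" "g j \<omega>"] by linarith
  moreover have "0 \<le> sqrt (2 * \<epsilon> / pmin ^ J)" "0 \<le> B * \<rho> ^ k" "0 \<le> 2 * pi * Lc * \<bar>\<theta>\<bar> * \<rho> ^ k"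
    using eps pmin B rho Lc by auto
  moreover have "\<eta> = 2 * sqrt (2 * \<epsilon> / pmin ^ J) + 2 * (B * \<rho> ^ k) + 2 * pi * Lc * \<bar>\<theta>\<bar> * \<rho> ^ k"
    by (simp add: \<eta>_def algebra_simps)
  ultimately show ?thesis using 1 by linarith
qed

lemma approx_eigen:
  assumes "k \<le> j"
  shows "j + length w \<le> J \<Longrightarrow>
    cmod (g j \<omega> - ec (\<theta> * bc w \<omega>) * g (j + length w) (foldr prepend w \<omega>)) \<le> length w * \<eta>"
proof (induction w)
  case (Cons a w)
  let ?j = "j + length w" and ?x = "foldr prepend w \<omega>"
  have 1: "cmod (ec (\<theta> * bc w \<omega>) * (g ?j ?x - ec (\<theta> * c a ?x) * g (Suc ?j) (prepend a ?x))) \<le> \<eta>"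
    using approx_eigen_step[of ?j a ?x] Cons.prems assms by (simp add: norm_mult norm_minus_commute)
  have "g j \<omega> - ec (\<theta> * bc (a # w) \<omega>) * g (Suc ?j) (prepend a ?x)
    = (g j \<omega> - ec (\<theta> * bc w \<omega>) * g ?j ?x)
      + ec (\<theta> * bc w \<omega>) * (g ?j ?x - ec (\<theta> * c a ?x) * g (Suc ?j) (prepend a ?x))"
    by (simp add: ec_add algebra_simps)
  then have "cmod (g j \<omega> - ec (\<theta> * bc (a # w) \<omega>) * g (Suc ?j) (prepend a ?x)) \<le>
    cmod (g j \<omega> - ec (\<theta> * bc w \<omega>) * g ?j ?x)
      + cmod (ec (\<theta> * bc w \<omega>) * (g ?j ?x - ec (\<theta> * c a ?x) * g (Suc ?j) (prepend a ?x)))"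
    by (simp only: norm_triangle_ineq)
  also have "\<dots> \<le> length w * \<eta> + \<eta>" using 1 Cons by (intro add_mono) auto
  finally show ?case by (simp add: algebra_simps)
qed simp

lemma modulus_square:
  assumes "k \<le> j" "j \<le> J"
  shows "cmod (g j \<omega> * cnj (g j \<omega>) - 1) \<le> 2 * \<eta>"
proof -
  let ?m = "cmod (g j \<omega>)"
  have m: "0 \<le> ?m" "?m \<le> 1" "1 - ?m \<le> \<eta>"
    using g_le_1[OF assms(2)] modulus_lower[OF assms, of \<omega>] by auto
  have "g j \<omega> * cnj (g j \<omega>) - 1 = of_real (?m\<^sup>2 - 1)"
    using complex_norm_square[of "g j \<omega>"] by simp
  then have "cmod (g j \<omega> * cnj (g j \<omega>) - 1) = \<bar>?m\<^sup>2 - 1\<bar>" by (simp only: norm_of_real)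
  also have "\<dots> = (1 - ?m) * (1 + ?m)"
    using power_le_one[OF m(1,2), of 2] by (simp add: abs_if power2_eq_square algebra_simps)
  also have "\<dots> \<le> \<eta> * 2" using m by (intro mult_mono) auto
  finally show ?thesis by simp
qed

lemma lip_foldr:
  assumes "j \<le> J" "length w = k"
  shows "cmod (g j (foldr prepend w \<omega>) - g j (foldr prepend w \<omega>')) \<le> B * \<rho> ^ k"
proof -
  have "cmod (g j (foldr prepend w \<omega>) - g j (foldr prepend w \<omega>'))
    \<le> B * (\<rho> ^ k * d \<omega> \<omega>')"
    using gB[OF assms(1)] unfolding lip_def by (metis word_dist_foldr assms(2))
  also have "\<dots> \<le> B * (\<rho> ^ k * 1)" using B rho d_le_1 by (intro mult_left_mono) auto
  finally show ?thesis by simp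
qed

text \<open>The product \<open>Q = g k * cnj (g (k + 1))\<close> is almost constant: when both
  factors are pushed along the same word of length \<open>k\<close> the phases cancel, and functions
  evaluated behind a prefix of length \<open>k\<close> hardly vary. At the word constantly equal to
  \<open>a\<close>, one step of the equation identifies \<open>Q\<close> with the phase of
  \<open>c a\<close>. Hence all these phases nearly agree.\<close>

lemma periodic_phases:
  assumes J: "2 * k + 1 \<le> J"
  shows "cmod (ec (\<theta> * (c a (\<lambda>_. a) - c b (\<lambda>_. b))) - 1) \<le> (4 * k + 6) * \<eta> + 2 * B * \<rho> ^ k"
proof -
  define Q where "Q \<omega> = g k \<omega> * cnj (g (Suc k) \<omega>)" for \<omega>
  define R where "R \<omega> = g (k + k) \<omega> * cnj (g (Suc k + k) \<omega>)" for \<omega>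
  obtain w :: "'a list" where w: "length w = k" using Ex_list_of_length by blast
  have QR: "cmod (Q \<omega> - R (foldr prepend w \<omega>)) \<le> 2 * k * \<eta>" for \<omega>
  proof -
    let ?e = "ec (\<theta> * bc w \<omega>)" and ?x = "foldr prepend w \<omega>"
    have "cmod (Q \<omega> - (?e * g (k + k) ?x) * cnj (?e * g (Suc k + k) ?x))
      \<le> cmod (g k \<omega> - ?e * g (k + k) ?x) + cmod (g (Suc k) \<omega> - ?e * g (Suc k + k) ?x)"
      unfolding Q_def using J g_le_1 by (intro norm_mult_cnj_diff) (auto simp: norm_mult)
    also have "\<dots> \<le> k * \<eta> + k * \<eta>"
      using approx_eigen[of k w \<omega>] approx_eigen[of "Suc k" w \<omega>] J by (intro add_mono) (auto simp: w)
    also have "(?e * g (k + k) ?x) * cnj (?e * g (Suc k + k) ?x) = (?e * cnj ?e) * R ?x"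
      by (simp add: R_def)
    also have "?e * cnj ?e = 1" by (simp add: ec_cnj flip: ec_add)
    finally show ?thesis by simp
  qed
  have RR: "cmod (R (foldr prepend w \<omega>) - R (foldr prepend w \<omega>')) \<le> 2 * B * \<rho> ^ k" for \<omega> \<omega>'
  proof -
    have "cmod (R (foldr prepend w \<omega>) - R (foldr prepend w \<omega>')) \<le> B * \<rho> ^ k + B * \<rho> ^ k"
      unfolding R_def using J g_le_1 w
      by (intro order_trans[OF norm_mult_cnj_diff] add_mono lip_foldr) auto
    then show ?thesis by simp
  qed
  have QQ: "cmod (Q \<omega> - Q \<omega>') \<le> 4 * k * \<eta> + 2 * B * \<rho> ^ k" for \<omega> \<omega>'
  proof -
    have "Q \<omega> - Q \<omega>' = (Q \<omega> - R (foldr prepend w \<omega>)) + (R (foldr prepend w \<omega>) - R (foldr prepend w \<omega>'))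
      - (Q \<omega>' - R (foldr prepend w \<omega>'))" by simp
    then have "cmod (Q \<omega> - Q \<omega>') \<le> cmod (Q \<omega> - R (foldr prepend w \<omega>))
      + cmod (R (foldr prepend w \<omega>) - R (foldr prepend w \<omega>')) + cmod (Q \<omega>' - R (foldr prepend w \<omega>'))"
      by (simp only: norm_add_diff_le)
    then show ?thesis using QR[of \<omega>] QR[of \<omega>'] RR[of \<omega> \<omega>'] by linarith
  qed
  have Qc: "cmod (Q (\<lambda>_. a) - ec (\<theta> * c a (\<lambda>_. a))) \<le> 3 * \<eta>" for a
  proof -
    let ?x = "\<lambda>_::nat. a" and ?e = "ec (\<theta> * c a (\<lambda>_. a))"
    have "cmod (Q ?x - (?e * g (Suc k) ?x) * cnj (g (Suc k) ?x))
      \<le> cmod (g k ?x - ?e * g (Suc k) ?x) + cmod (g (Suc k) ?x - g (Suc k) ?x)"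
      unfolding Q_def using J g_le_1 by (intro norm_mult_cnj_diff) (auto simp: norm_mult)
    also have "\<dots> \<le> \<eta>"
      using approx_eigen_step[of k a ?x] J by (simp add: prepend_const norm_minus_commute)
    finally have 1: "cmod (Q ?x - (?e * g (Suc k) ?x) * cnj (g (Suc k) ?x)) \<le> \<eta>" .
    have "cmod (?e * (g (Suc k) ?x * cnj (g (Suc k) ?x) - 1)) \<le> 2 * \<eta>"
      using modulus_square[of "Suc k" ?x] J by (simp add: norm_mult)
    moreover have "Q ?x - ?e = (Q ?x - (?e * g (Suc k) ?x) * cnj (g (Suc k) ?x))
      + ?e * (g (Suc k) ?x * cnj (g (Suc k) ?x) - 1)" by (simp add: algebra_simps)
    then have "cmod (Q ?x - ?e) \<le> cmod (Q ?x - (?e * g (Suc k) ?x) * cnj (g (Suc k) ?x))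
      + cmod (?e * (g (Suc k) ?x * cnj (g (Suc k) ?x) - 1))" by (simp only: norm_triangle_ineq)
    ultimately show ?thesis using 1 by linarith
  qed
  let ?ea = "ec (\<theta> * c a (\<lambda>_. a))" and ?eb = "ec (\<theta> * c b (\<lambda>_. b))"
  have "ec (\<theta> * (c a (\<lambda>_. a) - c b (\<lambda>_. b))) - 1 = (?ea - ?eb) * cnj ?eb"
    by (simp add: right_diff_distrib left_diff_distrib ec_diff) (simp add: ec_cnj flip: ec_add)
  then have "cmod (ec (\<theta> * (c a (\<lambda>_. a) - c b (\<lambda>_. b))) - 1) = cmod (?ea - ?eb)"
    by (simp add: norm_mult)
  also have "?ea - ?eb = (Q (\<lambda>_. a) - Q (\<lambda>_. b)) + (Q (\<lambda>_. b) - ?eb) - (Q (\<lambda>_. a) - ?ea)" by simp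
  also have "cmod \<dots> \<le> cmod (Q (\<lambda>_. a) - Q (\<lambda>_. b)) + cmod (Q (\<lambda>_. b) - ?eb) + cmod (Q (\<lambda>_. a) - ?ea)"
    by (simp only: norm_add_diff_le)
  also have "\<dots> \<le> (4 * k * \<eta> + 2 * B * \<rho> ^ k) + 3 * \<eta> + 3 * \<eta>"
    by (intro add_mono QQ Qc)
  finally show ?thesis by (simp add: algebra_simps)
qed

text \<open>Pushing \<omega> and \<omega>' along the same \<open>w\<close> shows that
  \<open>g j x * cnj (g j y)\<close> is close to the phase \<open>bc w x - bc w y\<close>, because
  the values behind the common prefix nearly coincide and have modulus near 1. This is applied to
  the pair at level \<open>k\<close> and to the pair with \<open>b\<close> prepended at level
  \<open>k + 1\<close>; one step of the equation links the two.\<close>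

lemma cocycle_phases:
  assumes J: "2 * k + 1 \<le> J" and w: "length w = k"
  shows "cmod (ec (\<theta> * (defect w b \<omega> - defect w b \<omega>')) - 1)
    \<le> (4 * k + 6) * \<eta> + 2 * B * \<rho> ^ k"
proof -
  define T where "T j x y = g j x * cnj (g j y)" for j x y
  have T: "cmod (T j x y - ec (\<theta> * (bc w x - bc w y))) \<le> 2 * k * \<eta> + B * \<rho> ^ k + 2 * \<eta>"
    if j: "k \<le> j" "j + k \<le> J" for j x y
  proof -
    let ?ex = "ec (\<theta> * bc w x)" and ?ey = "ec (\<theta> * bc w y)"
    let ?gx = "g (j + k) (foldr prepend w x)" and ?gy = "g (j + k) (foldr prepend w y)"
    have e: "ec (\<theta> * (bc w x - bc w y)) = ?ex * cnj ?ey" by (simp add: right_diff_distrib ec_diff)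
    have "cmod (T j x y - (?ex * ?gx) * cnj (?ey * ?gy)) \<le> cmod (g j x - ?ex * ?gx) + cmod (g j y - ?ey * ?gy)"
      unfolding T_def using j g_le_1 by (intro norm_mult_cnj_diff) (auto simp: norm_mult)
    also have "\<dots> \<le> k * \<eta> + k * \<eta>"
      using approx_eigen[OF j(1), of w x] approx_eigen[OF j(1), of w y] j w by (intro add_mono) auto
    finally have 1: "cmod (T j x y - (?ex * ?gx) * cnj (?ey * ?gy)) \<le> 2 * k * \<eta>" by simp
    have "cmod (?gx * cnj ?gy - ?gx * cnj ?gx) \<le> cmod (?gx - ?gx) + cmod (?gy - ?gx)"
      using j g_le_1 by (intro norm_mult_cnj_diff) auto
    also have "\<dots> \<le> B * \<rho> ^ k" using lip_foldr[of "j + k" w y x] j w by simp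
    finally have 2: "cmod (?gx * cnj ?gy - ?gx * cnj ?gx) \<le> B * \<rho> ^ k" .
    have 3: "cmod (?gx * cnj ?gx - 1) \<le> 2 * \<eta>" using modulus_square[of "j + k"] j by simp
    have "cmod (?gx * cnj ?gy - 1) \<le> B * \<rho> ^ k + 2 * \<eta>"
      using norm_triangle_ineq[of "?gx * cnj ?gy - ?gx * cnj ?gx" "?gx * cnj ?gx - 1"] 2 3 by simp
    then have 4: "cmod (?ex * cnj ?ey * (?gx * cnj ?gy - 1)) \<le> B * \<rho> ^ k + 2 * \<eta>"
      by (simp add: norm_mult)
    have "T j x y - ?ex * cnj ?ey = (T j x y - (?ex * ?gx) * cnj (?ey * ?gy)) + ?ex * cnj ?ey * (?gx * cnj ?gy - 1)"
      by (simp add: algebra_simps)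
    then have "cmod (T j x y - ?ex * cnj ?ey) \<le> cmod (T j x y - (?ex * ?gx) * cnj (?ey * ?gy)) + cmod (?ex * cnj ?ey * (?gx * cnj ?gy - 1))"
      by (simp only: norm_triangle_ineq)
    then show ?thesis unfolding e using 1 4 by linarith
  qed
  let ?bx = "prepend b \<omega>" and ?by = "prepend b \<omega>'"
  define E1 where "E1 = ec (\<theta> * (bc w \<omega> - bc w \<omega>'))"
  define E2 where "E2 = ec (\<theta> * (c b \<omega> - c b \<omega>'))"
  define E3 where "E3 = ec (\<theta> * (bc w ?bx - bc w ?by))"
  have S: "cmod (T k \<omega> \<omega>' - E2 * T (Suc k) ?bx ?by) \<le> 2 * \<eta>"
  proof -
    let ?ex = "ec (\<theta> * c b \<omega>)" and ?ey = "ec (\<theta> * c b \<omega>')"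
    have "cmod (T k \<omega> \<omega>' - (?ex * g (Suc k) ?bx) * cnj (?ey * g (Suc k) ?by))
      \<le> cmod (g k \<omega> - ?ex * g (Suc k) ?bx) + cmod (g k \<omega>' - ?ey * g (Suc k) ?by)"
      unfolding T_def using J g_le_1 by (intro norm_mult_cnj_diff) (auto simp: norm_mult)
    also have "\<dots> \<le> \<eta> + \<eta>"
      using approx_eigen_step[of k b \<omega>] approx_eigen_step[of k b \<omega>'] J
      by (intro add_mono) (auto simp: norm_minus_commute)
    also have "(?ex * g (Suc k) ?bx) * cnj (?ey * g (Suc k) ?by) = E2 * T (Suc k) ?bx ?by"
      by (simp add: E2_def T_def right_diff_distrib ec_diff)
    finally show ?thesis by simp
  qed
  have T1: "cmod (T k \<omega> \<omega>' - E1) \<le> 2 * k * \<eta> + B * \<rho> ^ k + 2 * \<eta>"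
    unfolding E1_def using J by (intro T) auto
  have "cmod (T (Suc k) ?bx ?by - E3) \<le> 2 * k * \<eta> + B * \<rho> ^ k + 2 * \<eta>"
    unfolding E3_def using J by (intro T) auto
  then have T2: "cmod (E2 * (T (Suc k) ?bx ?by - E3)) \<le> 2 * k * \<eta> + B * \<rho> ^ k + 2 * \<eta>"
    by (simp add: norm_mult E2_def)
  have "E1 - E2 * E3 = (T k \<omega> \<omega>' - E2 * T (Suc k) ?bx ?by) + E2 * (T (Suc k) ?bx ?by - E3) - (T k \<omega> \<omega>' - E1)"
    by (simp add: algebra_simps)
  then have "cmod (E1 - E2 * E3) \<le> cmod (T k \<omega> \<omega>' - E2 * T (Suc k) ?bx ?by)
    + cmod (E2 * (T (Suc k) ?bx ?by - E3)) + cmod (T k \<omega> \<omega>' - E1)"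
    by (simp only: norm_add_diff_le)
  also have "\<dots> \<le> (4 * k + 6) * \<eta> + 2 * B * \<rho> ^ k" using S T1 T2 by (simp add: algebra_simps)
  finally have E: "cmod (E1 - E2 * E3) \<le> (4 * k + 6) * \<eta> + 2 * B * \<rho> ^ k" .
  let ?D = "defect w b \<omega> - defect w b \<omega>'"
  have "E1 = ec (\<theta> * ?D) * (E2 * E3)"
    unfolding E1_def E2_def E3_def defect_def ec_add[symmetric] by (simp add: algebra_simps)
  then have "E1 - E2 * E3 = (ec (\<theta> * ?D) - 1) * (E2 * E3)" by (simp add: algebra_simps)
  then have "cmod (E1 - E2 * E3) = cmod (ec (\<theta> * ?D) - 1)"
    by (simp add: norm_mult E2_def E3_def)
  then show ?thesis using E by simp
qed

end
end
end

text \<open>Serves to choose \<tau>. The comparison is made at the fixed positive value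
  \<open>L = ln \<theta>0\<close>, so that the resulting bound holds for all |\<theta>| > \<theta>0
  and not merely for large |\<theta>|.\<close>

lemma exponential_beats_linear:
  fixes \<sigma> L C D K :: real
  assumes "0 < \<sigma>" "0 < L" "0 < K"
  shows "\<exists>\<tau>\<ge>\<tau>0. 0 < \<tau> \<and> 0 < \<sigma> * \<tau> - D \<and> (10 + 4 * \<tau>) * C < K * exp ((\<sigma> * \<tau> - D) * L)"
proof -
  have "((\<lambda>\<tau>. (10 + 4 * \<tau>) * C * exp (- ((\<sigma> * \<tau> - D) * L))) \<longlongrightarrow> 0) at_top"
    using assms by real_asymp
  then have 1: "\<forall>\<^sub>F \<tau> in at_top. (10 + 4 * \<tau>) * C * exp (- ((\<sigma> * \<tau> - D) * L)) < K"
    using assms(3) by (rule order_tendstoD)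
  have 2: "\<forall>\<^sub>F \<tau> in at_top. max \<tau>0 (max 1 (\<bar>D\<bar> / \<sigma> + 1)) \<le> \<tau>" by (rule eventually_ge_at_top)
  from 1 2 have "\<forall>\<^sub>F \<tau> in at_top. \<tau>0 \<le> \<tau> \<and> 0 < \<tau> \<and> 0 < \<sigma> * \<tau> - D \<and> (10 + 4 * \<tau>) * C < K * exp ((\<sigma> * \<tau> - D) * L)"
  proof eventually_elim
    case (elim \<tau>)
    have "\<sigma> * (\<bar>D\<bar> / \<sigma> + 1) \<le> \<sigma> * \<tau>" using elim assms by (intro mult_left_mono) auto
    then have "\<bar>D\<bar> + \<sigma> \<le> \<sigma> * \<tau>" using assms by (simp add: distrib_left)
    then have "0 < \<sigma> * \<tau> - D" using assms(1) by linarith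
    moreover have "0 < \<tau>" "\<tau>0 \<le> \<tau>" using elim(2) by linarith+
    moreover have "(10 + 4 * \<tau>) * C < K * exp ((\<sigma> * \<tau> - D) * L)"
    proof -
      have "(10 + 4 * \<tau>) * C = (10 + 4 * \<tau>) * C * exp (- ((\<sigma> * \<tau> - D) * L)) * exp ((\<sigma> * \<tau> - D) * L)"
        by (simp add: mult.assoc flip: exp_add)
      also have "\<dots> < K * exp ((\<sigma> * \<tau> - D) * L)" using elim(1) by (intro mult_strict_right_mono) auto
      finally show ?thesis .
    qed
    ultimately show ?case by blast
  qed
  then show ?thesis unfolding eventually_at_top_linorder by blast
qed

context phase_cocycle
begin

text \<open>If a value of the \<open>n\<close>-th iterate exceeded the claimed bound, both kinds of
  phases would fall below the gap for \<open>k\<close> about \<tau> log |\<theta>|. Only the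
  outermost \<open>J\<close> applications of \<open>P\<close> are examined, so the bound holds for
  every larger \<open>n\<close> as well.\<close>

lemma sup_norm_decay:
  fixes M K0 l \<theta>0 :: real and k0 :: nat
  assumes "1 < \<theta>0" "0 < K0" and M: "2 * pi * Lc / (1 - \<rho>) \<le> M"
    and gap: "\<And>\<theta> k. \<theta>0 < \<bar>\<theta>\<bar> \<Longrightarrow> k0 \<le> k \<Longrightarrow>
      (\<exists>a b. K0 * \<bar>\<theta>\<bar> powr - l \<le> cmod (ec (\<theta> * (c a (\<lambda>_. a) - c b (\<lambda>_. b))) - 1)) \<or>
      (\<exists>w b \<omega> \<omega>'. length w = k \<and> K0 * \<bar>\<theta>\<bar> powr - l \<le> cmod (ec (\<theta> * (defect w b \<omega> - defect w b \<omega>')) - 1))"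
  shows "\<exists>\<alpha>>0. \<exists>\<beta>>0. \<forall>\<theta> \<phi> n \<omega>. \<theta>0 < \<bar>\<theta>\<bar> \<longrightarrow> bounded_by 1 \<phi> \<longrightarrow> lip (M * \<bar>\<theta>\<bar>) \<phi> \<longrightarrow>
    \<beta> * ln \<bar>\<theta>\<bar> \<le> real n \<longrightarrow> cmod ((P \<theta> ^^ n) \<phi> \<omega>) \<le> 1 - \<bar>\<theta>\<bar> powr - \<alpha>"
proof -
  define \<sigma> where "\<sigma> = - ln \<rho>"
  define q where "q = - ln pmin"
  define L0 where "L0 = ln \<theta>0"
  have \<sigma>: "0 < \<sigma>" and L0: "0 < L0" and q: "0 \<le> q"
    using rho assms(1) pmin by (auto simp: \<sigma>_def L0_def q_def)
  have "0 < 2 * pi * Lc / (1 - \<rho>)" using rho Lc by simp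
  then have M0: "0 < M" using M by linarith
  define C1 where "C1 = 4 * exp (2 * q) + 2 * M + 2 * pi * Lc"
  have C1: "0 < C1" using M0 Lc by (simp add: C1_def add_pos_pos)
  \<comment> \<open>The number 2 pays for the factor |\<theta>| in the Lipschitz constants and for
    the estimate \<open>L \<le> exp L\<close> in the linear factor; \<open>l\<close> is the exponent
    of the gap, and 10 comes from \<open>4 * k + 6\<close> after rounding \<open>k\<close>
    up.\<close>
  obtain \<tau> where \<tau>: "\<tau> \<ge> k0 / L0" "0 < \<tau>" "0 < \<sigma> * \<tau> - (2 + l)"
    "(10 + 4 * \<tau>) * (C1 + 2 * M) < K0 * exp ((\<sigma> * \<tau> - (2 + l)) * L0)"
    using exponential_beats_linear[OF \<sigma> L0 assms(2)] by blast
  \<comment> \<open>With \<open>J\<close> at most \<open>2 * \<tau> * L + 4\<close>, the quotient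
    \<open>\<epsilon> / pmin ^ J\<close> is at most
    \<open>exp (4 * q - 2 * \<sigma> * \<tau> * L)\<close>. Its root then decays at the rate
    \<open>\<sigma> * \<tau>\<close> of \<open>\<rho> ^ k\<close>, so the two errors are
    balanced.\<close>
  define \<alpha> where "\<alpha> = 2 * (q * \<tau> + \<sigma> * \<tau>)"
  \<comment> \<open>Makes \<open>\<beta> * L\<close> at least \<open>2 * \<tau> * L + 4\<close>, an
    upper bound for \<open>J\<close>, for every \<open>L \<ge> L0\<close>.\<close>
  define \<beta> where "\<beta> = 2 * \<tau> + 4 / L0"
  have \<alpha>: "0 < \<alpha>" using \<tau> \<sigma> q by (simp add: \<alpha>_def add_nonneg_pos)
  have \<beta>: "0 < \<beta>" using \<tau> L0 by (simp add: \<beta>_def add_pos_pos)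
  have main: "cmod ((P \<theta> ^^ n) \<phi> \<omega>0) \<le> 1 - \<bar>\<theta>\<bar> powr - \<alpha>"
    if \<theta>: "\<theta>0 < \<bar>\<theta>\<bar>" and \<phi>: "bounded_by 1 \<phi>" "lip (M * \<bar>\<theta>\<bar>) \<phi>"
      and n: "\<beta> * ln \<bar>\<theta>\<bar> \<le> real n"
    for \<theta> \<phi> n \<omega>0
  proof (rule ccontr)
    assume big: "\<not> cmod ((P \<theta> ^^ n) \<phi> \<omega>0) \<le> 1 - \<bar>\<theta>\<bar> powr - \<alpha>"
    define L where "L = ln \<bar>\<theta>\<bar>"
    have \<theta>1: "1 < \<bar>\<theta>\<bar>" using \<theta> assms(1) by simp
    have LL0: "L0 \<le> L" using \<theta> assms(1) by (simp add: L_def L0_def)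
    have L: "0 < L" using LL0 L0 by simp
    have \<theta>L: "\<bar>\<theta>\<bar> = exp L" using \<theta>1 by (simp add: L_def)
    have powr: "\<bar>\<theta>\<bar> powr x = exp (x * L)" for x using \<theta>1 by (simp add: powr_def L_def)
    define k where "k = nat \<lceil>\<tau> * L\<rceil>"
    have k: "\<tau> * L \<le> k" "k \<le> \<tau> * L + 1" using \<tau> L unfolding k_def by (simp_all add: of_nat_ceiling) 
    have "k0 \<le> \<tau> * L0" using \<tau>(1) L0 by (simp add: field_simps)
    also have "\<dots> \<le> \<tau> * L" using LL0 \<tau> by simp
    finally have k0: "k0 \<le> k" using k(1) by linarith
    define J where "J = 2 * k + 2"
    have "4 \<le> 4 / L0 * L" using LL0 L0 by (simp add: field_simps)
    then have "real J \<le> \<beta> * L" using k(2) by (simp add: J_def \<beta>_def distrib_right)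
    then have Jn: "J \<le> n" using n by (simp add: L_def)
    define g where "g j = (P \<theta> ^^ (n - j)) \<phi>" for j
    have gP: "g j = P \<theta> (g (Suc j))" if "j < J" for j
    proof -
      have "n - j = Suc (n - Suc j)" using that Jn by simp
      then show ?thesis by (simp add: g_def)
    qed
    have g1: "bounded_by 1 (g j)" for j unfolding g_def by (rule P_pow_bounded[OF \<phi>(1)])
    have gB: "lip (M * \<bar>\<theta>\<bar>) (g j)" for j unfolding g_def by (rule P_pow_lip[OF \<phi> M])
    define \<epsilon> where "\<epsilon> = exp (- \<alpha> * L)"
    have \<epsilon>: "0 \<le> \<epsilon>" "1 - \<epsilon> \<le> cmod (g 0 \<omega>0)" using big by (auto simp: \<epsilon>_def g_def powr)
    define \<eta>' where "\<eta>' = 2 * sqrt (2 * \<epsilon> / pmin ^ J) + (2 * (M * \<bar>\<theta>\<bar>) + 2 * pi * Lc * \<bar>\<theta>\<bar>) * \<rho> ^ k"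
    define E where "E = (4 * k + 6) * \<eta>' + 2 * (M * \<bar>\<theta>\<bar>) * \<rho> ^ k"
    have rk: "\<rho> ^ k \<le> exp (- (\<sigma> * \<tau> * L))"
    proof -
      have "\<rho> ^ k = exp (- \<sigma> * k)" using rho by (simp add: \<sigma>_def exp_of_nat_mult mult.commute[of _ "real k"])
      also have "\<dots> \<le> exp (- \<sigma> * (\<tau> * L))" using k \<sigma> by simp
      finally show ?thesis by (simp add: mult.assoc)
    qed
    have pJ: "sqrt (2 * \<epsilon> / pmin ^ J) \<le> 2 * exp (2 * q) * exp (- (\<sigma> * \<tau> * L))"
    proof (rule real_le_lsqrt)
      have "pmin ^ J = exp (- q * J)" using pmin by (simp add: q_def exp_of_nat_mult mult.commute[of _ "real J"])
      then have "2 * \<epsilon> / pmin ^ J = 2 * exp (- \<alpha> * L + q * J)"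
        using exp_diff[of "- \<alpha> * L" "- q * real J"] by (simp add: \<epsilon>_def)
      also have "\<dots> \<le> 2 * exp (- \<alpha> * L + q * (2 * (\<tau> * L) + 4))"
        using k(2) q by (auto simp: J_def intro!: mult_left_mono)
      also have "- \<alpha> * L + q * (2 * (\<tau> * L) + 4) = 2 * (2 * q + - (\<sigma> * \<tau> * L))"
        by (simp add: \<alpha>_def algebra_simps)
      also have "2 * exp \<dots> \<le> 4 * exp \<dots>" by simp
      also have "4 * exp (2 * (2 * q + - (\<sigma> * \<tau> * L))) = (2 * exp (2 * q) * exp (- (\<sigma> * \<tau> * L)))\<^sup>2"
        by (simp only: exp_double exp_add power_mult_distrib) simp
      finally show "2 * \<epsilon> / pmin ^ J \<le> (2 * exp (2 * q) * exp (- (\<sigma> * \<tau> * L)))\<^sup>2" .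
    qed auto
    let ?X = "exp L * exp (- (\<sigma> * \<tau> * L))"
    have eL: "1 \<le> exp L" "L \<le> exp L" using L exp_ge_add_one_self[of L] by (simp, linarith)
    have "2 * sqrt (2 * \<epsilon> / pmin ^ J) \<le> 4 * exp (2 * q) * (1 * exp (- (\<sigma> * \<tau> * L)))" using pJ by simp
    also have "\<dots> \<le> 4 * exp (2 * q) * ?X"
      using eL by (intro mult_left_mono mult_right_mono) auto
    finally have e1: "2 * sqrt (2 * \<epsilon> / pmin ^ J) \<le> 4 * exp (2 * q) * ?X" .
    have "(2 * (M * \<bar>\<theta>\<bar>) + 2 * pi * Lc * \<bar>\<theta>\<bar>) * \<rho> ^ k = (2 * M + 2 * pi * Lc) * (exp L * \<rho> ^ k)"
      by (simp add: \<theta>L algebra_simps)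
    also have "\<dots> \<le> (2 * M + 2 * pi * Lc) * ?X" using rk M0 Lc by (intro mult_left_mono) auto
    finally have "\<eta>' \<le> 4 * exp (2 * q) * ?X + (2 * M + 2 * pi * Lc) * ?X"
      unfolding \<eta>'_def by (rule add_mono[OF e1])
    also have "\<dots> = C1 * ?X" by (simp add: C1_def algebra_simps)
    finally have \<eta>X: "\<eta>' \<le> C1 * ?X" .
    have "(4 * k + 6) * \<eta>' \<le> (4 * \<tau> * L + 10) * (C1 * ?X)"
      using k(2) \<eta>X \<tau> L C1 pmin \<epsilon>(1) M0 Lc rho by (intro mult_mono) (auto simp: \<eta>'_def)
    moreover have "2 * (M * \<bar>\<theta>\<bar>) * \<rho> ^ k \<le> 2 * M * ?X"
      using rk M0 by (simp add: \<theta>L)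
    ultimately have "E \<le> (4 * \<tau> * L + 10) * (C1 * ?X) + 2 * M * ?X" by (simp add: E_def)
    also have "\<dots> \<le> (4 * \<tau> * L + 10) * (C1 * ?X) + (4 * \<tau> * L + 10) * (2 * M * ?X)"
    proof (rule add_left_mono)
      have "0 \<le> 4 * \<tau> * L" using \<tau> L by simp
      then have "1 * (2 * M * ?X) \<le> (4 * \<tau> * L + 10) * (2 * M * ?X)"
        using M0 by (intro mult_right_mono) auto
      then show "2 * M * ?X \<le> (4 * \<tau> * L + 10) * (2 * M * ?X)" by simp
    qed
    also have "\<dots> = (4 * \<tau> * L + 10) * ((C1 + 2 * M) * ?X)" by (simp add: algebra_simps)
    also have "\<dots> \<le> ((10 + 4 * \<tau>) * exp L) * ((C1 + 2 * M) * ?X)"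
    proof (rule mult_right_mono)
      have "4 * \<tau> * L \<le> 4 * \<tau> * exp L" using eL \<tau> by (intro mult_left_mono) auto
      moreover have "(10 + 4 * \<tau>) * exp L = 10 * exp L + 4 * \<tau> * exp L" by (simp add: distrib_right)
      ultimately show "4 * \<tau> * L + 10 \<le> (10 + 4 * \<tau>) * exp L" using eL by linarith
    qed (use C1 M0 in auto)
    also have "\<dots> = (10 + 4 * \<tau>) * (C1 + 2 * M) * exp (2 * L - \<sigma> * \<tau> * L)"
    proof -
      have "exp (2 * L - \<sigma> * \<tau> * L) = exp L * ?X" by (simp flip: exp_add)
      then show ?thesis by (simp add: mult_ac)
    qed
    also have "\<dots> < K0 * exp ((\<sigma> * \<tau> - (2 + l)) * L0) * exp (2 * L - \<sigma> * \<tau> * L)"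
      using \<tau>(4) by (intro mult_strict_right_mono) auto
    \<comment> \<open>The choice of \<tau> made the coefficient of \<open>L0\<close> positive, so
      the inequality obtained at \<open>L0\<close> persists for larger \<open>L\<close>.\<close>
    also have "\<dots> \<le> K0 * exp ((\<sigma> * \<tau> - (2 + l)) * L) * exp (2 * L - \<sigma> * \<tau> * L)"
      using \<tau>(3) LL0 assms(2) by (intro mult_right_mono mult_left_mono) auto
    also have "\<dots> = K0 * exp (- l * L)"
      by (simp add: mult.assoc exp_add[symmetric]) (simp add: algebra_simps)
    finally have E: "E < K0 * \<bar>\<theta>\<bar> powr - l" by (simp add: powr)
    have kJ: "2 * k + 1 \<le> J" by (simp add: J_def)
    have M\<theta>: "0 \<le> M * \<bar>\<theta>\<bar>" using M0 by simp
    have \<eta>: "\<eta> \<theta> J (M * \<bar>\<theta>\<bar>) \<epsilon> k = \<eta>'"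
      unfolding \<eta>'_def by (rule \<eta>_def[OF gP g1 gB M\<theta> \<epsilon>])
    have 1: "cmod (ec (\<theta> * (c a (\<lambda>_. a) - c b (\<lambda>_. b))) - 1) < K0 * \<bar>\<theta>\<bar> powr - l" for a b
      using periodic_phases[OF gP g1 gB M\<theta> \<epsilon> kJ, of a b] E by (simp add: E_def \<eta>)
    have 2: "cmod (ec (\<theta> * (defect w b \<omega> - defect w b \<omega>')) - 1) < K0 * \<bar>\<theta>\<bar> powr - l"
      if "length w = k" for w b \<omega> \<omega>'
      using cocycle_phases[OF gP g1 gB M\<theta> \<epsilon> kJ that, where \<omega> = \<omega> and \<omega>' = \<omega>' and b = b] E by (simp add: E_def \<eta>)
    from gap[OF \<theta> k0] show False
    proof (elim disjE exE conjE)
      fix a b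
      assume "K0 * \<bar>\<theta>\<bar> powr - l \<le> cmod (ec (\<theta> * (c a (\<lambda>_. a) - c b (\<lambda>_. b))) - 1)"
      then show False using 1[of a b] by linarith
    next
      fix w :: "'a list" and b \<omega> \<omega>'
      assume "length w = k" "K0 * \<bar>\<theta>\<bar> powr - l \<le> cmod (ec (\<theta> * (defect w b \<omega> - defect w b \<omega>')) - 1)"
      then show False using 2[of w b \<omega> \<omega>'] by linarith
    qed
  qed
  show ?thesis
    by (intro exI[of _ \<alpha>] exI[of _ \<beta>] conjI \<alpha> \<beta> allI impI) (rule main)
qed

end

section \<open>Decay of the operator norm\<close>

lemma word_dist_ultrametric:
  assumes "0 < \<rho>" "\<rho> < 1"
  shows "word_dist \<rho> \<omega> \<omega>'' \<le> max (word_dist \<rho> \<omega> \<omega>') (word_dist \<rho> \<omega>' \<omega>'')"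
proof (cases "\<omega> = \<omega>''")
  case True
  then show ?thesis using word_dist_nonneg[OF assms(1), of \<omega> \<omega>'] by simp
next
  case False
  define n where "n = (LEAST n. \<omega> n \<noteq> \<omega>'' n)"
  have n: "\<omega> n \<noteq> \<omega>'' n" unfolding n_def by (rule LeastI_ex) (use False in auto)
  have le: "word_dist \<rho> \<omega> \<omega>'' \<le> word_dist \<rho> x y" if "x n \<noteq> y n" for x y
  proof -
    have "(LEAST n. x n \<noteq> y n) \<le> n" using that by (rule Least_le)
    then have "\<rho> ^ Suc n \<le> \<rho> ^ Suc (LEAST n. x n \<noteq> y n)"
      using assms by (intro power_decreasing) auto
    then show ?thesis using False that by (auto simp: word_dist_def n_def[symmetric])
  qed
  have "\<omega> n \<noteq> \<omega>' n \<or> \<omega>' n \<noteq> \<omega>'' n" using n by metis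
  then show ?thesis using le[of \<omega> \<omega>'] le[of \<omega>' \<omega>''] by (auto simp: max_def)
qed

text \<open>The rotated difference splits as \<open>cos s * (\<zeta> - \<zeta>') + \<i> * sin s *
  (\<zeta> + \<zeta>')\<close>, and the parallelogram law bounds the sum in terms of the
  difference.\<close>

lemma norm_rotated_diff:
  fixes \<zeta> \<zeta>' :: complex
  assumes "cmod \<zeta> \<le> R" "cmod \<zeta>' \<le> R"
  defines "x \<equiv> cmod (\<zeta> - \<zeta>')"
  shows "cmod (cis s * \<zeta> - cis (- s) * \<zeta>') \<le> \<bar>cos s\<bar> * x + \<bar>sin s\<bar> * sqrt (4 * R\<^sup>2 - x\<^sup>2)"
    "x\<^sup>2 \<le> 4 * R\<^sup>2"
proof -
  have "(cmod (\<zeta> + \<zeta>'))\<^sup>2 + x\<^sup>2 = 2 * (cmod \<zeta>)\<^sup>2 + 2 * (cmod \<zeta>')\<^sup>2"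
    unfolding x_def cmod_power2 by (simp add: power2_eq_square algebra_simps)
  also have "\<dots> \<le> 2 * R\<^sup>2 + 2 * R\<^sup>2"
    using assms by (intro add_mono mult_left_mono power_mono) auto
  finally have 1: "(cmod (\<zeta> + \<zeta>'))\<^sup>2 \<le> 4 * R\<^sup>2 - x\<^sup>2" by simp
  then show "x\<^sup>2 \<le> 4 * R\<^sup>2" using zero_le_power2[of "cmod (\<zeta> + \<zeta>')"] by linarith
  have 2: "cmod (\<zeta> + \<zeta>') \<le> sqrt (4 * R\<^sup>2 - x\<^sup>2)" using 1 by (rule real_le_rsqrt)
  have "cis s * \<zeta> - cis (- s) * \<zeta>' = of_real (cos s) * (\<zeta> - \<zeta>') + \<i> * of_real (sin s) * (\<zeta> + \<zeta>')"
    by (simp add: complex_eq_iff algebra_simps)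
  then have "cmod (cis s * \<zeta> - cis (- s) * \<zeta>') \<le> cmod (of_real (cos s) * (\<zeta> - \<zeta>')) + cmod (\<i> * of_real (sin s) * (\<zeta> + \<zeta>'))"
    by (simp only: norm_triangle_ineq)
  also have "\<dots> = \<bar>cos s\<bar> * x + \<bar>sin s\<bar> * cmod (\<zeta> + \<zeta>')" by (simp add: norm_mult x_def)
  also have "\<dots> \<le> \<bar>cos s\<bar> * x + \<bar>sin s\<bar> * sqrt (4 * R\<^sup>2 - x\<^sup>2)"
    using 2 by (intro add_left_mono mult_left_mono) auto
  finally show "cmod (cis s * \<zeta> - cis (- s) * \<zeta>') \<le> \<bar>cos s\<bar> * x + \<bar>sin s\<bar> * sqrt (4 * R\<^sup>2 - x\<^sup>2)" .
qed

text \<open>Equality in the preceding bound at radius 1: \<open>u - u'\<close> is real and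
  \<open>u + u'\<close> imaginary, with signs matched to \<open>cos s\<close> and
  \<open>sin s\<close> so that both contributions are nonnegative reals. If one of these vanishes,
  so does the coordinate.\<close>

lemma extremal_pair:
  assumes "0 \<le> x" "x \<le> 2"
  obtains u u' :: complex where "cmod u \<le> 1" "cmod u' \<le> 1" "cmod (u - u') \<le> x"
    "cis s * u - cis (- s) * u' = of_real (\<bar>cos s\<bar> * x + \<bar>sin s\<bar> * sqrt (4 - x\<^sup>2))"
proof -
  define S where "S = sqrt (4 - x\<^sup>2)"
  have x2: "x\<^sup>2 \<le> 4" using power_mono[OF assms(2,1), of 2] by simp
  then have S: "S\<^sup>2 = 4 - x\<^sup>2" by (simp add: S_def)
  define u where "u = Complex (x * sgn (cos s) / 2) (- (S * sgn (sin s)) / 2)"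
  define u' where "u' = Complex (- (x * sgn (cos s)) / 2) (- (S * sgn (sin s)) / 2)"
  have sg: "(sgn t)\<^sup>2 \<le> 1" for t :: real by (simp add: sgn_if)
  have "(x * sgn (cos s))\<^sup>2 + (S * sgn (sin s))\<^sup>2 \<le> x\<^sup>2 * 1 + S\<^sup>2 * 1"
    unfolding power_mult_distrib by (intro add_mono mult_left_mono sg) auto
  then have le: "(x * sgn (cos s))\<^sup>2 + (S * sgn (sin s))\<^sup>2 \<le> 4" by (simp add: S)
  show ?thesis
  proof (rule that)
    show "cmod u \<le> 1" using le by (simp add: u_def complex_norm power_divide field_simps)
    show "cmod u' \<le> 1" using le by (simp add: u'_def complex_norm power_divide field_simps)
    have "u - u' = of_real (x * sgn (cos s))" by (simp add: u_def u'_def complex_eq_iff)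
    then have "cmod (u - u') = \<bar>x * sgn (cos s)\<bar>" by (simp only: norm_of_real)
    also have "\<dots> \<le> x" using assms by (simp add: abs_mult sgn_if)
    finally show "cmod (u - u') \<le> x" .
    have "\<bar>t\<bar> = t * sgn t" for t :: real by (simp add: sgn_if)
    then show "cis s * u - cis (- s) * u' = of_real (\<bar>cos s\<bar> * x + \<bar>sin s\<bar> * sqrt (4 - x\<^sup>2))"
      by (simp add: complex_eq_iff u_def u'_def S_def algebra_simps)
  qed
qed

text \<open>The squares of the two roots differ by at least \<open>4 * \<epsilon>\<close>, while the
  roots add up to at most 4.\<close>

lemma sqrt_gap:
  assumes "0 \<le> \<epsilon>" "\<epsilon> \<le> 1" "x\<^sup>2 \<le> 4 * (1 - \<epsilon>)\<^sup>2"
  shows "sqrt (4 * (1 - \<epsilon>)\<^sup>2 - x\<^sup>2) \<le> sqrt (4 - x\<^sup>2) - \<epsilon>" "sqrt (4 - x\<^sup>2) \<le> 2"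
proof -
  have R: "(1 - \<epsilon>)\<^sup>2 \<le> 1 - \<epsilon>" using assms by (simp add: power2_eq_square mult_left_le)
  define a where "a = sqrt (4 - x\<^sup>2)"
  define b where "b = sqrt (4 * (1 - \<epsilon>)\<^sup>2 - x\<^sup>2)"
  have x4: "x\<^sup>2 \<le> 4" using assms R by linarith
  have sq: "a\<^sup>2 = 4 - x\<^sup>2" "b\<^sup>2 = 4 * (1 - \<epsilon>)\<^sup>2 - x\<^sup>2" using assms x4 by (simp_all add: a_def b_def)
  have nn: "0 \<le> a" "0 \<le> b" using assms x4 by (simp_all add: a_def b_def)
  have "b\<^sup>2 \<le> a\<^sup>2" using sq R assms by simp
  then have ba: "b \<le> a" using nn by (rule_tac power2_le_imp_le)
  have a2: "a \<le> 2" unfolding a_def by (rule real_le_lsqrt) auto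
  have "4 * \<epsilon> \<le> a\<^sup>2 - b\<^sup>2" using sq R by simp
  also have "\<dots> = (a - b) * (a + b)" by (simp add: power2_eq_square algebra_simps)
  also have "\<dots> \<le> (a - b) * 4" using ba a2 by (intro mult_left_mono) auto
  finally show "b \<le> a - \<epsilon>" by simp
  show "a \<le> 2" by (rule a2)
qed

context phase_cocycle
begin

text \<open>Near the diagonal the best constant in the Lipschitz estimate for \<open>P \<psi>\<close> is attained by a test
  function of modulus 1 that takes two values on each cylinder of length 1; the assumption on \<open>P\<close>
  bounds it. A smaller bound on the modulus of \<open>\<psi>\<close> gains a term proportional to the mean
  \<open>S\<close> of \<open>\<bar>sin\<bar>\<close> of the half phase differences, and if \<open>S\<close> is small the contraction of the metric suffices.
  The condition \<open>1 \<le> C * \<rho> * \<bar>\<theta>\<bar>\<close> makes the values on distinct cylinders independent.\<close>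

lemma lip_contraction:
  assumes C: "1 \<le> C * \<rho> * \<bar>\<theta>\<bar>"
    and stable: "\<And>\<phi>. bounded_by 1 \<phi> \<Longrightarrow> lip (2 * C * \<bar>\<theta>\<bar>) \<phi> \<Longrightarrow> lip (2 * C * \<bar>\<theta>\<bar>) (P \<theta> \<phi>)"
    and \<psi>: "bounded_by (1 - \<epsilon>) \<psi>" "lip (2 * C * \<bar>\<theta>\<bar>) \<psi>" and \<epsilon>: "0 \<le> \<epsilon>" "\<epsilon> \<le> 1"
  shows "lip ((1 - \<epsilon> * (1 - \<rho>) / 4) * (2 * C * \<bar>\<theta>\<bar>)) (P \<theta> \<psi>)"
  unfolding lip_def
proof (intro allI)
  fix \<omega> \<omega>'
  show "cmod (P \<theta> \<psi> \<omega> - P \<theta> \<psi> \<omega>') \<le> (1 - \<epsilon> * (1 - \<rho>) / 4) * (2 * C * \<bar>\<theta>\<bar>) * d \<omega> \<omega>'"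
  proof (cases "\<omega> = \<omega>'")
    case False
    define B where "B = 2 * C * \<bar>\<theta>\<bar>"
    define \<delta> where "\<delta> = d \<omega> \<omega>'"
    have \<delta>: "0 < \<delta>" using False rho by (simp add: \<delta>_def word_dist_def)
    have B: "2 \<le> B * \<rho>" using C by (simp add: B_def mult_ac)
    then have B0: "0 < B" using rho by (metis not_numeral_le_zero linorder_not_le mult_nonpos_nonneg order_trans less_imp_le)
    \<comment> \<open>Half the difference of the two phases; \<open>m\<close> carries their mean.
      This symmetric form is the one to which \<open>norm_rotated_diff\<close> applies.\<close>
    define s where "s a = pi * (\<theta> * c a \<omega> - \<theta> * c a \<omega>')" for a
    define m where "m a = cis (pi * (\<theta> * c a \<omega> + \<theta> * c a \<omega>'))" for a
    have e: "ec (\<theta> * c a \<omega>) = m a * cis (s a)" "ec (\<theta> * c a \<omega>') = m a * cis (- s a)" for a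
      by (simp_all add: ec_def m_def s_def cis_mult) (simp_all add: algebra_simps)
    have diff: "P \<theta> \<phi> \<omega> - P \<theta> \<phi> \<omega>' = (\<Sum>a\<in>UNIV. p a * (m a * (cis (s a) * \<phi> (prepend a \<omega>) - cis (- s a) * \<phi> (prepend a \<omega>'))))" for \<phi>
      unfolding P_def e by (simp add: algebra_simps flip: sum_subtractf)
    define x where "x a = cmod (\<psi> (prepend a \<omega>) - \<psi> (prepend a \<omega>'))" for a
    have \<psi>1: "cmod (\<psi> \<omega>) \<le> 1 - \<epsilon>" for \<omega> using \<psi>(1) by (auto simp: bounded_by_def)
    have x: "0 \<le> x a" "(x a)\<^sup>2 \<le> 4 * (1 - \<epsilon>)\<^sup>2" "x a \<le> 2" "x a \<le> B * \<rho> * \<delta>" for a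
    proof -
      show "0 \<le> x a" by (simp add: x_def)
      show "(x a)\<^sup>2 \<le> 4 * (1 - \<epsilon>)\<^sup>2" unfolding x_def by (rule norm_rotated_diff(2)[OF \<psi>1 \<psi>1])
      show "x a \<le> 2" unfolding x_def
        using norm_triangle_ineq4[of "\<psi> (prepend a \<omega>)" "\<psi> (prepend a \<omega>')"] \<psi>1[of "prepend a \<omega>"] \<psi>1[of "prepend a \<omega>'"] \<epsilon>
        by linarith
      have "x a \<le> B * d (prepend a \<omega>) (prepend a \<omega>')" using \<psi>(2) by (simp add: lip_def x_def B_def)
      then show "x a \<le> B * \<rho> * \<delta>" by (simp add: word_dist_prepend \<delta>_def mult.assoc)
    qed
    have "\<exists>u u'. cmod u \<le> 1 \<and> cmod u' \<le> 1 \<and> cmod (u - u') \<le> x a \<and>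
      cis (s a) * u - cis (- s a) * u' = of_real (\<bar>cos (s a)\<bar> * x a + \<bar>sin (s a)\<bar> * sqrt (4 - (x a)\<^sup>2))" for a
      using extremal_pair[OF x(1,3)] by metis
    then obtain u u' where u: "\<And>a. cmod (u a) \<le> 1" "\<And>a. cmod (u' a) \<le> 1" "\<And>a. cmod (u a - u' a) \<le> x a"
      "\<And>a. cis (s a) * u a - cis (- s a) * u' a = of_real (\<bar>cos (s a)\<bar> * x a + \<bar>sin (s a)\<bar> * sqrt (4 - (x a)\<^sup>2))"
      by metis
    \<comment> \<open>The tail \<omega> receives \<open>u\<close> and the tail \<omega>' receives
      \<open>u'\<close>. By the ultrametric inequality the ball around \<omega>' is separated from
      its complement by \<delta>, so the jump \<open>|u - u'| \<le> B * \<rho> * \<delta>\<close> is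
      allowed. The factor \<open>cnj (m (\<eta> 0))\<close> removes the mean phases, so that no
      cancellation occurs in the sum over letters.\<close>
    define \<phi> where "\<phi> \<eta> = cnj (m (\<eta> 0)) * (if d (\<lambda>n. \<eta> (Suc n)) \<omega>' < \<delta> then u' (\<eta> 0) else u (\<eta> 0))" for \<eta>
    have mm: "m a * cnj (m a) = 1" "cmod (m a) = 1" for a
      by (simp_all add: m_def cis_cnj cis_mult)
    have \<phi>1: "cmod (\<phi> \<eta>) \<le> 1" for \<eta> using u mm by (simp add: \<phi>_def norm_mult)
    have "lip B \<phi>"
      unfolding lip_def
    proof (intro allI)
      fix \<eta> \<eta>' :: "nat \<Rightarrow> 'a"
      let ?t = "\<lambda>n. \<eta> (Suc n)" and ?t' = "\<lambda>n. \<eta>' (Suc n)"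
      have \<eta>: "prepend (\<eta> 0) ?t = \<eta>" "prepend (\<eta>' 0) ?t' = \<eta>'" by (rule prepend_shift)+
      show "cmod (\<phi> \<eta> - \<phi> \<eta>') \<le> B * d \<eta> \<eta>'"
      proof (cases "\<eta> 0 = \<eta>' 0")
        case False
        then have "d \<eta> \<eta>' = \<rho>" using word_dist_prepend_neq[OF False, of \<rho> ?t ?t'] by (simp only: \<eta>)
        moreover have "cmod (\<phi> \<eta> - \<phi> \<eta>') \<le> 2"
          using norm_triangle_ineq4[of "\<phi> \<eta>" "\<phi> \<eta>'"] \<phi>1[of \<eta>] \<phi>1[of \<eta>'] by linarith
        ultimately show ?thesis using B by simp
      next
        case True
        then have d: "d \<eta> \<eta>' = \<rho> * d ?t ?t'" using word_dist_prepend[of \<rho> "\<eta> 0" ?t ?t'] \<eta> by simp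
        show ?thesis
        proof (cases "d ?t \<omega>' < \<delta> \<longleftrightarrow> d ?t' \<omega>' < \<delta>")
          case same: True
          then have "\<phi> \<eta> = \<phi> \<eta>'" using True by (simp add: \<phi>_def)
          then show ?thesis using B0 d_nonneg[of \<eta> \<eta>'] by simp
        next
          case split: False
          have "\<delta> \<le> d ?t ?t'"
            using split word_dist_ultrametric[OF rho, of ?t \<omega>' ?t'] word_dist_ultrametric[OF rho, of ?t' \<omega>' ?t]
              word_dist_commute[of \<rho> ?t ?t'] by linarith
          then have "B * (\<rho> * \<delta>) \<le> B * d \<eta> \<eta>'" unfolding d using B0 rho by (intro mult_left_mono) auto
          moreover have "cmod (\<phi> \<eta> - \<phi> \<eta>') = cmod (u (\<eta> 0) - u' (\<eta> 0))"
            using split True mm by (auto simp: \<phi>_def norm_mult norm_minus_commute simp flip: right_diff_distrib)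
          ultimately show ?thesis using u(3)[of "\<eta> 0"] x(4)[of "\<eta> 0"] by (simp add: mult.assoc)
        qed
      qed
    qed
    then have "lip B (P \<theta> \<phi>)" using stable[of \<phi>] \<phi>1 by (simp add: bounded_by_def B_def)
    then have "cmod (P \<theta> \<phi> \<omega> - P \<theta> \<phi> \<omega>') \<le> B * \<delta>" by (simp add: lip_def \<delta>_def)
    moreover have "P \<theta> \<phi> \<omega> - P \<theta> \<phi> \<omega>' = of_real (\<Sum>a\<in>UNIV. p a * (\<bar>cos (s a)\<bar> * x a + \<bar>sin (s a)\<bar> * sqrt (4 - (x a)\<^sup>2)))"
    proof -
      have "m a * (cis (s a) * \<phi> (prepend a \<omega>) - cis (- s a) * \<phi> (prepend a \<omega>'))
        = m a * cnj (m a) * (cis (s a) * u a - cis (- s a) * u' a)" for a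
        using \<delta> by (simp add: \<phi>_def \<delta>_def algebra_simps)
      then show ?thesis unfolding diff u(4) mm by simp
    qed
    ultimately have "\<bar>(\<Sum>a\<in>UNIV. p a * (\<bar>cos (s a)\<bar> * x a + \<bar>sin (s a)\<bar> * sqrt (4 - (x a)\<^sup>2)))\<bar> \<le> B * \<delta>"
      by (simp only: norm_of_real)
    then have test: "(\<Sum>a\<in>UNIV. p a * (\<bar>cos (s a)\<bar> * x a + \<bar>sin (s a)\<bar> * sqrt (4 - (x a)\<^sup>2))) \<le> B * \<delta>"
      by (rule abs_le_D1)
    define S where "S = (\<Sum>a\<in>UNIV. p a * \<bar>sin (s a)\<bar>)"
    define U where "U = (\<Sum>a\<in>UNIV. p a * (\<bar>cos (s a)\<bar> * x a + \<bar>sin (s a)\<bar> * sqrt (4 * (1 - \<epsilon>)\<^sup>2 - (x a)\<^sup>2)))"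
    have "cmod (P \<theta> \<psi> \<omega> - P \<theta> \<psi> \<omega>') \<le> U"
      unfolding diff U_def x_def
      using p_pos mm norm_rotated_diff(1)[OF \<psi>1 \<psi>1]
      by (intro sum_norm_le) (simp add: norm_mult mult_left_mono less_imp_le)
    moreover have "U \<le> (1 - \<epsilon> * (1 - \<rho>) / 4) * B * \<delta>"
    proof -
      have "U \<le> (\<Sum>a\<in>UNIV. p a * (\<bar>cos (s a)\<bar> * x a + \<bar>sin (s a)\<bar> * (sqrt (4 - (x a)\<^sup>2) - \<epsilon>)))"
        unfolding U_def using p_pos sqrt_gap(1)[OF \<epsilon> x(2)]
        by (intro sum_mono mult_left_mono add_left_mono) (auto intro: less_imp_le)
      also have "\<dots> = (\<Sum>a\<in>UNIV. p a * (\<bar>cos (s a)\<bar> * x a + \<bar>sin (s a)\<bar> * sqrt (4 - (x a)\<^sup>2))) - \<epsilon> * S"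
        by (simp add: S_def sum_distrib_left algebra_simps flip: sum_subtractf)
      finally have 1: "U \<le> B * \<delta> - \<epsilon> * S" using test by linarith
      have "U \<le> (\<Sum>a\<in>UNIV. p a * (1 * (B * \<rho> * \<delta>) + \<bar>sin (s a)\<bar> * 2))"
        unfolding U_def
      proof (intro sum_mono mult_left_mono add_mono mult_mono)
        show "sqrt (4 * (1 - \<epsilon>)\<^sup>2 - (x a)\<^sup>2) \<le> 2" for a
          using sqrt_gap[OF \<epsilon> x(2)[of a]] \<epsilon> by linarith
      qed (use p_pos x in \<open>auto intro: less_imp_le\<close>)
      also have "\<dots> = (\<Sum>a\<in>UNIV. p a) * (B * \<rho> * \<delta>) + 2 * S"
        by (simp add: S_def sum_distrib_left sum_distrib_right algebra_simps flip: sum.distrib)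
      finally have 2: "U \<le> \<rho> * (B * \<delta>) + 2 * S" by (simp add: p_sum mult_ac)
      have t: "0 < B * \<delta>" using B0 \<delta> by simp
      show ?thesis
      \<comment> \<open>If \<open>S\<close> is at least this large, the gain
        \<open>\<epsilon> * S\<close> suffices. Otherwise
        \<open>U \<le> \<rho> * (B * \<delta>) + 2 * S\<close> is already below
        \<open>(1 + \<rho>) / 2 * (B * \<delta>)\<close>.\<close>
      proof (cases "(1 - \<rho>) * (B * \<delta>) / 4 \<le> S")
        case True
        then have "\<epsilon> * ((1 - \<rho>) * (B * \<delta>) / 4) \<le> \<epsilon> * S" using \<epsilon> by (intro mult_left_mono)
        moreover have "(1 - \<epsilon> * (1 - \<rho>) / 4) * B * \<delta> = B * \<delta> - \<epsilon> * ((1 - \<rho>) * (B * \<delta>) / 4)"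
          by (simp add: algebra_simps)
        ultimately show ?thesis using 1 by linarith
      next
        case False
        define Y where "Y = (1 - \<rho>) * (B * \<delta>)"
        have Y0: "0 \<le> Y" unfolding Y_def using rho t by (intro mult_nonneg_nonneg[OF _ less_imp_le]) auto
        have Y: "\<rho> * (B * \<delta>) = B * \<delta> - Y" "(1 - \<epsilon> * (1 - \<rho>) / 4) * B * \<delta> = B * \<delta> - \<epsilon> * Y / 4"
          by (auto simp: Y_def algebra_simps)
        have "\<epsilon> * Y \<le> 1 * Y" using \<epsilon> Y0 by (intro mult_right_mono)
        then show ?thesis using 2 False Y0 unfolding Y Y_def[symmetric] by linarith
      qed
    qed
    ultimately show ?thesis unfolding B_def \<delta>_def by linarith
  qed simp
qed

end

section \<open>The weighted norm expressed by a sup bound and a Lipschitz bound\<close>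

context phase_cocycle
begin

lemma lip_iff_lip_bounds: "0 \<le> B \<Longrightarrow> lip B \<phi> \<longleftrightarrow> B \<in> lip_bounds \<rho> \<phi>"
  by (simp add: lip_def lip_bounds_def)

lemma lip_const_le: "0 \<le> B \<Longrightarrow> lip B \<phi> \<Longrightarrow> lip_const \<rho> \<phi> \<le> B"
  unfolding lip_const_def
  by (rule cInf_lower) (auto simp: lip_iff_lip_bounds lip_bounds_def intro!: bdd_belowI[of _ 0])

lemma lip_lip_const:
  assumes "\<phi> \<in> H1 \<rho>"
  shows "lip (lip_const \<rho> \<phi>) \<phi>"
  unfolding lip_def
proof (intro allI)
  fix \<omega> \<omega>' :: "nat \<Rightarrow> 'a"
  have ne: "lip_bounds \<rho> \<phi> \<noteq> {}" using assms by (simp add: H1_def)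
  show "cmod (\<phi> \<omega> - \<phi> \<omega>') \<le> lip_const \<rho> \<phi> * d \<omega> \<omega>'"
  proof (cases "\<omega> = \<omega>'")
    case False
    then have d: "0 < d \<omega> \<omega>'" using rho by (simp add: word_dist_def)
    have "cmod (\<phi> \<omega> - \<phi> \<omega>') / d \<omega> \<omega>' \<le> lip_const \<rho> \<phi>"
      unfolding lip_const_def using ne d
      by (intro cInf_greatest) (auto simp: lip_bounds_def pos_divide_le_eq)
    then show ?thesis using d by (simp add: pos_divide_le_eq)
  qed simp
qed

lemma H1_iff: "\<phi> \<in> H1 \<rho> \<longleftrightarrow> (\<exists>B\<ge>0. lip B \<phi>)"
  by (auto simp: H1_def lip_bounds_def lip_def)

lemma sup_norm_le: "bounded_by R \<phi> \<Longrightarrow> sup_norm \<phi> \<le> R"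
  unfolding sup_norm_def bounded_by_def by (rule cSUP_least) auto

lemma bounded_by_sup_norm:
  assumes "\<phi> \<in> H1 \<rho>"
  shows "bounded_by (sup_norm \<phi>) \<phi>"
proof -
  obtain B where B: "0 \<le> B" "lip B \<phi>" using assms H1_iff by blast
  have "cmod (\<phi> \<omega>) \<le> cmod (\<phi> undefined) + B" for \<omega>
  proof -
    have "cmod (\<phi> \<omega> - \<phi> undefined) \<le> B * d \<omega> undefined" using B by (simp add: lip_def)
    also have "\<dots> \<le> B * 1" using B d_le_1 by (intro mult_left_mono)
    finally show ?thesis using norm_triangle_ineq2[of "\<phi> \<omega>" "\<phi> undefined"] by linarith
  qed
  then have "bdd_above (range (\<lambda>\<omega>. cmod (\<phi> \<omega>)))" by (intro bdd_aboveI2)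
  then show ?thesis unfolding bounded_by_def sup_norm_def by (auto intro: cSUP_upper)
qed

text \<open>On \<open>H1\<close> the supremum and the infimum of Lipschitz constants are themselves
  valid bounds, which turns the norm into two pointwise conditions.\<close>

lemma theta_norm_le_iff:
  assumes "\<phi> \<in> H1 \<rho>" "0 \<le> q" "0 < C" "\<theta> \<noteq> 0"
  shows "theta_norm \<rho> C \<theta> \<phi> \<le> q \<longleftrightarrow> bounded_by q \<phi> \<and> lip (q * (2 * C * \<bar>\<theta>\<bar>)) \<phi>"
proof -
  have "sup_norm \<phi> \<le> q \<longleftrightarrow> bounded_by q \<phi>"
    using sup_norm_le[of q \<phi>] bounded_by_sup_norm[OF assms(1)] unfolding bounded_by_def
    by (meson order_trans)
  moreover have "lip_const \<rho> \<phi> / (2 * C * \<bar>\<theta>\<bar>) \<le> q \<longleftrightarrow> lip (q * (2 * C * \<bar>\<theta>\<bar>)) \<phi>"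
    using lip_const_le[of "q * (2 * C * \<bar>\<theta>\<bar>)" \<phi>] lip_mono[OF lip_lip_const[OF assms(1)]] assms
    by (auto simp: pos_divide_le_eq)
  ultimately show ?thesis by (simp add: theta_norm_def)
qed

text \<open>The Doeblin-Fortet inequality iterated: the old Lipschitz constant is damped by \<rho>
  at each step, and the source terms form a geometric series.\<close>

lemma P_pow_lip_decay:
  assumes "bounded_by R \<psi>" "lip B \<psi>"
  shows "lip (2 * pi * Lc * \<bar>\<theta>\<bar> * R / (1 - \<rho>) + \<rho> ^ m * B) ((P \<theta> ^^ m) \<psi>)"
proof (induction m)
  case 0
  have "0 \<le> R" using assms(1) norm_ge_zero order_trans unfolding bounded_by_def by blast
  then show ?case using assms(2) rho Lc by (auto intro!: lip_mono[OF assms(2)])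
next
  case (Suc m)
  have "2 * pi * Lc * \<bar>\<theta>\<bar> * R + \<rho> * (2 * pi * Lc * \<bar>\<theta>\<bar> * R / (1 - \<rho>) + \<rho> ^ m * B)
    = 2 * pi * Lc * \<bar>\<theta>\<bar> * R / (1 - \<rho>) + \<rho> ^ Suc m * B" using rho by (simp add: field_simps)
  then show ?case using P_lip[OF P_pow_bounded[OF assms(1)] Suc, of \<theta>] by simp
qed

lemma H1_P_pow: "\<phi> \<in> H1 \<rho> \<Longrightarrow> (P \<theta> ^^ n) \<phi> \<in> H1 \<rho>"
proof -
  assume \<phi>: "\<phi> \<in> H1 \<rho>"
  have "lip (max 0 B) ((P \<theta> ^^ n) \<phi>)" if "lip B ((P \<theta> ^^ n) \<phi>)" for B
    using that by (rule lip_mono) simp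
  then show ?thesis
    using P_pow_lip_decay[OF bounded_by_sup_norm[OF \<phi>] lip_lip_const[OF \<phi>]] H1_iff by (metis max.cobounded1)
qed

text \<open>The set of norms defining \<open>theta_opnorm\<close> is bounded, so its supremum is a genuine one.\<close>

lemma theta_opnorm_P_pow_imp:
  assumes "theta_opnorm \<rho> C \<theta> (P \<theta> ^^ n) \<le> 1" and C: "0 < C" and \<theta>: "\<theta> \<noteq> 0"
    and \<phi>: "bounded_by 1 \<phi>" "lip (2 * C * \<bar>\<theta>\<bar>) \<phi>"
  shows "lip (2 * C * \<bar>\<theta>\<bar>) ((P \<theta> ^^ n) \<phi>)"
proof -
  \<comment> \<open>Above the threshold of \<open>P_pow_lip\<close>, this constant bounds all powers
    a priori, independently of the stability assumption.\<close>
  define M where "M = 2 * C + 2 * pi * Lc / (1 - \<rho>)"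
  have M: "2 * pi * Lc / (1 - \<rho>) \<le> M" "2 * C \<le> M" using C Lc rho by (auto simp: M_def)
  let ?ball = "{\<phi> \<in> H1 \<rho>. theta_norm \<rho> C \<theta> \<phi> \<le> 1}"
  have "theta_norm \<rho> C \<theta> ((P \<theta> ^^ n) \<phi>) \<le> M / (2 * C)" if "\<phi> \<in> ?ball" for \<phi>
  proof -
    have b: "bounded_by 1 \<phi>" "lip (2 * C * \<bar>\<theta>\<bar>) \<phi>" "\<phi> \<in> H1 \<rho>"
      using that theta_norm_le_iff[of \<phi> 1 C \<theta>] C \<theta> by auto
    have 1: "1 \<le> M / (2 * C)" using M C by (simp add: field_simps)
    have "lip (M * \<bar>\<theta>\<bar>) \<phi>" using M by (intro lip_mono[OF b(2)] mult_right_mono) auto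
    then have "lip (M * \<bar>\<theta>\<bar>) ((P \<theta> ^^ n) \<phi>)" using P_pow_lip[OF b(1) _ M(1)] by blast
    moreover have "bounded_by (M / (2 * C)) ((P \<theta> ^^ n) \<phi>)"
      using P_pow_bounded[OF b(1), where \<theta> = \<theta> and n = n] 1 unfolding bounded_by_def by (meson order_trans)
    ultimately show ?thesis
      using 1 C \<theta> by (subst theta_norm_le_iff[OF H1_P_pow[OF b(3)]]) auto
  qed
  then have bdd: "bdd_above ((\<lambda>\<phi>. theta_norm \<rho> C \<theta> ((P \<theta> ^^ n) \<phi>)) ` ?ball)"
    by (intro bdd_aboveI2)
  have \<phi>H: "\<phi> \<in> H1 \<rho>" unfolding H1_iff using \<phi>(2) C by (intro exI[of _ "2 * C * \<bar>\<theta>\<bar>"]) simp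
  then have ball: "\<phi> \<in> ?ball" using theta_norm_le_iff[of \<phi> 1 C \<theta>] \<phi> C \<theta> by simp
  have "theta_norm \<rho> C \<theta> ((P \<theta> ^^ n) \<phi>) \<le> theta_opnorm \<rho> C \<theta> (P \<theta> ^^ n)"
    unfolding theta_opnorm_def by (rule cSUP_upper[OF ball bdd])
  then have "theta_norm \<rho> C \<theta> ((P \<theta> ^^ n) \<phi>) \<le> 1" using assms(1) by linarith
  then show ?thesis using theta_norm_le_iff[OF H1_P_pow[OF \<phi>H], of 1 C \<theta>] C \<theta> by simp
qed

lemma theta_opnorm_leI:
  assumes C: "0 < C" and \<theta>: "\<theta> \<noteq> 0" and q: "0 \<le> q"
    and *: "\<And>\<phi>. bounded_by 1 \<phi> \<Longrightarrow> lip (2 * C * \<bar>\<theta>\<bar>) \<phi> \<Longrightarrow>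
      bounded_by q ((P \<theta> ^^ n) \<phi>) \<and> lip (q * (2 * C * \<bar>\<theta>\<bar>)) ((P \<theta> ^^ n) \<phi>)"
  shows "theta_opnorm \<rho> C \<theta> (P \<theta> ^^ n) \<le> q"
  unfolding theta_opnorm_def
proof (rule cSUP_least)
  have 0: "(\<lambda>_::nat \<Rightarrow> 'a. 0) \<in> H1 \<rho>" unfolding H1_iff by (intro exI[of _ 0]) (simp add: lip_def)
  have "theta_norm \<rho> C \<theta> (\<lambda>_::nat \<Rightarrow> 'a. 0) \<le> 1"
    using C \<theta> d_nonneg by (subst theta_norm_le_iff[OF 0]) (auto simp: bounded_by_def lip_def intro!: mult_nonneg_nonneg)
  then have "(\<lambda>_. 0) \<in> {\<phi> :: (nat \<Rightarrow> 'a) \<Rightarrow> complex. \<phi> \<in> H1 \<rho> \<and> theta_norm \<rho> C \<theta> \<phi> \<le> 1}" using 0 by simp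
  then show "{\<phi> :: (nat \<Rightarrow> 'a) \<Rightarrow> complex. \<phi> \<in> H1 \<rho> \<and> theta_norm \<rho> C \<theta> \<phi> \<le> 1} \<noteq> {}" by (rule ex_in_conv[THEN iffD1, OF exI])
  fix \<phi> :: "(nat \<Rightarrow> 'a) \<Rightarrow> complex" assume "\<phi> \<in> {\<phi> \<in> H1 \<rho>. theta_norm \<rho> C \<theta> \<phi> \<le> 1}"
  then have "\<phi> \<in> H1 \<rho>" "bounded_by 1 \<phi>" "lip (2 * C * \<bar>\<theta>\<bar>) \<phi>"
    using theta_norm_le_iff[of \<phi> 1 C \<theta>] C \<theta> by auto
  then show "theta_norm \<rho> C \<theta> ((P \<theta> ^^ n) \<phi>) \<le> q"
    using * C \<theta> q by (subst theta_norm_le_iff[OF H1_P_pow]) auto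
qed

lemma P_scale: "P \<theta> (\<lambda>\<omega>. z * \<phi> \<omega>) = (\<lambda>\<omega>. z * P \<theta> \<phi> \<omega>)"
  by (rule ext) (simp add: P_def sum_distrib_left mult_ac)

lemma P_pow_scale: "(P \<theta> ^^ n) (\<lambda>\<omega>. z * \<phi> \<omega>) = (\<lambda>\<omega>. z * (P \<theta> ^^ n) \<phi> \<omega>)"
  by (induction n) (auto simp: P_scale)

lemma bounded_by_scale: "0 \<le> q \<Longrightarrow> bounded_by R \<phi> \<Longrightarrow> bounded_by (q * R) (\<lambda>\<omega>. of_real q * \<phi> \<omega>)"
  by (simp add: bounded_by_def norm_mult mult_left_mono)

lemma lip_scale: "0 \<le> q \<Longrightarrow> lip B \<phi> \<Longrightarrow> lip (q * B) (\<lambda>\<omega>. of_real q * \<phi> \<omega>)"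
  by (simp add: lip_def norm_mult mult.assoc mult_left_mono flip: right_diff_distrib)

text \<open>After the sup norm has dropped, further iterations make the Lipschitz constant drop too,
  since the source term is proportional to the sup norm. Linearity then permits rescaling to the
  unit ball and repetition. No constant depends on \<theta> in \<open>T\<close>.\<close>

lemma uniform_decay:
  assumes M: "2 * pi * Lc / (1 - \<rho>) \<le> M" and \<epsilon>: "0 < \<epsilon>" "\<epsilon> \<le> 1" and \<kappa>: "0 < \<kappa>"
    and sup: "\<And>\<theta> \<phi>. \<theta> \<in> T \<Longrightarrow> bounded_by 1 \<phi> \<Longrightarrow> lip (M * \<bar>\<theta>\<bar>) \<phi> \<Longrightarrow> bounded_by (1 - \<epsilon>) ((P \<theta> ^^ n1) \<phi>)"
  shows "\<exists>n2. \<forall>n\<ge>n2. \<forall>\<theta>\<in>T. \<forall>\<phi>. bounded_by 1 \<phi> \<longrightarrow> lip (M * \<bar>\<theta>\<bar>) \<phi> \<longrightarrow>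
    bounded_by \<kappa> ((P \<theta> ^^ n) \<phi>) \<and> lip (\<kappa> * (M * \<bar>\<theta>\<bar>)) ((P \<theta> ^^ n) \<phi>)"
proof -
  \<comment> \<open>Half of the gain is given up so that the remainder
    \<open>\<rho> ^ m < \<epsilon> / 2\<close> of the old Lipschitz constant fits in.\<close>
  define q where "q = 1 - \<epsilon> / 2"
  have q: "0 < q" "q < 1" using \<epsilon> by (auto simp: q_def)
  have "0 < 2 * pi * Lc / (1 - \<rho>)" using rho Lc by simp
  then have M0: "0 < M" using M by linarith
  have "(\<lambda>m. \<rho> ^ m) \<longlonglongrightarrow> 0" using rho by (simp add: LIMSEQ_power_zero)
  then have "\<forall>\<^sub>F m in sequentially. \<rho> ^ m < \<epsilon> / 2" using \<epsilon> by (intro order_tendstoD(2)) auto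
  then obtain m where m: "\<rho> ^ m < \<epsilon> / 2" by (auto simp: eventually_sequentially)
  define N where "N = m + n1"
  have step: "bounded_by q ((P \<theta> ^^ N) \<phi>) \<and> lip (q * (M * \<bar>\<theta>\<bar>)) ((P \<theta> ^^ N) \<phi>)"
    if \<theta>: "\<theta> \<in> T" and \<phi>: "bounded_by 1 \<phi>" "lip (M * \<bar>\<theta>\<bar>) \<phi>" for \<theta> \<phi>
  proof -
    let ?\<psi> = "(P \<theta> ^^ n1) \<phi>"
    have b: "bounded_by (1 - \<epsilon>) ?\<psi>" by (rule sup[OF \<theta> \<phi>])
    have l: "lip (M * \<bar>\<theta>\<bar>) ?\<psi>" by (rule P_pow_lip[OF \<phi> M])
    have "bounded_by (1 - \<epsilon>) ((P \<theta> ^^ m) ?\<psi>)" by (rule P_pow_bounded[OF b])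
    then have "bounded_by q ((P \<theta> ^^ m) ?\<psi>)" using \<epsilon> unfolding bounded_by_def q_def by (smt (verit) field_sum_of_halves)
    moreover have "lip (q * (M * \<bar>\<theta>\<bar>)) ((P \<theta> ^^ m) ?\<psi>)"
    proof (rule lip_mono[OF P_pow_lip_decay[OF b l]])
      have "2 * pi * Lc * \<bar>\<theta>\<bar> * (1 - \<epsilon>) / (1 - \<rho>) = (2 * pi * Lc / (1 - \<rho>)) * (\<bar>\<theta>\<bar> * (1 - \<epsilon>))" by simp
      also have "\<dots> \<le> M * (\<bar>\<theta>\<bar> * (1 - \<epsilon>))" using M \<epsilon> by (intro mult_right_mono) auto
      finally have 1: "2 * pi * Lc * \<bar>\<theta>\<bar> * (1 - \<epsilon>) / (1 - \<rho>) \<le> (1 - \<epsilon>) * (M * \<bar>\<theta>\<bar>)" by (simp add: mult_ac)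
      have 2: "\<rho> ^ m * (M * \<bar>\<theta>\<bar>) \<le> \<epsilon> / 2 * (M * \<bar>\<theta>\<bar>)" using m M0 by (intro mult_right_mono) auto
      have "q * (M * \<bar>\<theta>\<bar>) = (1 - \<epsilon>) * (M * \<bar>\<theta>\<bar>) + \<epsilon> / 2 * (M * \<bar>\<theta>\<bar>)" by (simp add: q_def algebra_simps)
      then show "2 * pi * Lc * \<bar>\<theta>\<bar> * (1 - \<epsilon>) / (1 - \<rho>) + \<rho> ^ m * (M * \<bar>\<theta>\<bar>) \<le> q * (M * \<bar>\<theta>\<bar>)" using 1 2 by linarith
    qed
    ultimately show ?thesis by (simp add: N_def funpow_add)
  qed
  have iter: "bounded_by (q ^ j) ((P \<theta> ^^ (j * N)) \<phi>) \<and> lip (q ^ j * (M * \<bar>\<theta>\<bar>)) ((P \<theta> ^^ (j * N)) \<phi>)"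
    if \<theta>: "\<theta> \<in> T" and \<phi>: "bounded_by 1 \<phi>" "lip (M * \<bar>\<theta>\<bar>) \<phi>" for \<theta> \<phi> j
  proof (induction j)
    case 0
    then show ?case using \<phi> by simp
  next
    case (Suc j)
    define \<phi>1 where "\<phi>1 \<omega> = of_real (inverse (q ^ j)) * (P \<theta> ^^ (j * N)) \<phi> \<omega>" for \<omega>
    have "bounded_by (inverse (q ^ j) * q ^ j) \<phi>1" "lip (inverse (q ^ j) * (q ^ j * (M * \<bar>\<theta>\<bar>))) \<phi>1"
      unfolding \<phi>1_def[abs_def] using q
      by (intro bounded_by_scale lip_scale conjunct1[OF Suc] conjunct2[OF Suc]; simp)+
    then have \<phi>1: "bounded_by 1 \<phi>1" "lip (M * \<bar>\<theta>\<bar>) \<phi>1" using q by (simp_all add: mult.assoc[symmetric])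
    have "(P \<theta> ^^ (j * N)) \<phi> = (\<lambda>\<omega>. of_real (q ^ j) * \<phi>1 \<omega>)"
      using q by (auto simp: \<phi>1_def)
    then have "(P \<theta> ^^ (Suc j * N)) \<phi> = (\<lambda>\<omega>. of_real (q ^ j) * (P \<theta> ^^ N) \<phi>1 \<omega>)"
      by (simp only: mult_Suc funpow_add o_apply P_pow_scale)
    then show ?case
      using bounded_by_scale[of "q ^ j" q "(P \<theta> ^^ N) \<phi>1"] lip_scale[of "q ^ j" "q * (M * \<bar>\<theta>\<bar>)" "(P \<theta> ^^ N) \<phi>1"]
        step[OF \<theta> \<phi>1] q by (simp add: mult_ac)
  qed
  have "(\<lambda>j. q ^ j) \<longlonglongrightarrow> 0" using q by (simp add: LIMSEQ_power_zero)
  then have "\<forall>\<^sub>F j in sequentially. q ^ j < \<kappa>" using \<kappa> by (rule order_tendstoD)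
  then obtain j where j: "q ^ j < \<kappa>" by (auto simp: eventually_sequentially)
  show ?thesis
  proof (intro exI[of _ "j * N"] allI ballI impI)
    fix n \<theta> \<phi> assume n: "j * N \<le> n" and \<theta>: "\<theta> \<in> T" and \<phi>: "bounded_by 1 \<phi>" "lip (M * \<bar>\<theta>\<bar>) \<phi>"
    let ?\<psi> = "(P \<theta> ^^ (n - j * N)) \<phi>"
    have "bounded_by 1 ?\<psi>" "lip (M * \<bar>\<theta>\<bar>) ?\<psi>"
      using P_pow_bounded[OF \<phi>(1)] P_pow_lip[OF \<phi> M] by auto
    note it = iter[OF \<theta> this, of j]
    have "(P \<theta> ^^ (j * N + (n - j * N))) \<phi> = (P \<theta> ^^ (j * N)) ?\<psi>"
      by (simp only: funpow_add o_apply)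
    then have "(P \<theta> ^^ n) \<phi> = (P \<theta> ^^ (j * N)) ?\<psi>"
      using n by (simp only: le_add_diff_inverse)
    moreover have "bounded_by \<kappa> ((P \<theta> ^^ (j * N)) ?\<psi>)"
      using it j unfolding bounded_by_def by (meson less_imp_le order_trans)
    moreover have "lip (\<kappa> * (M * \<bar>\<theta>\<bar>)) ((P \<theta> ^^ (j * N)) ?\<psi>)"
      using it j M0 by (auto intro!: lip_mono[OF conjunct2[OF it]] mult_right_mono)
    ultimately show "bounded_by \<kappa> ((P \<theta> ^^ n) \<phi>) \<and> lip (\<kappa> * (M * \<bar>\<theta>\<bar>)) ((P \<theta> ^^ n) \<phi>)" by simp
  qed
qed

text \<open>For large \<open>\<theta>\<close> one further application of \<open>P\<close> turns the decay of the supremum norm into decay of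
  the Lipschitz constant; for bounded \<open>\<theta>\<close> a fixed number of iterations makes both small.\<close>

lemma theta_opnorm_decay:
  assumes C: "0 < C" and \<theta>0: "1 < \<theta>0"
    and hyp: "\<And>\<theta> n. \<theta> \<noteq> 0 \<Longrightarrow> theta_opnorm \<rho> C \<theta> (P \<theta> ^^ n) \<le> 1"
    and sup: "\<And>M. 2 * pi * Lc / (1 - \<rho>) \<le> M \<Longrightarrow> \<exists>\<alpha>>0. \<exists>\<beta>>0. \<forall>\<theta> \<phi> n \<omega>. \<theta>0 < \<bar>\<theta>\<bar> \<longrightarrow> bounded_by 1 \<phi> \<longrightarrow>
      lip (M * \<bar>\<theta>\<bar>) \<phi> \<longrightarrow> \<beta> * ln \<bar>\<theta>\<bar> \<le> real n \<longrightarrow> cmod ((P \<theta> ^^ n) \<phi> \<omega>) \<le> 1 - \<bar>\<theta>\<bar> powr - \<alpha>"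
  shows "\<exists>\<alpha>>0. \<exists>\<beta>>0. \<exists>K>0. \<forall>\<theta>. \<bar>\<theta>\<bar> > \<theta>0 \<longrightarrow>
    theta_opnorm \<rho> C \<theta> (P \<theta> ^^ num_iter \<beta> \<theta>) \<le> 1 - K / \<bar>\<theta>\<bar> powr \<alpha>"
proof -
  \<comment> \<open>At least \<open>2 * C\<close>, so the unit ball of the weighted norm satisfies
    the Lipschitz bound with \<open>M\<close>; and above the threshold under which
    \<open>P_pow_lip\<close> and \<open>sup\<close> apply.\<close>
  define M where "M = 2 * C + 2 * pi * Lc / (1 - \<rho>)"
  have M: "2 * pi * Lc / (1 - \<rho>) \<le> M" "2 * C \<le> M" using C Lc rho by (auto simp: M_def)
  have M0: "0 < M" using M C by linarith
  obtain \<alpha> \<beta>1 where \<alpha>: "0 < \<alpha>" and \<beta>1: "0 < \<beta>1" and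
    dec: "\<And>\<theta> \<phi> n \<omega>. \<theta>0 < \<bar>\<theta>\<bar> \<Longrightarrow> bounded_by 1 \<phi> \<Longrightarrow> lip (M * \<bar>\<theta>\<bar>) \<phi> \<Longrightarrow> \<beta>1 * ln \<bar>\<theta>\<bar> \<le> real n \<Longrightarrow>
      cmod ((P \<theta> ^^ n) \<phi> \<omega>) \<le> 1 - \<bar>\<theta>\<bar> powr - \<alpha>"
    using sup[OF M(1)] by blast
  \<comment> \<open>Beyond this value the condition \<open>1 \<le> C * \<rho> * |\<theta>|\<close>
    of \<open>lip_contraction\<close> holds.\<close>
  define \<Theta> where "\<Theta> = max (1 / (C * \<rho>)) \<theta>0"
  have \<Theta>: "1 / (C * \<rho>) \<le> \<Theta>" "\<theta>0 \<le> \<Theta>" by (auto simp: \<Theta>_def)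
  define T where "T = {\<theta>. \<theta>0 < \<bar>\<theta>\<bar> \<and> \<bar>\<theta>\<bar> \<le> \<Theta>}"
  define n1 where "n1 = nat \<lceil>\<beta>1 * ln \<Theta>\<rceil>"
  define \<epsilon>0 where "\<epsilon>0 = \<Theta> powr - \<alpha>"
  have \<epsilon>0: "0 < \<epsilon>0" "\<epsilon>0 \<le> 1" using \<Theta> \<theta>0 \<alpha> powr_mono[of "- \<alpha>" 0 \<Theta>] by (auto simp: \<epsilon>0_def)
  \<comment> \<open>\<open>\<kappa> * M \<le> C\<close> converts a bound measured by
    \<open>M\<close> into half of the bound \<open>2 * C\<close> of the weighted norm.\<close>
  define \<kappa> where "\<kappa> = min (1/2) (C / M)"
  have \<kappa>: "0 < \<kappa>" "\<kappa> \<le> 1/2" "\<kappa> * M \<le> C"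
  proof -
    show "0 < \<kappa>" using C M0 by (simp add: \<kappa>_def)
    show "\<kappa> \<le> 1/2" unfolding \<kappa>_def by (rule min.cobounded1)
    have "\<kappa> * M \<le> C / M * M" using M0 by (intro mult_right_mono) (auto simp: \<kappa>_def)
    then show "\<kappa> * M \<le> C" using M0 by simp
  qed
  have "bounded_by (1 - \<epsilon>0) ((P \<theta> ^^ n1) \<phi>)"
    if "\<theta> \<in> T" "bounded_by 1 \<phi>" "lip (M * \<bar>\<theta>\<bar>) \<phi>" for \<theta> \<phi>
  proof -
    have \<theta>: "\<theta>0 < \<bar>\<theta>\<bar>" "\<bar>\<theta>\<bar> \<le> \<Theta>" using that by (auto simp: T_def)
    have "\<beta>1 * ln \<bar>\<theta>\<bar> \<le> \<beta>1 * ln \<Theta>" using \<theta> \<theta>0 \<beta>1 by (intro mult_left_mono) auto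
    then have "\<beta>1 * ln \<bar>\<theta>\<bar> \<le> real n1" unfolding n1_def using real_nat_ceiling_ge[of "\<beta>1 * ln \<Theta>"] by linarith
    moreover have "\<epsilon>0 \<le> \<bar>\<theta>\<bar> powr - \<alpha>" unfolding \<epsilon>0_def using \<theta> \<theta>0 \<alpha> by (intro powr_mono2') auto
    ultimately show ?thesis
      using dec[OF \<theta>(1) that(2,3)] unfolding bounded_by_def by (smt (verit))
  qed
  then obtain n2 where n2: "\<And>n \<theta> \<phi>. n2 \<le> n \<Longrightarrow> \<theta> \<in> T \<Longrightarrow> bounded_by 1 \<phi> \<Longrightarrow> lip (M * \<bar>\<theta>\<bar>) \<phi> \<Longrightarrow>
    bounded_by \<kappa> ((P \<theta> ^^ n) \<phi>) \<and> lip (\<kappa> * (M * \<bar>\<theta>\<bar>)) ((P \<theta> ^^ n) \<phi>)"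
    using uniform_decay[OF M(1) \<epsilon>0 \<kappa>(1), of T n1] by blast
  \<comment> \<open>The surplus \<open>2 + n2\<close> covers the rounding in
    \<open>num_iter\<close>, the last application of \<open>P\<close> and the \<open>n2\<close>
    iterations for bounded \<theta>. Division by \<open>ln \<theta>0\<close> makes it available for
    every |\<theta>| > \<theta>0.\<close>
  define \<beta> where "\<beta> = \<beta>1 + (2 + n2) / ln \<theta>0"
  have L0: "0 < ln \<theta>0" using \<theta>0 by simp
  have \<beta>: "0 < \<beta>" using \<beta>1 L0 by (simp add: \<beta>_def add_pos_nonneg)
  define K where "K = (1 - \<rho>) / 4"
  have K: "0 < K" "K \<le> 1/2" using rho by (auto simp: K_def)
  have "theta_opnorm \<rho> C \<theta> (P \<theta> ^^ num_iter \<beta> \<theta>) \<le> 1 - K / \<bar>\<theta>\<bar> powr \<alpha>" if \<theta>: "\<theta>0 < \<bar>\<theta>\<bar>" for \<theta>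
  proof -
    define n where "n = num_iter \<beta> \<theta>"
    define \<epsilon> where "\<epsilon> = \<bar>\<theta>\<bar> powr - \<alpha>"
    have \<theta>1: "\<theta> \<noteq> 0" "1 < \<bar>\<theta>\<bar>" using \<theta> \<theta>0 by auto
    have \<epsilon>: "0 < \<epsilon>" "\<epsilon> \<le> 1" using \<theta>1 \<alpha> powr_mono[of "- \<alpha>" 0 "\<bar>\<theta>\<bar>"] by (auto simp: \<epsilon>_def)
    have "ln \<theta>0 \<le> ln \<bar>\<theta>\<bar>" using \<theta> \<theta>0 by simp
    then have "(2 + n2) / ln \<theta>0 * ln \<theta>0 \<le> (2 + n2) / ln \<theta>0 * ln \<bar>\<theta>\<bar>"
      using L0 by (intro mult_left_mono) auto
    moreover have "(2 + n2) / ln \<theta>0 * ln \<theta>0 = 2 + n2" using L0 by simp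
    moreover have "\<beta> * ln \<bar>\<theta>\<bar> = \<beta>1 * ln \<bar>\<theta>\<bar> + (2 + n2) / ln \<theta>0 * ln \<bar>\<theta>\<bar>"
      by (simp only: \<beta>_def distrib_right)
    ultimately have "\<beta>1 * ln \<bar>\<theta>\<bar> + 2 + n2 \<le> \<beta> * ln \<bar>\<theta>\<bar>" by linarith
    moreover have "\<beta> * ln \<bar>\<theta>\<bar> < real n + 1" unfolding n_def num_iter_def by linarith
    ultimately have n: "\<beta>1 * ln \<bar>\<theta>\<bar> + 1 + n2 \<le> n" by linarith
    have "0 \<le> \<beta>1 * ln \<bar>\<theta>\<bar>" using \<beta>1 \<theta>1 by simp
    then have n': "n2 \<le> n" "1 \<le> n" "\<beta>1 * ln \<bar>\<theta>\<bar> \<le> real (n - 1)" using n by (auto simp: of_nat_diff)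
    define q where "q = 1 - K * \<epsilon>"
    have K\<epsilon>: "K * \<epsilon> \<le> 1/2" using K \<epsilon> mult_mono[of K "1/2" \<epsilon> 1] by simp
    have q: "1/2 \<le> q" "1 - \<epsilon> \<le> q"
    proof -
      show "1/2 \<le> q" using K\<epsilon> by (simp add: q_def)
      have "K * \<epsilon> \<le> 1 * \<epsilon>" using K \<epsilon> by (intro mult_right_mono) auto
      then show "1 - \<epsilon> \<le> q" by (simp add: q_def)
    qed
    have "theta_opnorm \<rho> C \<theta> (P \<theta> ^^ n) \<le> q"
    proof (rule theta_opnorm_leI[OF C \<theta>1(1)])
      show "0 \<le> q" using q by linarith
      fix \<phi> assume \<phi>: "bounded_by 1 \<phi>" "lip (2 * C * \<bar>\<theta>\<bar>) \<phi>"
      have \<phi>M: "lip (M * \<bar>\<theta>\<bar>) \<phi>" using M by (intro lip_mono[OF \<phi>(2)] mult_right_mono) auto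
      show "bounded_by q ((P \<theta> ^^ n) \<phi>) \<and> lip (q * (2 * C * \<bar>\<theta>\<bar>)) ((P \<theta> ^^ n) \<phi>)"
      proof (cases "\<bar>\<theta>\<bar> \<le> \<Theta>")
        case True
        then have "\<theta> \<in> T" using \<theta> by (simp add: T_def)
        note small = n2[OF n'(1) this \<phi>(1) \<phi>M]
        have "bounded_by q ((P \<theta> ^^ n) \<phi>)"
          using small \<kappa>(2) q(1) unfolding bounded_by_def by (meson order_trans)
        moreover have "\<kappa> * (M * \<bar>\<theta>\<bar>) \<le> q * (2 * C * \<bar>\<theta>\<bar>)"
        proof -
          have "1 / 2 * (2 * C) \<le> q * (2 * C)" using q(1) C by (intro mult_right_mono) auto
          then have "\<kappa> * M \<le> q * (2 * C)" using \<kappa>(3) by linarith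
          then have "(\<kappa> * M) * \<bar>\<theta>\<bar> \<le> (q * (2 * C)) * \<bar>\<theta>\<bar>" by (rule mult_right_mono) simp
          then show ?thesis by (simp add: mult.assoc)
        qed
        ultimately show ?thesis using small lip_mono by blast
      next
        case False
        \<comment> \<open>One application of \<open>P\<close> is held back: \<open>n - 1\<close>
          iterates lower the sup norm, and the last one transfers the gain to the Lipschitz
          constant.\<close>
        let ?\<psi> = "(P \<theta> ^^ (n - 1)) \<phi>"
        have b: "bounded_by (1 - \<epsilon>) ?\<psi>"
          using dec[OF \<theta> \<phi>(1) \<phi>M n'(3)] by (simp add: bounded_by_def \<epsilon>_def)
        have stable: "lip (2 * C * \<bar>\<theta>\<bar>) ((P \<theta> ^^ k) \<phi>')" if "bounded_by 1 \<phi>'" "lip (2 * C * \<bar>\<theta>\<bar>) \<phi>'" for \<phi>' k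
          by (rule theta_opnorm_P_pow_imp[OF hyp[OF \<theta>1(1)] C \<theta>1(1) that])
        have "1 / (C * \<rho>) \<le> \<bar>\<theta>\<bar>" using False \<Theta> by linarith
        then have big: "1 \<le> C * \<rho> * \<bar>\<theta>\<bar>" using C rho by (simp add: field_simps)
        have "lip ((1 - \<epsilon> * (1 - \<rho>) / 4) * (2 * C * \<bar>\<theta>\<bar>)) (P \<theta> ?\<psi>)"
          using stable[of _ 1] \<epsilon> by (intro lip_contraction[OF big _ b stable[OF \<phi>]]) auto
        moreover have "1 - \<epsilon> * (1 - \<rho>) / 4 = q" by (simp add: q_def K_def)
        moreover have "(P \<theta> ^^ n) \<phi> = P \<theta> ?\<psi>" using n'(2) by (cases n) auto
        moreover have "bounded_by q (P \<theta> ?\<psi>)"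
          using P_bounded[OF b, of \<theta>] q(2) unfolding bounded_by_def by (meson order_trans)
        ultimately show ?thesis by simp
      qed
    qed
    then show ?thesis by (simp add: n_def q_def \<epsilon>_def powr_minus divide_inverse)
  qed
  then show ?thesis using \<alpha> \<beta> K by blast
qed

end

section \<open>The Diophantine alternative and the assembly\<close>

context conformal_ifs
begin

text \<open>The Diophantine condition concerns large arguments, whereas a gap is wanted for all
  |\<theta>| > 1. It is used at \<open>m * \<theta>\<close> with a fixed integer \<open>m\<close>;
  raising to the \<open>m\<close>-th power enlarges the distance to 1 at most \<open>m\<close>
  times, so the gap returns to \<theta> with a smaller constant.\<close>

lemma diophantine_gap:
  assumes "diophantine I f"
  obtains K0 l where "0 < K0" "\<And>\<theta>. 1 < \<bar>\<theta>\<bar> \<Longrightarrow> \<exists>a b.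
    K0 * \<bar>\<theta>\<bar> powr - l \<le> cmod (ec (\<theta> * (cocycle I f a (\<lambda>_. a) - cocycle I f b (\<lambda>_. b))) - 1)"
proof -
  define C where "C a = cocycle I f a (\<lambda>_. a)" for a
  obtain l K where l: "0 < l" and K: "0 < K" and ev: "\<forall>\<^sub>F x in at_infinity.
      (INF y. MAX a. infdist (ln \<bar>df a (fixed_point I (f a))\<bar> * x + y) \<int>) \<ge> K * \<bar>x\<bar> powr (- l)"
    using assms unfolding diophantine_def by blast
  have lnC: "ln \<bar>df a (fixed_point I (f a))\<bar> = - C a" for a
    using df_pos[OF coding_in] by (simp add: C_def cocycle_def abs_of_pos flip: coding_const)
  obtain X where X: "\<And>x. X \<le> \<bar>x\<bar> \<Longrightarrow> K * \<bar>x\<bar> powr (- l) \<le> (INF y. MAX a. infdist (- C a * x + y) \<int>)"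
    using ev unfolding eventually_at_infinity lnC real_norm_def by blast
  define m where "m = nat \<lceil>X\<rceil> + 1"
  have m: "1 \<le> real m" "X \<le> real m" by (auto simp: m_def) linarith
  define K0 where "K0 = K * real m powr - l / m"
  have K0: "0 < K0" using K m by (simp add: K0_def)
  have "\<exists>a b. K0 * \<bar>\<theta>\<bar> powr - l \<le> cmod (ec (\<theta> * (C a - C b)) - 1)" if \<theta>: "1 < \<bar>\<theta>\<bar>" for \<theta>
  proof -
    fix b :: 'a
    \<comment> \<open>This shift cancels the term of the arbitrary letter \<open>b\<close>, so the
      maximum over letters measures differences of the data at the fixed words.\<close>
    let ?x = "real m * \<theta>" and ?y = "C b * (real m * \<theta>)"
    have "real m * 1 \<le> real m * \<bar>\<theta>\<bar>" using \<theta> by (intro mult_left_mono) auto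
    then have "X \<le> \<bar>?x\<bar>" using m(2) by (simp add: abs_mult)
    from X[OF this] have "K * \<bar>?x\<bar> powr (- l) \<le> (INF y. MAX a. infdist (- C a * ?x + y) \<int>)" .
    also have "\<dots> \<le> (MAX a. infdist (- C a * ?x + ?y) \<int>)"
    proof (rule cINF_lower)
      have "0 \<le> (MAX a. infdist (- C a * ?x + y) \<int>)" for y
        by (rule order_trans[OF infdist_nonneg Max_ge]) auto
      then show "bdd_below (range (\<lambda>y. MAX a. infdist (- C a * ?x + y) \<int>))" by (intro bdd_belowI2)
    qed simp
    finally have 1: "K * \<bar>?x\<bar> powr (- l) \<le> (MAX a. infdist (- C a * ?x + ?y) \<int>)" .
    have "(MAX a. infdist (- C a * ?x + ?y) \<int>) \<in> range (\<lambda>a. infdist (- C a * ?x + ?y) \<int>)"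
      by (rule Max_in) auto
    then obtain a where a: "(MAX a. infdist (- C a * ?x + ?y) \<int>) = infdist (- C a * ?x + ?y) \<int>" by blast
    have "K * \<bar>?x\<bar> powr (- l) \<le> infdist (- C a * ?x + ?y) \<int>" using 1 unfolding a .
    also have "- C a * ?x + ?y = real m * (\<theta> * (C b - C a))" by (simp add: algebra_simps)
    also have "infdist \<dots> \<int> \<le> cmod (ec (real m * (\<theta> * (C b - C a))) - 1)" by (rule infdist_int_le_ec)
    also have "\<dots> \<le> m * cmod (ec (\<theta> * (C b - C a)) - 1)" by (rule ec_power_dist)
    finally have "K * (real m powr - l * \<bar>\<theta>\<bar> powr - l) \<le> m * cmod (ec (\<theta> * (C b - C a)) - 1)"
      by (simp add: abs_mult powr_mult)
    then have "K0 * \<bar>\<theta>\<bar> powr - l \<le> cmod (ec (\<theta> * (C b - C a)) - 1)"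
      using m by (simp add: K0_def field_simps)
    then show ?thesis by blast
  qed
  then show ?thesis using that K0 unfolding C_def by blast
qed

end

theorem theorem2p5:
  fixes r :: real
    and I :: "real set"
    and f :: "'a::finite \<Rightarrow> real \<Rightarrow> real"
    and p :: "'a \<Rightarrow> real"
    and \<rho> C6 \<theta>0 :: real
  assumes r: "r \<ge> 2"
    and ifs: "Cr_ifs r I f"
    and contracting: "uniformly_contracting I f"
    and orientation: "orientation_preserving I f"
    and dichotomy: "diophantine I f \<or> \<not> conjugate_to_linear r I f"
    and p_pos: "\<And>a. p a > 0"
    and p_sum: "(\<Sum>a\<in>UNIV. p a) = 1"
    and rho: "\<rho> = max_contraction I f"
    and C6_pos: "C6 > 0"
    and C6: "\<And>\<theta> n. \<theta> \<noteq> 0 \<Longrightarrow> theta_opnorm \<rho> C6 \<theta> (transfer_op I f p \<theta> ^^ n) \<le> 1"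
    and theta0: "\<theta>0 > 1"
  shows "\<exists>\<alpha>>0. \<exists>\<beta>>0. \<exists>C>0. \<forall>\<theta>. \<bar>\<theta>\<bar> > \<theta>0 \<longrightarrow>
           theta_opnorm \<rho> C6 \<theta> (transfer_op I f p \<theta> ^^ num_iter \<beta> \<theta>) \<le> 1 - C / \<bar>\<theta>\<bar> powr \<alpha>"
proof -
  interpret F: conformal_ifs r I f
    using r ifs contracting orientation by unfold_locales
  obtain Lc where Lc: "0 < Lc"
    "\<And>a \<omega> \<omega>'. \<bar>cocycle I f a \<omega> - cocycle I f a \<omega>'\<bar> \<le> Lc * word_dist (max_contraction I f) \<omega> \<omega>'"
    using F.cocycle_lipschitz by blast
  interpret S: phase_cocycle \<rho> Lc "cocycle I f" p
    by unfold_locales (use F.rho_bounds Lc p_pos p_sum in \<open>auto simp: rho\<close>)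
  have op: "transfer_op I f p \<theta> = S.P \<theta>" for \<theta>
  proof (intro ext)
    fix \<phi> \<omega>
    have "exp (2 * of_real pi * \<i> * of_real \<theta> * of_real (cocycle I f a \<omega>)) = ec (\<theta> * cocycle I f a \<omega>)" for a
      by (simp add: ec_def cis_conv_exp mult_ac)
    then show "transfer_op I f p \<theta> \<phi> \<omega> = S.P \<theta> \<phi> \<omega>" by (simp add: transfer_op_def S.P_def)
  qed
  \<comment> \<open>Any letter will do; \<open>a0\<close> is the one whose linearization enters the
    nonlinear alternative, through the words \<open>replicate k a0\<close>.\<close>
  define a0 :: 'a where "a0 = undefined"
  have bc: "S.bc (replicate k a0) \<omega> = - F.birkhoff a0 k (coding I f \<omega>)" for k \<omega>
  proof (induction k)
    case (Suc k)
    have "cocycle I f a0 (foldr prepend (replicate k a0) \<omega>) = - ln (F.df a0 ((f a0 ^^ k) (coding I f \<omega>)))"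
      unfolding cocycle_def F.coding_foldr by simp
    then show ?case by (simp only: replicate_Suc S.bc.simps Suc) (simp add: F.birkhoff_def)
  qed (simp add: F.birkhoff_def)
  have "\<exists>K0>0. \<exists>l k0. \<forall>\<theta> k. 1 < \<bar>\<theta>\<bar> \<longrightarrow> k0 \<le> k \<longrightarrow>
    (\<exists>a b. K0 * \<bar>\<theta>\<bar> powr - l \<le> cmod (ec (\<theta> * (cocycle I f a (\<lambda>_. a) - cocycle I f b (\<lambda>_. b))) - 1)) \<or>
    (\<exists>w b \<omega> \<omega>'. length w = k \<and> K0 * \<bar>\<theta>\<bar> powr - l \<le> cmod (ec (\<theta> * (S.defect w b \<omega> - S.defect w b \<omega>')) - 1))"
    using dichotomy
  proof
    assume "diophantine I f"
    then show ?thesis using F.diophantine_gap by metis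
  next
    assume nl: "\<not> conjugate_to_linear r I f"
    define \<Psi> where "\<Psi> b k x = F.birkhoff a0 k (f b x) + ln (deriv_within I (f b) x) - F.birkhoff a0 k x" for b k x
    obtain b k0 K0 l where K0: "0 < K0" and gap:
      "\<And>\<theta> k. 1 < \<bar>\<theta>\<bar> \<Longrightarrow> k0 \<le> k \<Longrightarrow> \<exists>\<omega> \<omega>'.
       K0 * \<bar>\<theta>\<bar> powr - l \<le> \<bar>\<theta> * (\<Psi> b k (coding I f \<omega>) - \<Psi> b k (coding I f \<omega>'))\<bar> \<and>
       \<bar>\<theta> * (\<Psi> b k (coding I f \<omega>) - \<Psi> b k (coding I f \<omega>'))\<bar> \<le> 1/2"
      using F.nonlinear_gap[OF nl, of a0] unfolding \<Psi>_def by metis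
    \<comment> \<open>The minus sign in \<open>cocycle\<close> turns \<open>bc\<close> into minus a
      Birkhoff sum, so the three terms of the defect reproduce \<Psi> with its signs.\<close>
    have D: "S.defect (replicate k a0) b \<omega> = \<Psi> b k (coding I f \<omega>)" for b k \<omega>
      by (simp add: S.defect_def bc \<Psi>_def cocycle_def F.coding_prepend)
    have "\<exists>w b \<omega> \<omega>'. length w = k \<and> K0 * \<bar>\<theta>\<bar> powr - l \<le> cmod (ec (\<theta> * (S.defect w b \<omega> - S.defect w b \<omega>')) - 1)"
      if \<theta>k: "1 < \<bar>\<theta>\<bar>" "k0 \<le> k" for \<theta> k
    proof -
      \<comment> \<open>The bound by \<open>1/2\<close> is what allows \<open>ec_ge\<close> to pass
        from the phase difference to a distance on the circle.\<close>
      obtain \<omega> \<omega>' where "K0 * \<bar>\<theta>\<bar> powr - l \<le> cmod (ec (\<theta> * (\<Psi> b k (coding I f \<omega>) - \<Psi> b k (coding I f \<omega>'))) - 1)"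
        using gap[OF \<theta>k] ec_ge by (meson order_trans)
      then show ?thesis
        by (intro exI[of _ "replicate k a0"] exI[of _ b] exI[of _ \<omega>] exI[of _ \<omega>']) (simp add: D)
    qed
    then show ?thesis by (intro exI[of _ K0] exI[of _ l] exI[of _ k0] conjI K0 allI impI disjI2)
  qed
  then obtain K0 l k0 where K0: "0 < K0" and gap: "\<And>\<theta> k. 1 < \<bar>\<theta>\<bar> \<Longrightarrow> k0 \<le> k \<Longrightarrow>
    (\<exists>a b. K0 * \<bar>\<theta>\<bar> powr - l \<le> cmod (ec (\<theta> * (cocycle I f a (\<lambda>_. a) - cocycle I f b (\<lambda>_. b))) - 1)) \<or>
    (\<exists>w b \<omega> \<omega>'. length w = k \<and> K0 * \<bar>\<theta>\<bar> powr - l \<le> cmod (ec (\<theta> * (S.defect w b \<omega> - S.defect w b \<omega>')) - 1))"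
    by metis
  show ?thesis
    unfolding op
  proof (rule S.theta_opnorm_decay[OF C6_pos theta0 C6[unfolded op]])
    fix M assume M: "2 * pi * Lc / (1 - \<rho>) \<le> M"
    show "\<exists>\<alpha>>0. \<exists>\<beta>>0. \<forall>\<theta> \<phi> n \<omega>. \<theta>0 < \<bar>\<theta>\<bar> \<longrightarrow> S.bounded_by 1 \<phi> \<longrightarrow> S.lip (M * \<bar>\<theta>\<bar>) \<phi> \<longrightarrow>
      \<beta> * ln \<bar>\<theta>\<bar> \<le> real n \<longrightarrow> cmod ((S.P \<theta> ^^ n) \<phi> \<omega>) \<le> 1 - \<bar>\<theta>\<bar> powr - \<alpha>"
      by (rule S.sup_norm_decay[OF theta0 K0 M gap]) (use theta0 in auto)
  qed
qed

end
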